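(* For any $\tilde\tau_h\in V_h$, the operator $\tilde{\mathcal A}_{h,\tilde\tau_h}:Z_h\to (Z_h)'$ defined by $\langle\tilde{\mathcal A}_{h,\tilde\tau_h}w_h,v_h\rangle=a_h(w_h+\tilde\tau_h,v_h)$ for $w_h,v_h\in Z_h$ is continuous: for $w_h,z_h\in Z_h$ (with $w_h$ fixed), $$\|\tilde{\mathcal A}_{h,\tilde\tau_h}w_h-\tilde{\mathcal A}_{h,\tilde\tau_h}z_h\|_{(Z_h)'}\to0\quad\text{as}\quad \|w_h-z_h\|_{Z_h}\to0 .$$
   Context: Setting. $\Omega\subset\mathbb R^2$ is an open, bounded, connected polygonal domain with Lipschitz boundary; $p\in(1,\infty)$ and the integer $k\ge0$ are fixed; $p'=p/(p-1)$. $\Omega_h$ (a member of a family of meshes) is a decomposition of $\Omega$ into nonoverlapping polygonal elements $E$; $h_E$, $|E|$, $x_E$, $\mathcal E_E$ are the diameter, area, barycenter and set of edges of $E$; $h_e$, $x_e$, $n_e$ are the length, midpoint and a fixed unit normal of an edge $e$. Mesh regularity: there is $\rho>0$ (uniform over the family) such that every $E$ is star-shaped with respect to a disk of radius $\ge\rho h_E$ and $h_e\ge\rho h_E$ for all $e\in\mathcal E_E$. $\mathcal P^\ell(Y)$: polynomials of total degree $\le\ell$ on $Y$ ($\mathcal P^{-1}=\{0\}$); $\pi_E$: $L^2(E)$-orthogonal projector of vector fields onto $\mathcal P^k(E)^2$. $\operatorname{rot}w=\partial_1w_2-\partial_2w_1$; $(a_1,a_2)^\perp=(-a_2,a_1)$.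 Spaces. $V_h(E)=\{v\in H(\mathrm{div};E)\cap H(\mathrm{rot};E): v\cdot n_e\in\mathcal P^k(e)\ \forall e\in\mathcal E_E,\ \nabla\cdot v\in\mathcal P^k(E),\ \operatorname{rot}v\in\mathcal P^{k-1}(E)\}$. $\mathrm{dof}_E(v)\in\mathbb R^{N_E}$, $N_E=\dim V_h(E)$, is the vector of degrees of freedom: (i) $\frac1{h_e}\int_e (v\cdot n_e)m$ for each $e\in\mathcal E_E$, $m=((x-x_e)/h_e)^\alpha$, $0\le\alpha\le k$ ($x$ a length coordinate on $e$); (ii) $\frac{h_E}{|E|}\int_E v\cdot\nabla m$, $m=((x-x_E)/h_E)^{\alpha}$, $1\le|\alpha|\le k$; (iii) $\frac1{|E|}\int_E v\cdot\left(\frac{x-x_E}{h_E}\right)^\perp m$, $m=((x-x_E)/h_E)^{\alpha}$, $|\alpha|\le k-1$. $V_h=\{v\in H(\mathrm{div};\Omega): v|_E\in V_h(E)\ \forall E\in\Omega_h\}$ and $Z_h=\{v\in V_h:\nabla\cdot v=0\}$. Forms and norm. $a_E(w,v)=\int_E|w|^{p'-2}w\cdot v$; $s_E(w,v)=h_E^2|\mathrm{dof}_E(w)|^{p'-2}\mathrm{dof}_E(w)\cdot\mathrm{dof}_E(v)$ (with $|A|^{p'-2}A:=0$ at $A=0$); $a_h(w,v)=\sum_{E\in\Omega_h}[a_E(\pi_Ew,\pi_Ev)+s_E(w-\pi_Ew,v-\pi_Ev)]$. $Z_h$ is endowed with the norm $\|w\|_{Z_h}=a_h(w,w)^{1/p'}$,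 and $(Z_h)'$ with the corresponding dual norm. *)

theory Defs
  imports "HOL-Analysis.Analysis" "HOL-Computational_Algebra.Polynomial"
begin

section \<open>Function spaces and weak derivatives in the plane\<close>

type_synonym vfield = "real^2 \<Rightarrow> real^2"

definition perp :: "real^2 \<Rightarrow> real^2"
  where "perp a = vector [- (a $ 2), a $ 1]"

definition grad :: "(real^2 \<Rightarrow> real) \<Rightarrow> vfield"
  where "grad f x = (\<chi> i. frechet_derivative f (at x) (axis i 1))"

primrec Ck :: "nat \<Rightarrow> (real^2 \<Rightarrow> real) \<Rightarrow> bool" where
  "Ck 0 f \<longleftrightarrow> continuous_on UNIV f"
| "Ck (Suc m) f \<longleftrightarrow> (\<forall>x. f differentiable at x) \<and> (\<forall>i. Ck m (\<lambda>x. grad f x $ i))"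

definition smooth :: "(real^2 \<Rightarrow> real) \<Rightarrow> bool"
  where "smooth f \<longleftrightarrow> (\<forall>m. Ck m f)"

definition test_functions :: "(real^2) set \<Rightarrow> (real^2 \<Rightarrow> real) set"
  where "test_functions D =
    {\<phi>. smooth \<phi> \<and> compact (closure {x. \<phi> x \<noteq> 0}) \<and> closure {x. \<phi> x \<noteq> 0} \<subseteq> D}"

text \<open>Elements of Lebesgue and Sobolev-type spaces are represented by everywhere-defined
  functions; values outside the domain and on null sets are irrelevant.\<close>

definition L2 :: "(real^2) set \<Rightarrow> (real^2 \<Rightarrow> 'b::euclidean_space) set"
  where "L2 D = {v. v \<in> borel_measurable (lebesgue_on D)
    \<and> integrable (lebesgue_on D) (\<lambda>x. (norm (v x))\<^sup>2)}"

definition weak_div :: "(real^2) set \<Rightarrow> vfield \<Rightarrow> (real^2 \<Rightarrow> real) \<Rightarrow> bool"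
  where "weak_div D v g \<longleftrightarrow> (\<forall>\<phi> \<in> test_functions D.
    integral\<^sup>L (lebesgue_on D) (\<lambda>x. v x \<bullet> grad \<phi> x)
      = - integral\<^sup>L (lebesgue_on D) (\<lambda>x. g x * \<phi> x))"

definition weak_rot :: "(real^2) set \<Rightarrow> vfield \<Rightarrow> (real^2 \<Rightarrow> real) \<Rightarrow> bool"
  where "weak_rot D v r \<longleftrightarrow> (\<forall>\<phi> \<in> test_functions D.
    integral\<^sup>L (lebesgue_on D) (\<lambda>x. v x $ 2 * grad \<phi> x $ 1 - v x $ 1 * grad \<phi> x $ 2)
      = - integral\<^sup>L (lebesgue_on D) (\<lambda>x. r x * \<phi> x))"

definition Hdiv :: "(real^2) set \<Rightarrow> vfield set"
  where "Hdiv D = {v. v \<in> L2 D \<and> (\<exists>g \<in> L2 D. weak_div D v g)}"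

definition Hrot :: "(real^2) set \<Rightarrow> vfield set"
  where "Hrot D = {v. v \<in> L2 D \<and> (\<exists>r \<in> L2 D. weak_rot D v r)}"


section \<open>Polynomials\<close>

text \<open>The degree bound is an integer so that the bound \<open>-1\<close> gives the zero space.\<close>

definition polys :: "int \<Rightarrow> (real^2 \<Rightarrow> real) set"
  where "polys l = {q. \<exists>c :: nat \<Rightarrow> nat \<Rightarrow> real. \<forall>x.
    q x = (\<Sum>(i, j) | int i + int j \<le> l. c i j * (x $ 1) ^ i * (x $ 2) ^ j)}"

definition vpolys :: "int \<Rightarrow> vfield set"
  where "vpolys l = {q. \<forall>i. (\<lambda>x. q x $ i) \<in> polys l}"

definition proj :: "nat \<Rightarrow> (real^2) set \<Rightarrow> vfield \<Rightarrow> vfield"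
  where "proj k D w = (SOME q. q \<in> vpolys (int k) \<and>
    (\<forall>r \<in> vpolys (int k). integral\<^sup>L (lebesgue_on D) (\<lambda>x. (w x - q x) \<bullet> r x) = 0))"


section \<open>Polygonal domains and meshes\<close>

definition lipschitz_boundary :: "(real^2) set \<Rightarrow> bool"
  where "lipschitz_boundary S \<longleftrightarrow> (\<forall>z \<in> frontier S. \<exists>d g L r h.
    norm d = 1 \<and> L-lipschitz_on UNIV g \<and> 0 < r \<and> 0 < h \<and>
    (\<forall>s t :: real. \<bar>s\<bar> < r \<longrightarrow> \<bar>t\<bar> < h \<longrightarrow>
      (z + s *\<^sub>R perp d + t *\<^sub>R d \<in> S \<longleftrightarrow> t < g s)))"

definition polygonal_domain :: "(real^2) set \<Rightarrow> bool"
  where "polygonal_domain S \<longleftrightarrow> S \<noteq> {} \<and> open S \<and> bounded S \<and> connected S \<and>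
    (\<exists>T. finite T \<and> frontier S = (\<Union>(a, b) \<in> T. closed_segment a b)) \<and>
    lipschitz_boundary S"

text \<open>An element is given by the cyclic list of its vertices (consecutive edges may be
  aligned, so hanging nodes are allowed), and an edge by the set of its two endpoints, so
  that an edge shared by two elements is one and the same object.\<close>

type_synonym edge = "(real^2) set"
type_synonym element = "(real^2) list"

definition edges :: "element \<Rightarrow> edge set"
  where "edges E = {{E ! i, E ! (Suc i mod length E)} | i. i < length E}"

definition simple_polygon :: "element \<Rightarrow> bool"
  where "simple_polygon E \<longleftrightarrow> 3 \<le> length E \<and> distinct E \<and>
    (\<forall>e \<in> edges E. \<forall>f \<in> edges E. e \<noteq> f \<longrightarrow> convex hull e \<inter> convex hull f = e \<inter> f)"

definition cell :: "element \<Rightarrow> (real^2) set"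
  where "cell E = inside (\<Union>e \<in> edges E. convex hull e)"

definition elt_diam :: "element \<Rightarrow> real"
  where "elt_diam E = diameter (cell E)"

definition elt_area :: "element \<Rightarrow> real"
  where "elt_area E = measure lebesgue (cell E)"

definition elt_bary :: "element \<Rightarrow> real^2"
  where "elt_bary E = (1 / elt_area E) *\<^sub>R integral\<^sup>L (lebesgue_on (cell E)) (\<lambda>x. x)"

definition edge_len :: "edge \<Rightarrow> real"
  where "edge_len e = diameter e"

definition edge_mid :: "edge \<Rightarrow> real^2"
  where "edge_mid e = (1 / 2) *\<^sub>R (\<Sum>a \<in> e. a)"

definition decomposition :: "(real^2) set \<Rightarrow> element set \<Rightarrow> bool"
  where "decomposition \<Omega> M \<longleftrightarrow> finite M \<and> (\<forall>E \<in> M. simple_polygon E \<and> cell E \<subseteq> \<Omega>) \<and>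
    (\<forall>E \<in> M. \<forall>F \<in> M. E \<noteq> F \<longrightarrow> cell E \<inter> cell F = {}) \<and>
    (\<Union>E \<in> M. closure (cell E)) = closure \<Omega>"

definition mesh_regular :: "real \<Rightarrow> element set \<Rightarrow> bool"
  where "mesh_regular \<rho> M \<longleftrightarrow> 0 < \<rho> \<and> (\<forall>E \<in> M.
    (\<exists>c r. 0 < r \<and> \<rho> * elt_diam E \<le> r \<and> ball c r \<subseteq> cell E \<and>
      (\<forall>y \<in> ball c r. \<forall>x \<in> cell E. closed_segment y x \<subseteq> cell E)) \<and>
    (\<forall>e \<in> edges E. \<rho> * elt_diam E \<le> edge_len e))"

definition unit_normals :: "element set \<Rightarrow> (edge \<Rightarrow> real^2) \<Rightarrow> bool"
  where "unit_normals M n \<longleftrightarrow> (\<forall>E \<in> M. \<forall>e \<in> edges E.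
    norm (n e) = 1 \<and> (\<forall>a \<in> e. \<forall>b \<in> e. n e \<bullet> (a - b) = 0))"


section \<open>Normal traces, local spaces and degrees of freedom\<close>

text \<open>Edges are parametrised by arc length \<open>s\<close>, measured from the midpoint in the direction
  \<open>perp (n e)\<close>; polynomials on an edge are univariate polynomials in \<open>s\<close>.\<close>

definition edge_point :: "(edge \<Rightarrow> real^2) \<Rightarrow> edge \<Rightarrow> real \<Rightarrow> real^2"
  where "edge_point n e s = edge_mid e + s *\<^sub>R perp (n e)"

definition edge_integral :: "edge \<Rightarrow> (real \<Rightarrow> real) \<Rightarrow> real"
  where "edge_integral e f = integral\<^sup>L (lebesgue_on {- edge_len e / 2 .. edge_len e / 2}) f"

text \<open>The scalar product of \<open>n e\<close> with the outward unit normal of the element:\<close>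

definition edge_sign :: "(edge \<Rightarrow> real^2) \<Rightarrow> element \<Rightarrow> edge \<Rightarrow> real"
  where "edge_sign n E e =
    (if \<forall>\<^sub>F t in at_right 0. edge_mid e + t *\<^sub>R n e \<notin> cell E then 1 else -1)"

text \<open>For \<open>v\<close> in \<open>Hdiv (cell E)\<close> the normal trace is a functional on the boundary, given by
  Green's formula, and its restriction to an edge \<open>e\<close> is obtained by testing with functions
  whose support does not meet the other edges. The following says that on \<open>e\<close> the component
  \<open>v \<bullet> n e\<close> is the polynomial \<open>q\<close>.\<close>

definition has_normal_trace ::
    "(edge \<Rightarrow> real^2) \<Rightarrow> element \<Rightarrow> edge \<Rightarrow> vfield \<Rightarrow> real poly \<Rightarrow> bool"
  where "has_normal_trace n E e v q \<longleftrightarrow> (\<exists>g \<in> L2 (cell E). weak_div (cell E) v g \<and>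
    (\<forall>\<phi> \<in> test_functions (- (\<Union>f \<in> edges E - {e}. convex hull f)).
      integral\<^sup>L (lebesgue_on (cell E)) (\<lambda>x. v x \<bullet> grad \<phi> x + g x * \<phi> x) =
      edge_sign n E e * edge_integral e (\<lambda>s. poly q s * \<phi> (edge_point n e s))))"

text \<open>Meaningful for fields whose normal component on \<open>e\<close> is a polynomial, which is then
  unique:\<close>

definition normal_trace :: "(edge \<Rightarrow> real^2) \<Rightarrow> element \<Rightarrow> edge \<Rightarrow> vfield \<Rightarrow> real poly"
  where "normal_trace n E e v = (SOME q. has_normal_trace n E e v q)"

definition Vloc :: "nat \<Rightarrow> (edge \<Rightarrow> real^2) \<Rightarrow> element \<Rightarrow> vfield set"
  where "Vloc k n E = {v. v \<in> Hdiv (cell E) \<inter> Hrot (cell E) \<and>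
    (\<forall>e \<in> edges E. \<exists>q. degree q \<le> k \<and> has_normal_trace n E e v q) \<and>
    (\<exists>g \<in> polys (int k). weak_div (cell E) v g) \<and>
    (\<exists>r \<in> polys (int k - 1). weak_rot (cell E) v r)}"

definition scaled_monomial :: "element \<Rightarrow> nat \<Rightarrow> nat \<Rightarrow> real^2 \<Rightarrow> real"
  where "scaled_monomial E i j x =
    ((x $ 1 - elt_bary E $ 1) / elt_diam E) ^ i * ((x $ 2 - elt_bary E $ 2) / elt_diam E) ^ j"

text \<open>The vector of degrees of freedom is indexed by a finite set of labels rather than by
  numbers; only its Euclidean scalar product and norm are used.\<close>

datatype dof_index = Edge_dof edge nat | Grad_dof nat nat | Perp_dof nat nat

definition dof_indices :: "nat \<Rightarrow> element \<Rightarrow> dof_index set"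
  where "dof_indices k E =
    {Edge_dof e i | e i. e \<in> edges E \<and> i \<le> k} \<union>
    {Grad_dof i j | i j. 1 \<le> i + j \<and> i + j \<le> k} \<union>
    {Perp_dof i j | i j. int i + int j \<le> int k - 1}"

primrec dof :: "(edge \<Rightarrow> real^2) \<Rightarrow> element \<Rightarrow> vfield \<Rightarrow> dof_index \<Rightarrow> real" where
  "dof n E v (Edge_dof e i) = 1 / edge_len e *
     edge_integral e (\<lambda>s. poly (normal_trace n E e v) s * (s / edge_len e) ^ i)"
| "dof n E v (Grad_dof i j) = elt_diam E / elt_area E *
     integral\<^sup>L (lebesgue_on (cell E)) (\<lambda>x. v x \<bullet> grad (scaled_monomial E i j) x)"
| "dof n E v (Perp_dof i j) = 1 / elt_area E *
     integral\<^sup>L (lebesgue_on (cell E))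
       (\<lambda>x. v x \<bullet> perp ((1 / elt_diam E) *\<^sub>R (x - elt_bary E)) * scaled_monomial E i j x)"


section \<open>Global spaces, forms and norms\<close>

definition Vh :: "nat \<Rightarrow> (edge \<Rightarrow> real^2) \<Rightarrow> (real^2) set \<Rightarrow> element set \<Rightarrow> vfield set"
  where "Vh k n \<Omega> M = {v. v \<in> Hdiv \<Omega> \<and> (\<forall>E \<in> M. v \<in> Vloc k n E)}"

definition Zh :: "nat \<Rightarrow> (edge \<Rightarrow> real^2) \<Rightarrow> (real^2) set \<Rightarrow> element set \<Rightarrow> vfield set"
  where "Zh k n \<Omega> M = {v \<in> Vh k n \<Omega> M. weak_div \<Omega> v (\<lambda>x. 0)}"

definition conj_exp :: "real \<Rightarrow> real"
  where "conj_exp p = p / (p - 1)"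

text \<open>Since \<open>0 powr t = 0\<close> for every \<open>t\<close>, the convention that the nonlinearities vanish at
  zero is built in.\<close>

definition form_a :: "real \<Rightarrow> element \<Rightarrow> vfield \<Rightarrow> vfield \<Rightarrow> real"
  where "form_a p E w v = integral\<^sup>L (lebesgue_on (cell E))
    (\<lambda>x. norm (w x) powr (conj_exp p - 2) * (w x \<bullet> v x))"

definition form_s ::
    "real \<Rightarrow> nat \<Rightarrow> (edge \<Rightarrow> real^2) \<Rightarrow> element \<Rightarrow> vfield \<Rightarrow> vfield \<Rightarrow> real"
  where "form_s p k n E w v = (elt_diam E)\<^sup>2 *
    L2_set (dof n E w) (dof_indices k E) powr (conj_exp p - 2) *
    (\<Sum>\<iota> \<in> dof_indices k E. dof n E w \<iota> * dof n E v \<iota>)"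

definition form_h ::
    "real \<Rightarrow> nat \<Rightarrow> (edge \<Rightarrow> real^2) \<Rightarrow> element set \<Rightarrow> vfield \<Rightarrow> vfield \<Rightarrow> real"
  where "form_h p k n M w v = (\<Sum>E \<in> M.
    form_a p E (proj k (cell E) w) (proj k (cell E) v) +
    form_s p k n E (\<lambda>x. w x - proj k (cell E) w x) (\<lambda>x. v x - proj k (cell E) v x))"

definition normZ :: "real \<Rightarrow> nat \<Rightarrow> (edge \<Rightarrow> real^2) \<Rightarrow> element set \<Rightarrow> vfield \<Rightarrow> real"
  where "normZ p k n M w = form_h p k n M w w powr (1 / conj_exp p)"

text \<open>The bounded linear functionals on a space \<open>Z\<close> of functions with respect to \<open>N\<close>, and
  their operator norm. Boundedness together with linearity makes a functional independent of
  the representative.\<close>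

definition dual_space :: "vfield set \<Rightarrow> (vfield \<Rightarrow> real) \<Rightarrow> (vfield \<Rightarrow> real) set"
  where "dual_space Z N = {F.
    (\<forall>u \<in> Z. \<forall>v \<in> Z. \<forall>a b. F (\<lambda>x. a *\<^sub>R u x + b *\<^sub>R v x) = a * F u + b * F v) \<and>
    (\<exists>C. \<forall>v \<in> Z. \<bar>F v\<bar> \<le> C * N v)}"

definition dual_norm :: "vfield set \<Rightarrow> (vfield \<Rightarrow> real) \<Rightarrow> (vfield \<Rightarrow> real) \<Rightarrow> real"
  where "dual_norm Z N F = (SUP v \<in> {v \<in> Z. N v \<le> 1}. \<bar>F v\<bar>)"

definition op_A ::
    "real \<Rightarrow> nat \<Rightarrow> (edge \<Rightarrow> real^2) \<Rightarrow> element set \<Rightarrow> vfield \<Rightarrow> vfield \<Rightarrow> vfield \<Rightarrow> real"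
  where "op_A p k n M \<tau> w = (\<lambda>v. form_h p k n M (\<lambda>x. w x + \<tau> x) v)"

end

theory Submission
  imports Defs
begin

text \<open>Put \<open>q = p'\<close>. Once the projections \<open>\<pi>\<^sub>E\<close> and the degrees of freedom of \<open>v - \<pi>\<^sub>E v\<close> are known
  to be linear in \<open>v\<close>, the form \<open>a\<^sub>h\<close> is a sum of terms \<open>|a|^(q-2) a \<cdot> c\<close> integrated over the
  elements or evaluated on vectors of degrees of freedom. For every \<open>\<eta> > 0\<close> there is a \<open>C\<close> with
  \<open>| |a|^(q-2) a \<cdot> c - |b|^(q-2) b \<cdot> c | \<le> \<eta> (|a|^q + |c|^q) + C |a - b|^q\<close>; summing this with
  \<open>a, b, c\<close> coming from \<open>w + \<tau>\<close>, \<open>z + \<tau>\<close>, \<open>v\<close> gives continuity without Hoelder's inequality, and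
  \<open>| |a|^(q-2) a \<cdot> c | \<le> |a|^q + |c|^q\<close> together with homogeneity in \<open>c\<close> gives boundedness.

  Linearity of the edge degrees of freedom needs that \<open>v - \<pi>\<^sub>E v\<close> has exactly one polynomial normal
  trace. Existence for the polynomial part is Green's formula localised to one edge: in coordinates
  along and across the edge the field times a test function, cut off outside the element, is
  smooth except for a jump across the edge, so Fubini and the fundamental theorem of calculus
  suffice. It is enough that each side of the edge lies inside or outside the element; that
  exactly one side lies inside (the Jordan curve theorem) is irrelevant.\<close>

section \<open>Smooth test functions\<close>

text \<open>The scalar inequality is asymmetric: its right-hand side contains |a|^q but not |b|^q.
  As \<open>a\<close> belongs to the fixed field w + \<tau>, the energy of z + \<tau> never enters,
  and on the unit ball the energy of v is at most 1. The order of choice is therefore \<eta> from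
  \<epsilon> and the energy of w + \<tau>, then C from \<eta>, then \<delta> from C. Both
  \<open>proj\<close> and \<open>normal_trace\<close> are values of a choice operator, so each must
  be pinned down by uniqueness before it can be linear. For \<open>proj\<close>, the difference of
  two candidates is orthogonal to itself. For \<open>normal_trace\<close>, the difference d of two
  candidates is used as a factor of the test function, which produces the integral of d^2 against a
  positive weight. A field of V_h(E) has traces by definition, but its projection is only known to
  be a polynomial, which is why a Green formula has to be proved at all.\<close>

lemma frechet_derivative_grad:
  assumes "f differentiable at x"
  shows "frechet_derivative f (at x) v = grad f x \<bullet> v"
proof -
  have lin: "linear (frechet_derivative f (at x))"
    using assms by (rule linear_frechet_derivative)
  have "frechet_derivative f (at x) v = frechet_derivative f (at x) (\<Sum>i\<in>UNIV. v $ i *\<^sub>R axis i 1)"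
    using basis_expansion[of v] by (simp add: scalar_mult_eq_scaleR)
  also have "\<dots> = (\<Sum>i\<in>UNIV. v $ i * frechet_derivative f (at x) (axis i 1))"
    by (simp add: linear_sum[OF lin] linear_scale[OF lin])
  also have "\<dots> = grad f x \<bullet> v"
    by (simp add: grad_def inner_vec_def mult.commute)
  finally show ?thesis .
qed

lemma has_derivative_grad:
  assumes "f differentiable at x"
  shows "(f has_derivative (\<lambda>v. grad f x \<bullet> v)) (at x)"
proof -
  have "frechet_derivative f (at x) = (\<lambda>v. grad f x \<bullet> v)"
    using frechet_derivative_grad[OF assms] by (rule ext)
  then show ?thesis using assms unfolding frechet_derivative_works by simp
qed

lemma grad_eqI:
  assumes "(f has_derivative (\<lambda>v. G \<bullet> v)) (at x)"
  shows "grad f x = G"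
  unfolding grad_def frechet_derivative_at[OF assms, symmetric]
  by (simp add: vec_eq_iff inner_axis)

lemma test_function_differentiable:
  assumes "\<phi> \<in> test_functions D"
  shows "\<phi> differentiable at x"
proof -
  have "Ck (Suc 0) \<phi>" using assms unfolding test_functions_def smooth_def by blast
  then show ?thesis by simp
qed

lemma test_function_continuous:
  assumes "\<phi> \<in> test_functions D"
  shows "continuous_on UNIV \<phi>"
  by (meson assms continuous_at_imp_continuous_on differentiable_imp_continuous_within
      test_function_differentiable)

lemma test_function_grad_continuous:
  assumes "\<phi> \<in> test_functions D"
  shows "continuous_on UNIV (grad \<phi>)"
proof -
  have "Ck (Suc 0) \<phi>" using assms unfolding test_functions_def smooth_def by blast
  then have "\<forall>i. continuous_on UNIV (\<lambda>x. grad \<phi> x $ i)" by simp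
  then show ?thesis
    using continuous_on_vec_lambda[of UNIV "\<lambda>i x. grad \<phi> x $ i"] by simp
qed

section \<open>Flat exponentials, the source of compactly supported smooth functions\<close>

text \<open>Allowing a polynomial in 1/t as a factor makes the family closed under differentiation;
  \<open>P = 1\<close> is the classical flat function.\<close>

definition exp_flat :: "real poly \<Rightarrow> real \<Rightarrow> real"
  where "exp_flat P t = (if 0 < t then poly P (1 / t) * exp (- (1 / t)) else 0)"

lemma poly_times_exp_neg_tendsto_0:
  "((\<lambda>y::real. poly P y * exp (- y)) \<longlongrightarrow> 0) at_top"
proof -
  have "((\<lambda>y. coeff P i * (y ^ i / exp y)) \<longlongrightarrow> coeff P i * 0) at_top" for i
    by (intro tendsto_intros tendsto_power_div_exp_0)
  then have "((\<lambda>y. \<Sum>i\<le>degree P. coeff P i * (y ^ i / exp y)) \<longlongrightarrow> (\<Sum>i\<le>degree P. 0)) at_top"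
    by (intro tendsto_sum) simp
  moreover have "(\<Sum>i\<le>degree P. coeff P i * (y ^ i / exp y)) = poly P y * exp (- y)" for y
    by (simp add: poly_altdef sum_distrib_right exp_minus divide_inverse mult.assoc)
  ultimately show ?thesis by simp
qed

lemma exp_flat_tendsto_0: "(exp_flat P \<longlongrightarrow> 0) (at 0)"
proof -
  have "filterlim (\<lambda>t::real. 1 / t) at_top (at_right 0)"
    by (simp add: filterlim_inverse_at_top_right inverse_eq_divide[symmetric])
  then have "((\<lambda>t. poly P (1 / t) * exp (- (1 / t))) \<longlongrightarrow> 0) (at_right 0)"
    by (rule filterlim_compose[OF poly_times_exp_neg_tendsto_0])
  moreover have "\<forall>\<^sub>F t in at_right (0::real). poly P (1 / t) * exp (- (1 / t)) = exp_flat P t"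
    by (auto simp: exp_flat_def eventually_at_right_field intro!: exI[of _ 1])
  ultimately have "(exp_flat P \<longlongrightarrow> 0) (at_right 0)"
    by (rule Lim_transform_eventually)
  moreover have "(exp_flat P \<longlongrightarrow> 0) (at_left 0)"
    by (rule Lim_transform_eventually[of "\<lambda>_. 0"])
      (auto simp: exp_flat_def eventually_at_left_field intro!: exI[of _ "-1"])
  ultimately show ?thesis by (simp add: filterlim_split_at)
qed

text \<open>With y = 1/t one has d/dt = - y^2 d/dy, and the y-derivative of P(y) exp(-y) is (P'(y) -
  P(y)) exp(-y); \<open>[:0, 0, 1:]\<close> is the factor y^2.\<close>

lemma exp_flat_has_real_derivative:
  "(exp_flat P has_real_derivative exp_flat ([:0, 0, 1:] * (P - pderiv P)) t) (at t)"
proof -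
  consider "t > 0" | "t < 0" | "t = 0" by linarith
  then show ?thesis
  proof cases
    case 1
    have "((\<lambda>t. poly P (1 / t) * exp (- (1 / t))) has_real_derivative
        exp_flat ([:0, 0, 1:] * (P - pderiv P)) t) (at t)"
      using 1 by (auto intro!: derivative_eq_intros DERIV_chain2[where f = "poly P"] poly_DERIV
          simp: exp_flat_def field_simps power2_eq_square)
    then show ?thesis
      by (rule DERIV_cong_ev[THEN iffD1, OF refl _ refl, rotated])
        (use 1 in \<open>auto simp: exp_flat_def eventually_nhds intro!: exI[of _ "{0<..}"]\<close>)
  next
    case 2
    have "((\<lambda>t. 0) has_real_derivative exp_flat ([:0, 0, 1:] * (P - pderiv P)) t) (at t)"
      using 2 by (simp add: exp_flat_def)
    then show ?thesis
      by (rule DERIV_cong_ev[THEN iffD1, OF refl _ refl, rotated])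
        (use 2 in \<open>auto simp: exp_flat_def eventually_nhds intro!: exI[of _ "{..<0}"]\<close>)
  next
    case 3
    \<comment> \<open>Dividing by h multiplies the polynomial by its variable 1/h, so the difference
      quotient at 0 is again a member of the family and tends to 0.\<close>
    have "(exp_flat P (0 + h) - exp_flat P 0) / h = exp_flat (pCons 0 P) h" if "h \<noteq> 0" for h
      using that by (simp add: exp_flat_def field_simps)
    then have "((\<lambda>h. (exp_flat P (0 + h) - exp_flat P 0) / h) \<longlongrightarrow> 0) (at 0)"
      by (intro Lim_transform_eventually[OF exp_flat_tendsto_0[of "pCons 0 P"]])
        (simp add: eventually_at_filter)
    then show ?thesis using 3 by (simp add: DERIV_def exp_flat_def)
  qed
qed

text \<open>A class of functions closed under partial derivatives; all its members are therefore
  smooth.\<close>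

inductive elementary :: "(real^2 \<Rightarrow> real) \<Rightarrow> bool" where
  elementary_const: "elementary (\<lambda>x. c)"
| elementary_coord: "elementary (\<lambda>x. x $ i)"
| elementary_bump: "elementary (\<lambda>x. exp_flat P (r - (x - c) \<bullet> (x - c)))"
| elementary_add: "elementary f \<Longrightarrow> elementary g \<Longrightarrow> elementary (\<lambda>x. f x + g x)"
| elementary_mult: "elementary f \<Longrightarrow> elementary g \<Longrightarrow> elementary (\<lambda>x. f x * g x)"

lemma elementary_uminus: "elementary f \<Longrightarrow> elementary (\<lambda>x. - f x)"
  using elementary_mult[OF elementary_const[of "-1"]] by simp

lemma elementary_diff: "elementary f \<Longrightarrow> elementary g \<Longrightarrow> elementary (\<lambda>x. f x - g x)"
  using elementary_add[OF _ elementary_uminus] by simp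

lemma elementary_power: "elementary f \<Longrightarrow> elementary (\<lambda>x. f x ^ i)"
  by (induction i) (auto intro: elementary_const elementary_mult)

lemma elementary_sum:
  "(\<And>i. i \<in> A \<Longrightarrow> elementary (f i)) \<Longrightarrow> elementary (\<lambda>x. \<Sum>i\<in>A. f i x)"
  by (induction A rule: infinite_finite_induct) (auto intro: elementary_const elementary_add)

lemma elementary_inner: "elementary (\<lambda>x. (x - a) \<bullet> b)"
  unfolding inner_vec_def
  by (auto intro!: elementary_sum elementary_mult elementary_diff elementary_coord elementary_const)

lemma elementary_poly: "elementary f \<Longrightarrow> elementary (\<lambda>x. poly P (f x))"
  by (induction P) (auto intro: elementary_const elementary_add elementary_mult)

text \<open>The gradient is carried along as a witness \<open>G\<close>: the product rule returns f
  and g as coefficients of the two gradients, so the induction closes only for functions and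
  gradient components together.\<close>

lemma elementary_derivative:
  assumes "elementary f"
  shows "\<exists>G. (\<forall>i. elementary (\<lambda>x. G x $ i)) \<and> (\<forall>x. (f has_derivative (\<lambda>v. G x \<bullet> v)) (at x))"
  using assms
proof induction
  case (elementary_const c)
  show ?case by (rule exI[of _ "\<lambda>_. 0"]) (auto intro: elementary.intros)
next
  case (elementary_coord i)
  have "((\<lambda>x::real^2. x $ i) has_derivative (\<lambda>v. axis i 1 \<bullet> v)) (at x)" for x
    using bounded_linear_imp_has_derivative[OF bounded_linear_vec_nth, of i]
    by (simp add: inner_axis' )
  then show ?case by (intro exI[of _ "\<lambda>_. axis i 1"]) (auto intro: elementary.intros)
next
  case (elementary_bump P r c)
  let ?Q = "[:0, 0, 1:] * (P - pderiv P)"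
  let ?s = "\<lambda>x::real^2. r - (x - c) \<bullet> (x - c)"
  let ?G = "\<lambda>x. (exp_flat ?Q (?s x) * (-2)) *\<^sub>R (x - c)"
  have "(?s has_derivative (\<lambda>v. (-2) * ((x - c) \<bullet> v))) (at x)" for x
    by (auto intro!: derivative_eq_intros simp: inner_commute inner_diff_left algebra_simps)
  then have "((\<lambda>x. exp_flat P (?s x)) has_derivative
      (\<lambda>v. ((-2) * ((x - c) \<bullet> v)) * exp_flat ?Q (?s x))) (at x)" for x
    by (rule has_derivative_eq_rhs[OF DERIV_compose_FDERIV[OF exp_flat_has_real_derivative]]) auto
  then have "((\<lambda>x. exp_flat P (?s x)) has_derivative (\<lambda>v. ?G x \<bullet> v)) (at x)" for x
    by (simp add: mult_ac)
  moreover have "elementary (\<lambda>x. ?G x $ i)" for i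
    unfolding vector_scaleR_component vector_minus_component real_scaleR_def
    by (intro elementary_mult elementary_diff elementary.intros)
  ultimately show ?case by (intro exI[of _ ?G]) auto
next
  case (elementary_add f g)
  then obtain F G where
    "\<forall>i. elementary (\<lambda>x. F x $ i)" "\<forall>x. (f has_derivative (\<lambda>v. F x \<bullet> v)) (at x)"
    "\<forall>i. elementary (\<lambda>x. G x $ i)" "\<forall>x. (g has_derivative (\<lambda>v. G x \<bullet> v)) (at x)" by blast
  then show ?case
    by (intro exI[of _ "\<lambda>x. F x + G x"])
      (auto intro!: elementary.intros has_derivative_eq_rhs[OF has_derivative_add] simp: inner_add_left)
next
  case (elementary_mult f g)
  then obtain F G where
    FG: "\<forall>i. elementary (\<lambda>x. F x $ i)" "\<forall>x. (f has_derivative (\<lambda>v. F x \<bullet> v)) (at x)"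
    "\<forall>i. elementary (\<lambda>x. G x $ i)" "\<forall>x. (g has_derivative (\<lambda>v. G x \<bullet> v)) (at x)" by blast
  have "((\<lambda>x. f x * g x) has_derivative (\<lambda>v. (f x *\<^sub>R G x + g x *\<^sub>R F x) \<bullet> v)) (at x)" for x
    by (rule has_derivative_eq_rhs[OF has_derivative_mult[OF FG(2)[rule_format] FG(4)[rule_format]]])
      (auto simp: inner_add_left)
  then show ?case using FG elementary_mult.hyps
    by (intro exI[of _ "\<lambda>x. f x *\<^sub>R G x + g x *\<^sub>R F x"]) (auto intro!: elementary.intros)
qed

lemma elementary_differentiable: "elementary f \<Longrightarrow> f differentiable at x"
  using elementary_derivative unfolding differentiable_def by blast

lemma elementary_continuous: "elementary f \<Longrightarrow> continuous_on UNIV f"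
  by (meson continuous_at_imp_continuous_on differentiable_imp_continuous_within
      elementary_differentiable)

lemma elementary_grad:
  assumes "elementary f" shows "elementary (\<lambda>x. grad f x $ i)"
proof -
  obtain G where "\<forall>i. elementary (\<lambda>x. G x $ i)" "\<forall>x. (f has_derivative (\<lambda>v. G x \<bullet> v)) (at x)"
    using elementary_derivative[OF assms] by blast
  then show ?thesis using grad_eqI by (metis (no_types, lifting) ext)
qed

lemma elementary_grad_continuous: "elementary f \<Longrightarrow> continuous_on UNIV (grad f)"
  using continuous_on_vec_lambda[of UNIV "\<lambda>i x. grad f x $ i"]
  by (simp add: elementary_continuous elementary_grad)

lemma elementary_smooth: "elementary f \<Longrightarrow> smooth f"
proof -
  have "elementary f \<Longrightarrow> Ck m f" for m
    by (induction m arbitrary: f)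
      (auto simp: elementary_continuous elementary_differentiable elementary_grad)
  then show "elementary f \<Longrightarrow> smooth f" by (simp add: smooth_def)
qed

lemma elementary_polys:
  assumes "q \<in> polys l" shows "elementary q"
proof -
  obtain c where "q = (\<lambda>x. \<Sum>(i, j) | int i + int j \<le> l. c i j * (x $ 1) ^ i * (x $ 2) ^ j)"
    using assms unfolding polys_def by auto
  then show ?thesis
    by (auto simp: case_prod_beta intro!: elementary_sum elementary_mult elementary_power elementary.intros)
qed

section \<open>Fubini in a rotated frame\<close>

text \<open>Orthonormal coordinates with origin \<open>m\<close>. For the midpoint and normal of an
  edge, t = 0 is the line of the edge and s is arc length on it.\<close>

definition frame_point :: "real^2 \<Rightarrow> real^2 \<Rightarrow> real \<Rightarrow> real \<Rightarrow> real^2"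
  where "frame_point m N s t = m + s *\<^sub>R perp N + t *\<^sub>R N"

lemma perp_component [simp]: "perp a $ 1 = - (a $ 2)" "perp a $ 2 = a $ 1"
  by (simp_all add: perp_def)

lemma inner_perp [simp]: "perp a \<bullet> a = 0" "a \<bullet> perp a = 0" "perp a \<bullet> perp b = a \<bullet> b"
  by (simp_all add: inner_vec_def sum_2 mult.commute)

lemma norm_perp [simp]: "norm (perp a) = norm a"
  by (simp add: norm_eq_sqrt_inner)

lemma frame_expansion:
  assumes "norm N = 1"
  shows "v = (v \<bullet> perp N) *\<^sub>R perp N + (v \<bullet> N) *\<^sub>R N"
proof -
  have N: "N $ 1 * N $ 1 + N $ 2 * N $ 2 = 1"
    using assms by (simp add: norm_eq_1 inner_vec_def sum_2)
  have "(v $ 2 * N $ 1 - v $ 1 * N $ 2) * (- N $ 2) + (v $ 1 * N $ 1 + v $ 2 * N $ 2) * N $ 1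
      = v $ 1 * (N $ 1 * N $ 1 + N $ 2 * N $ 2)"
    "(v $ 2 * N $ 1 - v $ 1 * N $ 2) * N $ 1 + (v $ 1 * N $ 1 + v $ 2 * N $ 2) * N $ 2
      = v $ 2 * (N $ 1 * N $ 1 + N $ 2 * N $ 2)"
    by (simp_all add: algebra_simps)
  then show ?thesis
    by (simp add: vec_eq_iff forall_2 inner_vec_def sum_2 N algebra_simps)
qed

lemma frame_coords:
  assumes "norm N = 1"
  shows "(frame_point m N s t - m) \<bullet> perp N = s" "(frame_point m N s t - m) \<bullet> N = t"
proof -
  have "N \<bullet> N = 1" using assms by (simp add: norm_eq_1)
  then show "(frame_point m N s t - m) \<bullet> perp N = s" "(frame_point m N s t - m) \<bullet> N = t"
    by (simp_all add: frame_point_def inner_add_left inner_diff_left)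
qed

lemma frame_point_eq_iff:
  assumes "norm N = 1"
  shows "frame_point m N s t = frame_point m N s' t' \<longleftrightarrow> s = s' \<and> t = t'"
  using frame_coords[OF assms, of m s t] frame_coords[OF assms, of m s' t'] by metis

lemma norm_frame_diff:
  assumes "norm N = 1"
  shows "norm (frame_point m N s t - frame_point m N s' t') ^ 2 = (s - s')\<^sup>2 + (t - t')\<^sup>2"
proof -
  have N: "N \<bullet> N = 1" using assms by (simp add: norm_eq_1)
  have "frame_point m N s t - frame_point m N s' t' = (s - s') *\<^sub>R perp N + (t - t') *\<^sub>R N"
    by (simp add: frame_point_def algebra_simps)
  then have "norm (frame_point m N s t - frame_point m N s' t') ^ 2
      = ((s - s') *\<^sub>R perp N + (t - t') *\<^sub>R N) \<bullet> ((s - s') *\<^sub>R perp N + (t - t') *\<^sub>R N)"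
    by (simp only: power2_norm_eq_inner)
  then show ?thesis
    by (simp add: inner_add_left inner_add_right N power2_eq_square)
qed

lemma continuous_vector_2: "continuous_on UNIV (\<lambda>(s, t). vector [s, t] :: real^2)"
proof -
  have "(\<lambda>(s, t). vector [s, t] :: real^2) = (\<lambda>p. fst p *\<^sub>R axis 1 1 + snd p *\<^sub>R axis 2 1)"
    by (auto simp: vec_eq_iff forall_2 axis_def)
  then show ?thesis by (auto intro!: continuous_intros)
qed

text \<open>Boxes determine Lebesgue measure, and the preimage of a box is the box with the same
  sides. This makes Fubini on pairs of reals available for functions on
  \<open>real^2\<close>.\<close>

lemma distr_lborel_vector:
  "distr (lborel :: (real \<times> real) measure) borel (\<lambda>(s, t). vector [s, t] :: real^2) = lborel"
proof (rule lborel_eqI[symmetric])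
  let ?V = "\<lambda>(s, t). vector [s, t] :: real^2"
  have m: "?V \<in> borel_measurable borel"
    by (rule borel_measurable_continuous_onI[OF continuous_vector_2])
  have B: "(Basis :: (real^2) set) = {axis 1 1, axis 2 1}"
    by (auto simp: Basis_vec_def UNIV_2)
  have ne: "axis 1 1 \<noteq> (axis 2 1 :: real^2)" by (simp add: axis_eq_axis)
  fix l u :: "real^2" assume le: "\<And>b. b \<in> Basis \<Longrightarrow> l \<bullet> b \<le> u \<bullet> b"
  have le': "l $ 1 \<le> u $ 1" "l $ 2 \<le> u $ 2"
    using le[of "axis 1 1"] le[of "axis 2 1"] by (auto simp: B inner_axis)
  have "?V -` box l u = box (l $ 1, l $ 2) (u $ 1, u $ 2)"
    by (auto simp: box_def B inner_axis Basis_prod_def)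
  then have "emeasure (distr lborel borel ?V) (box l u) = emeasure lborel (box (l $ 1, l $ 2) (u $ 1, u $ 2))"
    using m by (simp add: emeasure_distr)
  also have "\<dots> = (\<Prod>b\<in>Basis. ((u $ 1, u $ 2) - (l $ 1, l $ 2)) \<bullet> b)"
    using le' by (subst emeasure_lborel_box_eq) (auto simp: Basis_prod_def)
  also have "(\<Prod>b\<in>Basis. ((u $ 1, u $ 2) - (l $ 1, l $ 2)) \<bullet> b) = (\<Prod>b\<in>Basis. (u - l) \<bullet> b)"
    using ne by (simp add: B inner_axis Basis_prod_def)
  finally show "emeasure (distr lborel borel ?V) (box l u) = (\<Prod>b\<in>Basis. (u - l) \<bullet> b)" .
qed simp

text \<open>The preimage of a box is its image under the inverse map, which is orthogonal too and so
  preserves \<open>lebesgue\<close>; Borel measurability of the preimage brings the equality back to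
  \<open>lborel\<close>.\<close>

lemma distr_lborel_orthogonal:
  fixes R :: "real^2 \<Rightarrow> real^2"
  assumes R: "orthogonal_transformation R"
  shows "distr lborel borel R = lborel"
proof (rule lborel_eqI[symmetric])
  have m: "R \<in> borel_measurable borel"
    using R by (intro borel_measurable_continuous_onI linear_continuous_on)
      (simp add: orthogonal_transformation_def linear_linear)
  fix l u :: "real^2" assume le: "\<And>b. b \<in> Basis \<Longrightarrow> l \<bullet> b \<le> u \<bullet> b"
  have bij: "bij R" using R by (simp add: orthogonal_transformation_bij)
  have inv: "orthogonal_transformation (inv R)" using R by (rule orthogonal_transformation_inv)
  have "R -` box l u \<in> sets borel"
    using measurable_sets[OF m, of "box l u"] by simp
  have "R -` box l u = inv R ` box l u" by (rule bij_vimage_eq_inv_image[OF bij])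
  moreover have "inv R ` box l u \<in> lmeasurable"
    using inv by (intro measurable_orthogonal_image) auto
  moreover have "measure lebesgue (inv R ` box l u) = measure lebesgue (box l u)"
    using inv by (intro measure_orthogonal_image) auto
  ultimately have "emeasure lebesgue (R -` box l u) = emeasure lebesgue (box l u)"
    by (simp add: emeasure_eq_measure2)
  then have "emeasure lborel (R -` box l u) = emeasure lborel (box l u)"
    using \<open>R -` box l u \<in> sets borel\<close> by simp
  then show "emeasure (distr lborel borel R) (box l u) = (\<Prod>b\<in>Basis. (u - l) \<bullet> b)"
    using m le by (simp add: emeasure_distr emeasure_lborel_box_eq)
qed simp

lemma distr_lborel_frame:
  assumes "norm N = 1"
  shows "distr (lborel :: (real \<times> real) measure) borel (\<lambda>(s, t). frame_point m N s t) = lborel"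
proof -
  let ?V = "\<lambda>(s, t). vector [s, t] :: real^2"
  let ?R = "\<lambda>x :: real^2. x $ 1 *\<^sub>R perp N + x $ 2 *\<^sub>R N"
  have N: "N \<bullet> N = 1" using assms by (simp add: norm_eq_1)
  have "linear ?R"
    by (rule linearI) (simp_all add: algebra_simps)
  moreover have "?R v \<bullet> ?R w = v \<bullet> w" for v w
    by (simp add: inner_add_left inner_add_right N) (simp add: inner_vec_def sum_2)
  ultimately have "orthogonal_transformation ?R"
    unfolding orthogonal_transformation_def by blast
  then have R: "distr lborel borel ?R = lborel" by (rule distr_lborel_orthogonal)
  have mV: "?V \<in> borel_measurable borel"
    by (rule borel_measurable_continuous_onI[OF continuous_vector_2])
  have mR: "?R \<in> borel_measurable borel"
    by (intro borel_measurable_continuous_onI continuous_intros)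
  have "lborel = distr (distr (distr lborel borel ?V) borel ?R) borel ((+) m)"
    by (simp add: distr_lborel_vector R lborel_distr_plus)
  also have "\<dots> = distr lborel borel ((+) m \<circ> (?R \<circ> ?V))"
    using mV mR by (simp add: distr_distr)
  also have "(+) m \<circ> (?R \<circ> ?V) = (\<lambda>(s, t). frame_point m N s t)"
    by (auto simp: frame_point_def)
  finally show ?thesis by simp
qed

lemma frame_measurable: "(\<lambda>(s, t). frame_point m N s t) \<in> borel_measurable borel"
  unfolding frame_point_def case_prod_beta
  by (intro borel_measurable_continuous_onI continuous_intros)

text \<open>Integrability of almost every section is recorded because line integrals are computed
  later as \<open>has_integral\<close>; only for an integrable section is that value also the
  Lebesgue integral.\<close>

lemma integral_frame:
  fixes f :: "real^2 \<Rightarrow> real"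
  assumes N: "norm N = 1" and f: "integrable lborel f"
  shows "integral\<^sup>L lborel f = (\<integral>s. (\<integral>t. f (frame_point m N s t) \<partial>lborel) \<partial>lborel)"
    and "integral\<^sup>L lborel f = (\<integral>t. (\<integral>s. f (frame_point m N s t) \<partial>lborel) \<partial>lborel)"
    and "AE s in lborel. integrable lborel (\<lambda>t. f (frame_point m N s t))"
    and "AE t in lborel. integrable lborel (\<lambda>s. f (frame_point m N s t))"
    and "integrable lborel (\<lambda>s. \<integral>t. f (frame_point m N s t) \<partial>lborel)"
proof -
  let ?P = "\<lambda>(s, t). frame_point m N s t"
  have fm: "f \<in> borel_measurable borel" using f by auto
  have "integrable (distr lborel borel ?P) f" using f by (simp add: distr_lborel_frame[OF N])
  then have i: "integrable (lborel \<Otimes>\<^sub>M lborel) (\<lambda>(s, t). f (frame_point m N s t))"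
    using frame_measurable[of m N] fm
    by (subst (asm) integrable_distr_eq) (auto simp: lborel_prod case_prod_beta')
  have "integral\<^sup>L lborel f = integral\<^sup>L (distr lborel borel ?P) f"
    by (simp add: distr_lborel_frame[OF N])
  also have "\<dots> = integral\<^sup>L (lborel \<Otimes>\<^sub>M lborel) (\<lambda>(s, t). f (frame_point m N s t))"
    using frame_measurable[of m N] fm
    by (subst integral_distr) (auto simp: lborel_prod case_prod_beta')
  finally have e: "integral\<^sup>L lborel f = integral\<^sup>L (lborel \<Otimes>\<^sub>M lborel) (\<lambda>(s, t). f (frame_point m N s t))" .
  show "integral\<^sup>L lborel f = (\<integral>s. (\<integral>t. f (frame_point m N s t) \<partial>lborel) \<partial>lborel)"
    using lborel_pair.integral_fst[OF i] e by simp
  show "integral\<^sup>L lborel f = (\<integral>t. (\<integral>s. f (frame_point m N s t) \<partial>lborel) \<partial>lborel)"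
    using lborel_pair.integral_snd[OF i] e by simp
  show "AE s in lborel. integrable lborel (\<lambda>t. f (frame_point m N s t))"
    using lborel_pair.AE_integrable_fst[OF i] .
  show "AE t in lborel. integrable lborel (\<lambda>s. f (frame_point m N s t))"
    using lborel_pair.AE_integrable_snd[OF i] .
  show "integrable lborel (\<lambda>s. \<integral>t. f (frame_point m N s t) \<partial>lborel)"
    using lborel_pair.integrable_fst[OF i] .
qed

section \<open>Integration of a derivative across a jump\<close>

text \<open>The fundamental theorem for h F on the half line, where h will be the indicator of a
  cell along a line. The hypothesis \<open>loc\<close> compares h F with c F instead of asking h to
  be locally constant, so h may be wild wherever F vanishes.\<close>

lemma half_line_integral:
  fixes F F' h :: "real \<Rightarrow> real"
  assumes "0 < R"
    and der: "\<And>t. (F has_real_derivative F' t) (at t)"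
    and supp: "F R = 0"
    and loc: "\<And>t. 0 < t \<Longrightarrow> \<exists>c. \<forall>\<^sub>F y in nhds t. h y * F y = c * F y \<and> h y * F' y = c * F' y"
    and right: "\<forall>\<^sub>F t in at_right 0. h t * F t = a * F t"
  shows "((\<lambda>t. h t * F' t) has_integral (- a * F 0)) {0..R}"
proof -
  \<comment> \<open>The value at 0 is replaced by the limit from the right. H is then continuous on
    the closed interval and has derivative h F' inside it, which is all that the interior form of
    the fundamental theorem asks for.\<close>
  define H where "H t = (if t = 0 then a * F 0 else h t * F t)" for t
  have dH: "(H has_real_derivative h t * F' t) (at t)" if t: "0 < t" for t
  proof -
    obtain c where c: "\<forall>\<^sub>F y in nhds t. h y * F y = c * F y \<and> h y * F' y = c * F' y"
      using loc[OF t] by blast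
    have "\<forall>\<^sub>F y in nhds t. y \<noteq> (0::real)" using t by (intro t1_space_nhds) auto
    with c have ev: "\<forall>\<^sub>F y in nhds t. H y = c * F y"
      by eventually_elim (simp add: H_def)
    moreover have "((\<lambda>y. c * F y) has_real_derivative c * F' t) (at t)"
      using der by (rule DERIV_cmult)
    moreover have "h t * F' t = c * F' t" using eventually_nhds_x_imp_x[OF c] by simp
    ultimately show ?thesis by (simp only: DERIV_cong_ev[OF refl ev refl])
  qed
  have "continuous_on {0..R} H"
    unfolding continuous_on_def
  proof (intro ballI)
    fix t assume t: "t \<in> {0..R}"
    show "(H \<longlongrightarrow> H t) (at t within {0..R})"
    proof (cases "t = 0")
      case True
      have "(F \<longlongrightarrow> F 0) (at_right 0)"
        using DERIV_isCont[OF der] by (metis at_le filterlim_mono isCont_def order_refl subset_UNIV)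
      then have "((\<lambda>t. a * F t) \<longlongrightarrow> a * F 0) (at_right 0)" by (intro tendsto_intros)
      moreover have "\<forall>\<^sub>F t in at_right 0. a * F t = H t"
        using right eventually_at_right_less[of "0::real"] by eventually_elim (auto simp: H_def)
      ultimately have "(H \<longlongrightarrow> a * F 0) (at_right 0)" by (rule Lim_transform_eventually)
      then show ?thesis using True \<open>0 < R\<close> by (simp add: H_def at_within_Icc_at_right)
    next
      case False
      then have "isCont H t" using t by (intro DERIV_isCont[OF dH]) auto
      then show ?thesis by (metis at_le filterlim_mono isCont_def order_refl subset_UNIV)
    qed
  qed
  then have "((\<lambda>t. h t * F' t) has_integral (H R - H 0)) {0..R}"
    using dH \<open>0 < R\<close>
    by (intro fundamental_theorem_of_calculus_interior)
      (auto simp: has_real_derivative_iff_has_vector_derivative[symmetric])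
  then show ?thesis using supp \<open>0 < R\<close> by (simp add: H_def)
qed

text \<open>The right half line contributes - a F(0). Reflection turns the left one into a half line
  of the same kind, contributing b F(0).\<close>

lemma line_integral_jump:
  fixes F F' h :: "real \<Rightarrow> real"
  assumes "0 < R"
    and der: "\<And>t. (F has_real_derivative F' t) (at t)"
    and supp: "\<And>t. R \<le> \<bar>t\<bar> \<Longrightarrow> F t = 0" "\<And>t. R \<le> \<bar>t\<bar> \<Longrightarrow> F' t = 0"
    and loc: "\<And>t. t \<noteq> 0 \<Longrightarrow> \<exists>c. \<forall>\<^sub>F y in nhds t. h y * F y = c * F y \<and> h y * F' y = c * F' y"
    and right: "\<forall>\<^sub>F t in at_right 0. h t * F t = a * F t"
    and left: "\<forall>\<^sub>F t in at_left 0. h t * F t = b * F t"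
  shows "((\<lambda>t. h t * F' t) has_integral ((b - a) * F 0)) UNIV"
proof -
  have r: "((\<lambda>t. h t * F' t) has_integral (- a * F 0)) {0..R}"
    using assms by (intro half_line_integral) auto
  have "((\<lambda>t. h (- t) * (- F' (- t))) has_integral (- b * F (- 0))) {0..R}"
  proof (rule half_line_integral)
    show "((\<lambda>t. F (- t)) has_real_derivative - F' (- t)) (at t)" for t
      using DERIV_chain2[where f = F and g = "\<lambda>t. - t", OF der DERIV_minus[OF DERIV_ident]] by simp
    show "\<exists>c. \<forall>\<^sub>F y in nhds t. h (- y) * F (- y) = c * F (- y) \<and>
        h (- y) * - F' (- y) = c * - F' (- y)" if "0 < t" for t
    proof -
      obtain c where c: "\<forall>\<^sub>F y in nhds (- t). h y * F y = c * F y \<and> h y * F' y = c * F' y"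
        using loc[of "- t"] \<open>0 < t\<close> by auto
      have "filterlim uminus (nhds (- t)) (nhds t)"
        by (intro tendsto_intros filterlim_ident)
      from eventually_compose_filterlim[OF c this]
      have "\<forall>\<^sub>F y in nhds t. h (- y) * F (- y) = c * F (- y) \<and> h (- y) * - F' (- y) = c * - F' (- y)"
        by eventually_elim simp
      then show ?thesis by blast
    qed
    show "\<forall>\<^sub>F t in at_right 0. h (- t) * F (- t) = b * F (- t)"
      using left eventually_at_left_to_right[of _ "0::real"] by (simp add: at_left_minus eventually_filtermap)
  qed (use assms in auto)
  from has_integral_neg[OF this]
  have "((\<lambda>t. h (- t) * F' (- t)) has_integral b * F 0) {0..R}" by simp
  then have l: "((\<lambda>t. h t * F' t) has_integral b * F 0) {- R..0}"
    using has_integral_reflect_real[of "\<lambda>t. h t * F' t" "b * F 0" 0 "- R"] \<open>0 < R\<close> by simp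
  have "((\<lambda>t. h t * F' t) has_integral (b * F 0 + - a * F 0)) {- R..R}"
    using l r \<open>0 < R\<close> by (intro has_integral_combine[of _ 0]) auto
  then have "((\<lambda>t. h t * F' t) has_integral (b * F 0 + - a * F 0)) UNIV"
    by (rule has_integral_on_superset) (auto intro!: supp(2))
  then show ?thesis by (simp add: algebra_simps)
qed

section \<open>Square-integrable fields and Green's formula in a frame\<close>

lemma L2_inner_integrable:
  assumes "u \<in> L2 D" "v \<in> L2 D"
  shows "integrable (lebesgue_on D) (\<lambda>x. u x \<bullet> v x)"
proof (rule Bochner_Integration.integrable_bound)
  show "integrable (lebesgue_on D) (\<lambda>x. (norm (u x))\<^sup>2 + (norm (v x))\<^sup>2)"
    using assms by (simp add: L2_def)
  show "(\<lambda>x. u x \<bullet> v x) \<in> borel_measurable (lebesgue_on D)"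
    using assms by (intro borel_measurable_inner) (simp_all add: L2_def)
  have "norm (u x \<bullet> v x) \<le> norm ((norm (u x))\<^sup>2 + (norm (v x))\<^sup>2)" for x
  proof -
    have "\<bar>u x \<bullet> v x\<bar> \<le> norm (u x) * norm (v x)" by (rule Cauchy_Schwarz_ineq2)
    also have "\<dots> \<le> (norm (u x))\<^sup>2 + (norm (v x))\<^sup>2"
      using sum_squares_bound[of "norm (u x)" "norm (v x)"] by (simp add: mult_nonneg_nonneg order_trans[rotated])
    finally show ?thesis by simp
  qed
  then show "AE x in lebesgue_on D. norm (u x \<bullet> v x) \<le> norm ((norm (u x))\<^sup>2 + (norm (v x))\<^sup>2)"
    by simp
qed

lemma L2_lincomb:
  assumes "u \<in> L2 D" "v \<in> L2 D"
  shows "(\<lambda>x. a *\<^sub>R u x + b *\<^sub>R v x) \<in> L2 D"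
proof -
  have "(norm (a *\<^sub>R u x + b *\<^sub>R v x))\<^sup>2
      = a\<^sup>2 * (norm (u x))\<^sup>2 + b\<^sup>2 * (norm (v x))\<^sup>2 + 2 * a * b * (u x \<bullet> v x)" for x
    unfolding power2_norm_eq_inner
    by (simp add: inner_add_left inner_add_right inner_commute power2_eq_square algebra_simps)
  then show ?thesis
    using assms L2_inner_integrable[OF assms]
    by (auto simp add: L2_def intro!: borel_measurable_add borel_measurable_scaleR)
qed

lemma L2_zero: "(\<lambda>x. 0) \<in> L2 D"
  by (simp add: L2_def)

lemma L2_diff:
  assumes "u \<in> L2 D" "v \<in> L2 D"
  shows "(\<lambda>x. u x - v x) \<in> L2 D"
  using L2_lincomb[OF assms, of 1 "-1"] by simp

lemma continuous_bounded_on_bounded: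
  fixes f :: "real^2 \<Rightarrow> 'b::real_normed_vector"
  assumes "bounded D" "continuous_on UNIV f"
  obtains B where "\<And>x. x \<in> D \<Longrightarrow> norm (f x) \<le> B"
proof -
  have "compact (f ` closure D)"
    using assms by (intro compact_continuous_image) (auto intro: continuous_on_subset simp: compact_closure)
  then obtain B where "\<forall>y \<in> f ` closure D. norm y \<le> B"
    using compact_imp_bounded bounded_iff by blast
  then show thesis using that closure_subset by blast
qed

lemma integrable_bounded_measurable:
  fixes f :: "real^2 \<Rightarrow> 'b::euclidean_space"
  assumes D: "D \<in> sets lebesgue" "bounded D"
    and f: "f \<in> borel_measurable (lebesgue_on D)" "\<And>x. x \<in> D \<Longrightarrow> norm (f x) \<le> B"
  shows "integrable (lebesgue_on D) f"
proof -
  have "D \<in> lmeasurable" using D by (simp add: bounded_set_imp_lmeasurable)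
  then have "integrable (lebesgue_on D) (\<lambda>_. B)"
    by (simp add: finite_measure.integrable_const finite_measure_lebesgue_on)
  then show ?thesis
    by (rule Bochner_Integration.integrable_bound)
      (use f in \<open>auto intro!: AE_I2 simp: order_trans[OF _ abs_ge_self]\<close>)
qed

lemma L2_continuous:
  fixes f :: "real^2 \<Rightarrow> 'b::euclidean_space"
  assumes D: "D \<in> sets lebesgue" "bounded D" and f: "continuous_on UNIV f"
  shows "f \<in> L2 D"
proof -
  have m: "f \<in> borel_measurable (lebesgue_on D)"
    using f D continuous_imp_measurable_on_sets_lebesgue continuous_on_subset by blast
  obtain B where "\<And>x. x \<in> D \<Longrightarrow> norm (f x) \<le> B"
    using continuous_bounded_on_bounded[OF D(2) f] by blast
  then have "integrable (lebesgue_on D) (\<lambda>x. (norm (f x))\<^sup>2)"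
    using m by (intro integrable_bounded_measurable[OF D, where B = "B\<^sup>2"]) (auto intro!: power_mono)
  then show ?thesis using m by (simp add: L2_def)
qed

lemma integral_lebesgue_on_open:
  fixes g :: "real^2 \<Rightarrow> real"
  assumes D: "open D" and g: "continuous_on UNIV g"
  shows "integral\<^sup>L (lebesgue_on D) g = (\<integral>x. indicator D x * g x \<partial>lborel)"
proof -
  have "g \<in> borel_measurable borel" using g by (rule borel_measurable_continuous_onI)
  then have "(\<lambda>x. indicator D x *\<^sub>R g x) \<in> borel_measurable lborel" using D by simp
  then show ?thesis
    using D by (simp add: integral_restrict_space integral_completion)
qed

text \<open>Within the support \<open>K\<close>, the frontier of D lies on the segment t = 0, |s|
  \<le> l; everywhere else indicator times f is locally a constant multiple of f. Lines t = const
  \<noteq> 0 avoid the segment and integrate to 0, while each line s = const crosses it at most once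
  and leaves the jump. The number \<open>l\<close> stays apart from the half length \<open>r\<close>
  because near the end points of an edge no single \<delta> serves both sides; \<open>gap\<close>
  makes the integral over the full edge the same as over the shorter segment.\<close>

lemma green_frame:
  fixes f :: "real^2 \<Rightarrow> real"
  assumes N: "norm N = 1" and D: "open D" and K: "compact K"
    and diff: "\<And>x. f differentiable at x" and cont: "continuous_on UNIV (grad f)"
    and zero: "\<And>x. x \<notin> K \<Longrightarrow> f x = 0"
    and bd: "\<And>x. x \<in> K \<Longrightarrow> x \<in> frontier D \<Longrightarrow> \<exists>s. \<bar>s\<bar> \<le> l \<and> x = frame_point m N s 0"
    and gap: "\<And>s. l < \<bar>s\<bar> \<Longrightarrow> \<bar>s\<bar> \<le> r \<Longrightarrow> frame_point m N s 0 \<notin> K" and "l \<le> r"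
    and \<delta>: "0 < \<delta>"
    and A: "\<And>s t. \<bar>s\<bar> \<le> l \<Longrightarrow> 0 < t \<Longrightarrow> t < \<delta> \<Longrightarrow> frame_point m N s t \<in> D \<longleftrightarrow> A"
    and B: "\<And>s t. \<bar>s\<bar> \<le> l \<Longrightarrow> - \<delta> < t \<Longrightarrow> t < 0 \<Longrightarrow> frame_point m N s t \<in> D \<longleftrightarrow> B"
  shows "integral\<^sup>L (lebesgue_on D) (\<lambda>x. grad f x \<bullet> perp N) = 0"
    and "integral\<^sup>L (lebesgue_on D) (\<lambda>x. grad f x \<bullet> N) =
      (of_bool B - of_bool A) * integral\<^sup>L (lebesgue_on {- r..r}) (\<lambda>s. f (frame_point m N s 0))"
proof -
  let ?P = "frame_point m N"
  define w where "w v x = indicator D x * (grad f x \<bullet> v)" for v x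
  have gzero: "grad f x = 0" if "x \<notin> K" for x
  proof (rule grad_eqI)
    have "((\<lambda>x. 0) has_derivative (\<lambda>v. 0 \<bullet> v)) (at x)" by simp
    then show "(f has_derivative (\<lambda>v. 0 \<bullet> v)) (at x)"
      by (rule has_derivative_transform_within_open[of _ _ _ UNIV "- K"])
        (use that zero compact_imp_closed[OF K] in auto)
  qed
  have int: "integrable lborel (w v)" for v
  proof -
    have "integrable lborel (\<lambda>x. indicator K x *\<^sub>R (grad f x \<bullet> v))"
      using K cont by (intro borel_integrable_compact) (auto intro!: continuous_intros intro: continuous_on_subset)
    then have "integrable lborel (\<lambda>x. indicator D x *\<^sub>R (indicator K x *\<^sub>R (grad f x \<bullet> v)))"
      by (rule integrable_mult_indicator[rotated]) (use D in simp)
    moreover have "(\<lambda>x. indicator D x *\<^sub>R (indicator K x *\<^sub>R (grad f x \<bullet> v))) = w v"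
      using gzero by (auto simp: w_def fun_eq_iff split: split_indicator)
    ultimately show ?thesis by simp
  qed
  have eq: "integral\<^sup>L (lebesgue_on D) (\<lambda>x. grad f x \<bullet> v) = integral\<^sup>L lborel (w v)" for v
    unfolding w_def by (intro integral_lebesgue_on_open D continuous_intros cont)
  \<comment> \<open>The constant c is 0 off \<open>K\<close>, 1 inside D and 0 outside the closure
    of D. It is chosen before v, so one c serves f and all its directional derivatives.\<close>
  have loc: "\<exists>c. \<forall>\<^sub>F y in nhds x. indicator D y * f y = c * f y \<and>
      (\<forall>v. indicator D y * (grad f y \<bullet> v) = c * (grad f y \<bullet> v))"
    if "x \<notin> K \<or> x \<notin> frontier D" for x
  proof -
    have "x \<notin> K \<or> x \<in> D \<or> x \<notin> closure D"
      using that D by (auto simp: frontier_def interior_open)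
    then consider "x \<notin> K" | "x \<in> D" | "x \<notin> closure D" by blast
    then show ?thesis
    proof cases
      case 1
      have "\<forall>\<^sub>F y in nhds x. y \<in> - K"
        using 1 compact_imp_closed[OF K] by (intro eventually_nhds_in_open) auto
      then show ?thesis by (intro exI[of _ 0]) (auto elim!: eventually_mono simp: zero gzero)
    next
      case 2
      have "\<forall>\<^sub>F y in nhds x. y \<in> D"
        using 2 D by (intro eventually_nhds_in_open) auto
      then show ?thesis by (intro exI[of _ 1]) (auto elim!: eventually_mono)
    next
      case 3
      have "\<forall>\<^sub>F y in nhds x. y \<in> - closure D"
        using 3 by (intro eventually_nhds_in_open) auto
      then show ?thesis
        by (intro exI[of _ 0]) (use closure_subset in \<open>auto elim!: eventually_mono simp: indicator_def\<close>)
    qed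
  qed
  have "bounded ((\<lambda>x. x - m) ` K)"
    using K by (intro compact_imp_bounded compact_continuous_image) (auto intro!: continuous_intros)
  then obtain R where R: "0 < R" "\<And>x. x \<in> K \<Longrightarrow> norm (x - m) < R"
    unfolding bounded_pos_less by auto
  have out: "?P s t \<notin> K" if "R \<le> \<bar>s\<bar> \<or> R \<le> \<bar>t\<bar>" for s t
  proof
    assume "?P s t \<in> K"
    then have "norm (?P s t - m) < R" by (rule R)
    moreover have "\<bar>(?P s t - m) \<bullet> perp N\<bar> \<le> norm (?P s t - m)" "\<bar>(?P s t - m) \<bullet> N\<bar> \<le> norm (?P s t - m)"
      using Cauchy_Schwarz_ineq2[of "?P s t - m" "perp N"] Cauchy_Schwarz_ineq2[of "?P s t - m" N]
      by (simp_all add: N)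
    ultimately show False using that by (simp add: frame_coords[OF N])
  qed
  have der_s: "((\<lambda>s. f (?P s t)) has_real_derivative grad f (?P s t) \<bullet> perp N) (at s)" for s t
  proof -
    have "((\<lambda>s. ?P s t) has_derivative (\<lambda>h. h *\<^sub>R perp N)) (at s)"
      unfolding frame_point_def by (auto intro!: derivative_eq_intros)
    from has_derivative_compose[OF this has_derivative_grad[OF diff]]
    show ?thesis by (simp add: has_field_derivative_def mult_commute_abs mult.commute)
  qed
  have der_t: "((\<lambda>t. f (?P s t)) has_real_derivative grad f (?P s t) \<bullet> N) (at t)" for s t
  proof -
    have "((\<lambda>t. ?P s t) has_derivative (\<lambda>h. h *\<^sub>R N)) (at t)"
      unfolding frame_point_def by (auto intro!: derivative_eq_intros)
    from has_derivative_compose[OF this has_derivative_grad[OF diff]]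
    show ?thesis by (simp add: has_field_derivative_def mult_commute_abs mult.commute)
  qed
  have lim_s: "filterlim (\<lambda>s. ?P s t) (nhds (?P s t)) (nhds s)" for s t
    unfolding frame_point_def by (intro tendsto_intros filterlim_ident)
  have lim_t: "filterlim (\<lambda>t. ?P s t) (nhds (?P s t)) (nhds t)" for s t
    unfolding frame_point_def by (intro tendsto_intros filterlim_ident)
  have loc_s: "\<exists>c. \<forall>\<^sub>F y in nhds s. indicator D (?P y t) * f (?P y t) = c * f (?P y t) \<and>
      indicator D (?P y t) * (grad f (?P y t) \<bullet> perp N) = c * (grad f (?P y t) \<bullet> perp N)"
    if reg: "?P s t \<notin> K \<or> ?P s t \<notin> frontier D" for s t
  proof -
    obtain c where c: "\<forall>\<^sub>F y in nhds (?P s t). indicator D y * f y = c * f y \<and>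
      (\<forall>v. indicator D y * (grad f y \<bullet> v) = c * (grad f y \<bullet> v))" using loc[OF reg] by blast
    show ?thesis
      using eventually_compose_filterlim[OF c lim_s] by (intro exI[of _ c]) (auto elim!: eventually_mono)
  qed
  have loc_t: "\<exists>c. \<forall>\<^sub>F y in nhds t. indicator D (?P s y) * f (?P s y) = c * f (?P s y) \<and>
      indicator D (?P s y) * (grad f (?P s y) \<bullet> N) = c * (grad f (?P s y) \<bullet> N)"
    if reg: "?P s t \<notin> K \<or> ?P s t \<notin> frontier D" for s t
  proof -
    obtain c where c: "\<forall>\<^sub>F y in nhds (?P s t). indicator D y * f y = c * f y \<and>
      (\<forall>v. indicator D y * (grad f y \<bullet> v) = c * (grad f y \<bullet> v))" using loc[OF reg] by blast
    show ?thesis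
      using eventually_compose_filterlim[OF c lim_t] by (intro exI[of _ c]) (auto elim!: eventually_mono)
  qed
  have regular: "?P s t \<notin> K \<or> ?P s t \<notin> frontier D" if "t \<noteq> 0 \<or> l < \<bar>s\<bar>" for s t
    using bd[of "?P s t"] that by (auto simp: frame_point_eq_iff[OF N])
  have side: "\<forall>\<^sub>F y in at_right x. Q y" "\<forall>\<^sub>F y in at_left x. Q y" if "\<forall>\<^sub>F y in nhds x. Q y"
    for Q and x :: real
    using that by (auto simp: eventually_at_filter elim: eventually_mono)
  have hor: "((\<lambda>s. w (perp N) (?P s t)) has_integral 0) UNIV" if t: "t \<noteq> 0" for t
  proof -
    \<comment> \<open>A line with t \<noteq> 0 has no jump at s = 0: the jump formula is used with
      the same constant c on both sides.\<close>
    obtain c where c: "\<forall>\<^sub>F y in nhds 0. indicator D (?P y t) * f (?P y t) = c * f (?P y t) \<and>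
        indicator D (?P y t) * (grad f (?P y t) \<bullet> perp N) = c * (grad f (?P y t) \<bullet> perp N)"
      using loc_s[OF regular] t by blast
    have "((\<lambda>s. indicator D (?P s t) * (grad f (?P s t) \<bullet> perp N)) has_integral (c - c) * f (?P 0 t)) UNIV"
      by (rule line_integral_jump[where R = R])
        (use R(1) der_s out zero gzero loc_s[OF regular] t side[OF c] in \<open>auto elim!: eventually_mono\<close>)
    then show ?thesis by (simp add: w_def)
  qed
  have ver: "((\<lambda>t. w N (?P s t)) has_integral
      (of_bool B - of_bool A) * (indicator {- r..r} s * f (?P s 0))) UNIV" for s
  proof (cases "\<bar>s\<bar> \<le> l")
    case True
    have "\<forall>\<^sub>F t in at_right 0. t \<in> {0<..<\<delta>}" using \<delta> by (rule eventually_at_right_real)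
    then have a: "\<forall>\<^sub>F t in at_right 0. indicator D (?P s t) * f (?P s t) = of_bool A * f (?P s t)"
      by eventually_elim (use A[OF True] in \<open>auto simp: indicator_def\<close>)
    have "\<forall>\<^sub>F t in at_left 0. t \<in> {- \<delta><..<0}" using \<delta> by (intro eventually_at_left_real) auto
    then have b: "\<forall>\<^sub>F t in at_left 0. indicator D (?P s t) * f (?P s t) = of_bool B * f (?P s t)"
      by eventually_elim (use B[OF True] in \<open>auto simp: indicator_def\<close>)
    have "((\<lambda>t. indicator D (?P s t) * (grad f (?P s t) \<bullet> N)) has_integral
        (of_bool B - of_bool A) * f (?P s 0)) UNIV"
      by (rule line_integral_jump[where R = R])
        (use R(1) der_t out zero gzero loc_t[OF regular] a b in auto)
    then show ?thesis using True \<open>l \<le> r\<close> by (simp add: w_def indicator_def abs_le_iff)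
  next
    case False
    then have reg: "?P s t \<notin> K \<or> ?P s t \<notin> frontier D" for t by (intro regular) auto
    obtain c where c: "\<forall>\<^sub>F y in nhds 0. indicator D (?P s y) * f (?P s y) = c * f (?P s y) \<and>
        indicator D (?P s y) * (grad f (?P s y) \<bullet> N) = c * (grad f (?P s y) \<bullet> N)"
      using loc_t[OF reg] by blast
    have "((\<lambda>t. indicator D (?P s t) * (grad f (?P s t) \<bullet> N)) has_integral (c - c) * f (?P s 0)) UNIV"
      by (rule line_integral_jump[where R = R])
        (use R(1) der_t out zero gzero loc_t[OF reg] side[OF c] in \<open>auto elim!: eventually_mono\<close>)
    \<comment> \<open>For l < |s| \<le> r the point lies off the support by \<open>gap\<close>; for
      larger |s| the indicator vanishes.\<close>
    moreover have 0: "indicator {- r..r} s * f (?P s 0) = 0"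
      using gap[of s] zero False by (auto simp: indicator_def abs_le_iff)
    ultimately show ?thesis unfolding 0 by (simp add: w_def)
  qed
  \<comment> \<open>The line t = 0, which contains the segment and which \<open>hor\<close> leaves
    out, is discarded as a null set of values t.\<close>
  have "AE t in lborel. t \<noteq> (0::real)" by (rule AE_lborel_singleton)
  with integral_frame(4)[OF N int, where m = m and v1 = "perp N"]
  have "AE t in lborel. (\<integral>s. w (perp N) (?P s t) \<partial>lborel) = 0"
    by eventually_elim (metis hor has_integral_integral_lborel has_integral_unique)
  then have "(\<integral>t. (\<integral>s. w (perp N) (?P s t) \<partial>lborel) \<partial>lborel) = 0"
    by (rule integral_eq_zero_AE)
  then show "integral\<^sup>L (lebesgue_on D) (\<lambda>x. grad f x \<bullet> perp N) = 0"
    by (simp add: eq integral_frame(2)[OF N int, where m = m])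
  have contf: "continuous_on UNIV f"
    by (meson diff continuous_at_imp_continuous_on differentiable_imp_continuous_within)
  have contP: "continuous_on UNIV (\<lambda>s. f (?P s 0))"
    unfolding frame_point_def by (intro continuous_on_compose2[OF contf] continuous_intros) auto
  have "AE s in lborel. (\<integral>t. w N (?P s t) \<partial>lborel) = (of_bool B - of_bool A) * (indicator {- r..r} s * f (?P s 0))"
    using integral_frame(3)[OF N int, where m = m and v1 = N]
    by eventually_elim (metis ver has_integral_integral_lborel has_integral_unique)
  then have "(\<integral>s. (\<integral>t. w N (?P s t) \<partial>lborel) \<partial>lborel) =
      (\<integral>s. (of_bool B - of_bool A) * (indicator {- r..r} s * f (?P s 0)) \<partial>lborel)"
    using integral_frame(5)[OF N int, where m = m and v1 = N] borel_measurable_continuous_onI[OF contP]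
    by (intro integral_cong_AE) auto
  also have "\<dots> = (of_bool B - of_bool A) * (\<integral>s. indicator {- r..r} s * f (?P s 0) \<partial>lborel)"
    by simp
  also have "(\<integral>s. indicator {- r..r} s * f (?P s 0) \<partial>lborel) = integral\<^sup>L (lebesgue_on {- r..r}) (\<lambda>s. f (?P s 0))"
    using borel_measurable_continuous_onI[OF contP] by (simp add: integral_restrict_space integral_completion)
  finally show "integral\<^sup>L (lebesgue_on D) (\<lambda>x. grad f x \<bullet> N) =
      (of_bool B - of_bool A) * integral\<^sup>L (lebesgue_on {- r..r}) (\<lambda>s. f (?P s 0))"
    by (simp add: eq integral_frame(1)[OF N int, where m = m])
qed

section \<open>Polygon edges\<close>

lemma edges_finite: "finite (edges E)"
  by (simp add: edges_def)

lemma edges_hull_compact: "e \<in> edges E \<Longrightarrow> compact (convex hull e)"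
  by (auto simp: edges_def intro!: finite_imp_compact_convex_hull)

lemma compact_edge_union: "A \<subseteq> edges E \<Longrightarrow> compact (\<Union>e\<in>A. convex hull e)"
  using edges_finite finite_subset by (blast intro: compact_UN edges_hull_compact)

lemma open_cell: "open (cell E)"
  unfolding cell_def using compact_edge_union[of "edges E" E]
  by (intro open_inside compact_imp_closed) simp

lemma bounded_cell: "bounded (cell E)"
  unfolding cell_def using compact_edge_union[of "edges E" E]
  by (intro bounded_inside compact_imp_bounded) simp

lemma frontier_cell: "frontier (cell E) \<subseteq> (\<Union>e\<in>edges E. convex hull e)"
  unfolding cell_def using compact_edge_union[of "edges E" E]
  by (intro frontier_inside_subset compact_imp_closed) simp

lemma cell_disjoint_edges: "e \<in> edges E \<Longrightarrow> cell E \<inter> convex hull e = {}"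
  using inside_no_overlap[of "\<Union>e\<in>edges E. convex hull e"] unfolding cell_def by blast

lemma cell_sets [simp]: "cell E \<in> sets lebesgue"
  using open_cell by (simp add: borel_open)

lemma edge_point_frame: "edge_point n e s = frame_point (edge_mid e) (n e) s 0"
  by (simp add: edge_point_def frame_point_def)

locale polygon_edge =
  fixes n :: "edge \<Rightarrow> real^2" and E :: element and e :: edge
  assumes polygon: "simple_polygon E"
    and edge: "e \<in> edges E"
    and unit_normal: "norm (n e) = 1"
    and orthogonal: "\<And>a b. a \<in> e \<Longrightarrow> b \<in> e \<Longrightarrow> n e \<bullet> (a - b) = 0"
begin

text \<open>The set that the supports of the test functions for the trace on \<open>e\<close> have
  to avoid.\<close>

definition other_edges :: "(real^2) set"
  where "other_edges = (\<Union>f \<in> edges E - {e}. convex hull f)"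

lemma closed_other_edges: "closed other_edges"
  unfolding other_edges_def by (intro compact_imp_closed compact_edge_union[where E = E]) auto

text \<open>Each end point of \<open>e\<close> also belongs to the preceding or the following edge
  of the cycle; having at least three vertices makes those edges different from \<open>e\<close>.
  Hence a support avoiding \<open>other_edges\<close> keeps away from the end points.\<close>

lemma endpoints:
  obtains a b where "e = {a, b}" "a \<noteq> b" "a \<in> other_edges" "b \<in> other_edges"
proof -
  let ?l = "length E"
  have len: "3 \<le> ?l" and dist: "distinct E" using polygon by (auto simp: simple_polygon_def)
  obtain i where i: "i < ?l" "e = {E ! i, E ! (Suc i mod ?l)}"
    using edge by (auto simp: edges_def)
  define j where "j = Suc i mod ?l"
  define k where "k = Suc j mod ?l"
  \<comment> \<open>The cyclic predecessor of i. In a triangle h and k coincide, so the inequalities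
    below only separate each of them from i and j.\<close>
  define h where "h = (if i = 0 then ?l - 1 else i - 1)"
  have "x mod ?l < ?l" for x using len by (intro mod_less_divisor) linarith
  then have j: "j < ?l" "k < ?l" "h < ?l" using len i by (auto simp: j_def k_def h_def)
  have sh: "Suc h mod ?l = i" using i len by (auto simp: h_def)
  have neq: "i \<noteq> j" "k \<noteq> i" "k \<noteq> j" "h \<noteq> i" "h \<noteq> j"
    using i(1) len by (auto simp: j_def k_def h_def mod_Suc split: if_splits)
  have E: "E ! x = E ! y \<longleftrightarrow> x = y" if "x < ?l" "y < ?l" for x y
    using nth_eq_iff_index_eq[OF dist that] .
  have ej: "e = {E ! i, E ! j}" using i by (simp add: j_def)
  have "{E ! j, E ! k} \<in> edges E - {e}"
  proof -
    have "{E ! j, E ! k} \<in> edges E" using j by (auto simp: edges_def k_def)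
    then show ?thesis using j i neq by (auto simp: ej doubleton_eq_iff E)
  qed
  then have "E ! j \<in> other_edges"
    unfolding other_edges_def by (blast intro: hull_inc)
  moreover have "{E ! h, E ! i} \<in> edges E - {e}"
  proof -
    have "{E ! h, E ! i} \<in> edges E" using j sh by (auto simp: edges_def)
    moreover have "E ! h \<noteq> E ! i" "E ! h \<noteq> E ! j" using E[of h i] E[of h j] j i neq by simp_all
    ultimately show ?thesis unfolding ej by (simp add: doubleton_eq_iff)
  qed
  then have "E ! i \<in> other_edges"
    unfolding other_edges_def by (blast intro: hull_inc)
  ultimately show thesis using that[OF ej] neq E[of i j] i j by auto
qed

text \<open>The vector a - b is a multiple \<sigma> of the tangent \<open>perp (n e)\<close>. An
  edge is an unordered pair, so \<sigma> may have either sign, and the statements about end points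
  are symmetric in a and b.\<close>

lemma edge_hull:
  shows "0 < edge_len e"
    and "convex hull e = (\<lambda>s. edge_point n e s) ` {- edge_len e / 2 .. edge_len e / 2}"
    and "edge_point n e (edge_len e / 2) \<in> e" "edge_point n e (- edge_len e / 2) \<in> e"
    and "edge_point n e (edge_len e / 2) \<in> other_edges" "edge_point n e (- edge_len e / 2) \<in> other_edges"
    and "e = {edge_point n e (edge_len e / 2), edge_point n e (- edge_len e / 2)}"
proof -
  obtain a b where ab: "e = {a, b}" "a \<noteq> b" "a \<in> other_edges" "b \<in> other_edges"
    by (rule endpoints)
  define \<sigma> where "\<sigma> = (a - b) \<bullet> perp (n e)"
  have "(a - b) \<bullet> n e = 0" using orthogonal[of a b] ab by (simp add: inner_commute)
  then have diff: "a - b = \<sigma> *\<^sub>R perp (n e)"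
    using frame_expansion[OF unit_normal, of "a - b"] by (simp add: \<sigma>_def)
  have mid: "edge_mid e = (1 / 2) *\<^sub>R (a + b)" using ab by (simp add: edge_mid_def)
  have len: "edge_len e = \<bar>\<sigma>\<bar>"
  proof -
    have "norm (a - b) = \<bar>\<sigma>\<bar>" using unit_normal by (simp add: diff)
    moreover have "diameter {a, b} = norm (a - b)"
      by (intro antisym diameter_le)
        (auto simp: dist_commute dist_norm[symmetric] intro!: diameter_bounded_bound)
    ultimately show ?thesis using ab by (simp add: edge_len_def)
  qed
  have "\<sigma> \<noteq> 0" using diff ab by auto
  then show "0 < edge_len e" by (simp add: len)
  have a: "edge_point n e (\<sigma> / 2) = a"
  proof -
    have "edge_point n e (\<sigma> / 2) = (1/2) *\<^sub>R (a + b) + (1/2) *\<^sub>R (a - b)"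
      by (simp add: edge_point_def mid diff)
    also have "\<dots> = a" by (simp add: vec_eq_iff field_simps)
    finally show ?thesis .
  qed
  have b: "edge_point n e (- \<sigma> / 2) = b"
  proof -
    have "edge_point n e (- \<sigma> / 2) = (1/2) *\<^sub>R (a + b) - (1/2) *\<^sub>R (a - b)"
      by (simp add: edge_point_def mid diff)
    also have "\<dots> = b" by (simp add: vec_eq_iff field_simps)
    finally show ?thesis .
  qed
  have "edge_point n e (edge_len e / 2) = a \<and> edge_point n e (- edge_len e / 2) = b \<or>
    edge_point n e (edge_len e / 2) = b \<and> edge_point n e (- edge_len e / 2) = a"
    using a b by (cases "0 \<le> \<sigma>") (auto simp: len)
  then show "edge_point n e (edge_len e / 2) \<in> e" "edge_point n e (- edge_len e / 2) \<in> e"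
    "edge_point n e (edge_len e / 2) \<in> other_edges" "edge_point n e (- edge_len e / 2) \<in> other_edges"
    "e = {edge_point n e (edge_len e / 2), edge_point n e (- edge_len e / 2)}"
    using ab by auto
  then have "convex hull e = closed_segment (edge_point n e (- edge_len e / 2)) (edge_point n e (edge_len e / 2))"
    by (metis segment_convex_hull insert_commute)
  also have "\<dots> = (\<lambda>s. edge_mid e + s) ` closed_segment ((- edge_len e / 2) *\<^sub>R perp (n e)) ((edge_len e / 2) *\<^sub>R perp (n e))"
    unfolding edge_point_def by (rule closed_segment_translation)
  also have "\<dots> = (\<lambda>s. edge_mid e + s) ` (\<lambda>s. s *\<^sub>R perp (n e)) ` closed_segment (- edge_len e / 2) (edge_len e / 2)"
    by (subst closed_segment_linear_image) (auto intro!: linearI simp: algebra_simps)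
  also have "closed_segment (- edge_len e / 2) (edge_len e / 2) = {- edge_len e / 2 .. edge_len e / 2}"
    using \<open>0 < edge_len e\<close> by (simp add: closed_segment_eq_real_ivl)
  finally show "convex hull e = (\<lambda>s. edge_point n e s) ` {- edge_len e / 2 .. edge_len e / 2}"
    by (simp add: image_image edge_point_def)
qed

text \<open>In a simple polygon two edges meet only in common vertices, and the vertices of
  \<open>e\<close> are the two points at parameters plus and minus half the length.\<close>

lemma edge_point_other_edges:
  assumes "\<bar>s\<bar> < edge_len e / 2"
  shows "edge_point n e s \<notin> other_edges"
proof
  assume "edge_point n e s \<in> other_edges"
  then obtain f where f: "f \<in> edges E" "f \<noteq> e" "edge_point n e s \<in> convex hull f"
    by (auto simp: other_edges_def)
  moreover have "s \<in> {- edge_len e / 2 .. edge_len e / 2}" using assms by auto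
  then have "edge_point n e s \<in> convex hull e" unfolding edge_hull(2) by (rule imageI)
  moreover have "convex hull e \<inter> convex hull f = e \<inter> f"
    using polygon edge f by (auto simp: simple_polygon_def)
  ultimately have "edge_point n e s \<in> e" by blast
  then have "edge_point n e s = edge_point n e (edge_len e / 2) \<or>
      edge_point n e s = edge_point n e (- edge_len e / 2)"
    using edge_hull(7) by blast
  then show False
    using assms by (auto simp: edge_point_frame frame_point_eq_iff[OF unit_normal])
qed

lemma frontier_cell_edge:
  assumes "x \<in> frontier (cell E)" "x \<notin> other_edges"
  shows "\<exists>s. \<bar>s\<bar> \<le> edge_len e / 2 \<and> x = edge_point n e s"
proof -
  have "x \<in> convex hull e"
    using assms frontier_cell[of E] by (auto simp: other_edges_def)
  then obtain s where "s \<in> {- edge_len e / 2 .. edge_len e / 2}" "x = edge_point n e s"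
    unfolding edge_hull(2) by blast
  moreover from this have "\<bar>s\<bar> \<le> edge_len e / 2" by auto
  ultimately show ?thesis by blast
qed

text \<open>The strip over |s| \<le> l with t in I is connected and misses the frontier of the cell:
  its points are closer than d to the edge, hence not on other edges, and t \<noteq> 0 keeps them
  off \<open>e\<close>. A connected set missing the frontier lies wholly inside or wholly
  outside.\<close>

lemma one_side:
  assumes l: "l < edge_len e / 2" and d: "0 < d" and t: "\<And>t. t \<in> I \<Longrightarrow> t \<noteq> 0 \<and> \<bar>t\<bar> < d"
    and I: "connected I"
    and sep: "\<And>s y. \<bar>s\<bar> \<le> l \<Longrightarrow> y \<in> other_edges \<Longrightarrow> d \<le> dist (edge_point n e s) y"
  shows "\<exists>A. \<forall>s t. \<bar>s\<bar> \<le> l \<longrightarrow> t \<in> I \<longrightarrow> (frame_point (edge_mid e) (n e) s t \<in> cell E \<longleftrightarrow> A)"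
proof -
  let ?P = "frame_point (edge_mid e) (n e)"
  let ?R = "(\<lambda>(s, t). ?P s t) ` ({- l..l} \<times> I)"
  have "connected ?R"
    using I unfolding frame_point_def case_prod_beta
    by (intro connected_continuous_image connected_Times continuous_intros) auto
  moreover have "?R \<inter> frontier (cell E) = {}"
  proof -
    have "?P s t \<notin> frontier (cell E)" if st: "\<bar>s\<bar> \<le> l" "t \<in> I" for s t
    proof
      assume fr: "?P s t \<in> frontier (cell E)"
      have "(dist (edge_point n e s) (?P s t))\<^sup>2 = \<bar>t\<bar>\<^sup>2"
        unfolding dist_norm edge_point_frame norm_frame_diff[OF unit_normal] by simp
      then have "dist (edge_point n e s) (?P s t) = \<bar>t\<bar>"
        by (subst (asm) power2_eq_iff_nonneg) auto
      then have "?P s t \<notin> other_edges" using sep[OF st(1), of "?P s t"] t[OF st(2)] by auto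
      then obtain s' where "?P s t = edge_point n e s'" using frontier_cell_edge[OF fr] by blast
      then show False
        using t[OF st(2)] by (simp add: edge_point_frame frame_point_eq_iff[OF unit_normal])
    qed
    then show ?thesis by (auto simp: abs_le_iff)
  qed
  ultimately have or: "?R \<inter> cell E = {} \<or> ?R - cell E = {}"
    using connected_Int_frontier by blast
  have inR: "?P s t \<in> ?R" if "\<bar>s\<bar> \<le> l" "t \<in> I" for s t
    using that by (intro image_eqI[of _ _ "(s, t)"]) (auto simp: abs_le_iff)
  show ?thesis
  proof (cases "?R \<inter> cell E = {}")
    case True
    then have "?P s t \<notin> cell E" if "\<bar>s\<bar> \<le> l" "t \<in> I" for s t
      using inR[OF that] by blast
    then show ?thesis by (intro exI[of _ False]) simp
  next
    case False
    then have "?P s t \<in> cell E" if "\<bar>s\<bar> \<le> l" "t \<in> I" for s t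
      using inR[OF that] or by blast
    then show ?thesis by (intro exI[of _ True]) simp
  qed
qed

text \<open>The side is read off along the normal through the midpoint, so that it depends neither
  on l nor on \<delta>. The trace polynomial must be one and the same for all test functions,
  whatever their supports.\<close>

definition right_side :: bool
  where "right_side \<longleftrightarrow> (\<forall>\<^sub>F t in at_right 0. frame_point (edge_mid e) (n e) 0 t \<in> cell E)"

definition left_side :: bool
  where "left_side \<longleftrightarrow> (\<forall>\<^sub>F t in at_left 0. frame_point (edge_mid e) (n e) 0 t \<in> cell E)"

lemma sides:
  assumes l: "0 \<le> l" "l < edge_len e / 2"
  obtains \<delta> where "0 < \<delta>"
    "\<And>s t. \<bar>s\<bar> \<le> l \<Longrightarrow> 0 < t \<Longrightarrow> t < \<delta> \<Longrightarrow> frame_point (edge_mid e) (n e) s t \<in> cell E \<longleftrightarrow> right_side"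
    "\<And>s t. \<bar>s\<bar> \<le> l \<Longrightarrow> - \<delta> < t \<Longrightarrow> t < 0 \<Longrightarrow> frame_point (edge_mid e) (n e) s t \<in> cell E \<longleftrightarrow> left_side"
proof -
  let ?P = "frame_point (edge_mid e) (n e)"
  have "compact (edge_point n e ` {- l..l})"
    unfolding edge_point_def by (intro compact_continuous_image continuous_intros) auto
  moreover have "edge_point n e ` {- l..l} \<inter> other_edges = {}"
    using edge_point_other_edges l by fastforce
  \<comment> \<open>The width d is the positive distance between the compact shortened edge and the
    closed set of other edges.\<close>
  ultimately obtain d where d: "0 < d" "\<forall>x\<in>edge_point n e ` {- l..l}. \<forall>y\<in>other_edges. d \<le> dist x y"
    using separate_compact_closed[OF _ closed_other_edges] by blast
  then have sep: "d \<le> dist (edge_point n e s) y" if "\<bar>s\<bar> \<le> l" "y \<in> other_edges" for s y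
    using that by (auto simp: abs_le_iff)
  have "\<exists>A. \<forall>s t. \<bar>s\<bar> \<le> l \<longrightarrow> t \<in> {0<..<d} \<longrightarrow> (?P s t \<in> cell E \<longleftrightarrow> A)"
    by (rule one_side[OF l(2) d(1) _ _ sep]) auto
  then obtain A where A: "\<forall>s t. \<bar>s\<bar> \<le> l \<longrightarrow> t \<in> {0<..<d} \<longrightarrow> (?P s t \<in> cell E \<longleftrightarrow> A)"
    by (rule exE)
  have "\<exists>B. \<forall>s t. \<bar>s\<bar> \<le> l \<longrightarrow> t \<in> {- d<..<0} \<longrightarrow> (?P s t \<in> cell E \<longleftrightarrow> B)"
    by (rule one_side[OF l(2) d(1) _ _ sep]) auto
  then obtain B where B: "\<forall>s t. \<bar>s\<bar> \<le> l \<longrightarrow> t \<in> {- d<..<0} \<longrightarrow> (?P s t \<in> cell E \<longleftrightarrow> B)"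
    by (rule exE)
  have r: "\<forall>\<^sub>F t in at_right 0. t \<in> {0<..<d}" using d(1) by (rule eventually_at_right_real)
  have lf: "\<forall>\<^sub>F t in at_left 0. t \<in> {- d<..<0}" using d(1) by (intro eventually_at_left_real) auto
  \<comment> \<open>The constant A for the whole strip is identified at s = 0, which lies in the
    strip because 0 \<le> l.\<close>
  have "right_side \<longleftrightarrow> (\<forall>\<^sub>F t in at_right (0::real). A)"
    unfolding right_side_def
    by (rule eventually_cong[OF r]) (use l(1) A in simp)
  then have A': "right_side = A" by simp
  have "left_side \<longleftrightarrow> (\<forall>\<^sub>F t in at_left (0::real). B)"
    unfolding left_side_def
    by (rule eventually_cong[OF lf]) (use l(1) B in simp)
  then have B': "left_side = B" by simp
  show thesis
    by (rule that[OF d(1)]) (use A B in \<open>simp_all add: A' B'\<close>)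
qed

text \<open>Take for l the largest |s| at which the edge meets \<open>K\<close>. It is attained by
  compactness and is less than half the length, since the end points lie on other edges.\<close>

lemma edge_gap:
  assumes K: "compact K" "K \<inter> other_edges = {}"
  obtains l where "0 \<le> l" "l < edge_len e / 2"
    "\<And>s. l < \<bar>s\<bar> \<Longrightarrow> \<bar>s\<bar> \<le> edge_len e / 2 \<Longrightarrow> edge_point n e s \<notin> K"
proof -
  let ?r = "edge_len e / 2"
  define J where "J = {- ?r..?r} \<inter> edge_point n e -` K"
  have cont: "continuous_on UNIV (edge_point n e)"
    unfolding edge_point_def by (intro continuous_intros)
  have inJ: "s \<in> J" if "\<bar>s\<bar> \<le> ?r" "edge_point n e s \<in> K" for s
  proof -
    have "s \<in> {- ?r..?r}" using that(1) by auto
    then show ?thesis using that(2) by (simp add: J_def)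
  qed
  have "compact J"
    unfolding J_def using K(1) cont
    by (intro compact_Int_closed closed_vimage) (auto simp: compact_imp_closed)
  show thesis
  proof (cases "J = {}")
    case True
    show ?thesis
      by (rule that[of 0]) (use True edge_hull(1) inJ in auto)
  next
    case False
    then have "\<exists>x\<in>J. \<forall>y\<in>J. \<bar>y\<bar> \<le> \<bar>x\<bar>"
      by (intro continuous_attains_sup \<open>compact J\<close> continuous_intros)
    then obtain s0 where s0: "s0 \<in> J" "\<And>s. s \<in> J \<Longrightarrow> \<bar>s\<bar> \<le> \<bar>s0\<bar>" by blast
    have "edge_point n e s0 \<in> K" "\<bar>s0\<bar> \<le> ?r" using s0(1) by (auto simp: J_def)
    moreover have "edge_point n e ?r \<notin> K" "edge_point n e (- ?r) \<notin> K"
      using edge_hull(5,6) K by auto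
    ultimately have "s0 \<noteq> ?r" "s0 \<noteq> - ?r" by blast+
    then have "\<bar>s0\<bar> \<noteq> ?r" by linarith
    moreover have "edge_point n e s \<notin> K" if "\<bar>s0\<bar> < \<bar>s\<bar>" "\<bar>s\<bar> \<le> ?r" for s
      using s0(2)[OF inJ, of s] that by auto
    ultimately show ?thesis
      using that[of "\<bar>s0\<bar>"] \<open>\<bar>s0\<bar> \<le> ?r\<close> by auto
  qed
qed

text \<open>The support determines l, and l determines \<delta>, but neither survives in the result:
  the jump factor belongs to the edge alone.\<close>

lemma green_edge:
  fixes f :: "real^2 \<Rightarrow> real"
  assumes K: "compact K" "K \<inter> other_edges = {}"
    and diff: "\<And>x. f differentiable at x" and cont: "continuous_on UNIV (grad f)"
    and zero: "\<And>x. x \<notin> K \<Longrightarrow> f x = 0"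
  shows "integral\<^sup>L (lebesgue_on (cell E)) (\<lambda>x. grad f x \<bullet> perp (n e)) = 0"
    and "integral\<^sup>L (lebesgue_on (cell E)) (\<lambda>x. grad f x \<bullet> n e) =
      (of_bool left_side - of_bool right_side) * edge_integral e (\<lambda>s. f (edge_point n e s))"
proof -
  obtain l where l: "0 \<le> l" "l < edge_len e / 2"
    "\<And>s. l < \<bar>s\<bar> \<Longrightarrow> \<bar>s\<bar> \<le> edge_len e / 2 \<Longrightarrow> edge_point n e s \<notin> K"
    using edge_gap[OF K] by blast
  obtain \<delta> where \<delta>: "0 < \<delta>"
    "\<And>s t. \<bar>s\<bar> \<le> l \<Longrightarrow> 0 < t \<Longrightarrow> t < \<delta> \<Longrightarrow> frame_point (edge_mid e) (n e) s t \<in> cell E \<longleftrightarrow> right_side"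
    "\<And>s t. \<bar>s\<bar> \<le> l \<Longrightarrow> - \<delta> < t \<Longrightarrow> t < 0 \<Longrightarrow> frame_point (edge_mid e) (n e) s t \<in> cell E \<longleftrightarrow> left_side"
    using sides[OF l(1,2)] by blast
  have bd: "\<exists>s. \<bar>s\<bar> \<le> l \<and> x = frame_point (edge_mid e) (n e) s 0"
    if x: "x \<in> K" "x \<in> frontier (cell E)" for x
  proof -
    have "x \<notin> other_edges" using K x by auto
    then obtain s where "\<bar>s\<bar> \<le> edge_len e / 2" "x = edge_point n e s"
      using frontier_cell_edge x by blast
    moreover have "\<bar>s\<bar> \<le> l" using l(3)[of s] x calculation by force
    ultimately show ?thesis by (auto simp: edge_point_frame)
  qed
  note green = green_frame[OF unit_normal open_cell K(1) diff cont zero bd _ _ \<delta>,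
      where r = "edge_len e / 2", folded edge_point_frame]
  show "integral\<^sup>L (lebesgue_on (cell E)) (\<lambda>x. grad f x \<bullet> perp (n e)) = 0"
    using l by (intro green) auto
  show "integral\<^sup>L (lebesgue_on (cell E)) (\<lambda>x. grad f x \<bullet> n e) =
      (of_bool left_side - of_bool right_side) * edge_integral e (\<lambda>s. f (edge_point n e s))"
    unfolding edge_integral_def minus_divide_left[symmetric] using l by (intro green) auto
qed

end

section \<open>Normal traces\<close>

lemma polys_on_line:
  assumes "f \<in> polys l"
  shows "\<exists>q. \<forall>s. f (a + s *\<^sub>R b) = poly q s"
proof -
  obtain c where c: "f = (\<lambda>x. \<Sum>(i, j) | int i + int j \<le> l. c i j * (x $ 1) ^ i * (x $ 2) ^ j)"
    using assms unfolding polys_def by auto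
  let ?q = "\<Sum>(i, j) | int i + int j \<le> l. smult (c i j) ([:a $ 1, b $ 1:] ^ i * [:a $ 2, b $ 2:] ^ j)"
  have "f (a + s *\<^sub>R b) = poly ?q s" for s
    by (simp add: c poly_sum case_prod_beta poly_power mult.assoc)
  then show ?thesis by blast
qed

lemma test_functions_mono: "D \<subseteq> D' \<Longrightarrow> test_functions D \<subseteq> test_functions D'"
  unfolding test_functions_def by blast

lemma test_function_support:
  assumes "\<phi> \<in> test_functions D"
  obtains K where "compact K" "K \<subseteq> D" "\<And>x. x \<notin> K \<Longrightarrow> \<phi> x = 0"
  using assms closure_subset[of "{x. \<phi> x \<noteq> 0}"] unfolding test_functions_def by blast

lemma L2_test_function:
  assumes "\<phi> \<in> test_functions D'"
  shows "\<phi> \<in> L2 (cell E)" "grad \<phi> \<in> L2 (cell E)"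
  using assms by (auto intro!: L2_continuous bounded_cell test_function_continuous test_function_grad_continuous)

lemma green_integrand_integrable:
  assumes "v \<in> L2 (cell E)" "g \<in> L2 (cell E)" "\<phi> \<in> test_functions D"
  shows "integrable (lebesgue_on (cell E)) (\<lambda>x. v x \<bullet> grad \<phi> x)"
    and "integrable (lebesgue_on (cell E)) (\<lambda>x. g x * \<phi> x)"
  using L2_inner_integrable[OF assms(1) L2_test_function(2)[OF assms(3)]]
    L2_inner_integrable[OF assms(2) L2_test_function(1)[OF assms(3)]] by simp_all

lemma edge_integrable:
  fixes f :: "real \<Rightarrow> real"
  assumes "continuous_on UNIV f"
  shows "integrable (lebesgue_on {- edge_len e / 2 .. edge_len e / 2}) f"
proof -
  have "continuous_on {- edge_len e / 2 .. edge_len e / 2} f"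
    using assms by (rule continuous_on_subset) simp
  then show ?thesis by (rule continuous_imp_integrable_real)
qed

lemma edge_integral_lincomb:
  assumes "continuous_on UNIV f" "continuous_on UNIV g"
  shows "edge_integral e (\<lambda>s. a * f s + b * g s) = a * edge_integral e f + b * edge_integral e g"
  using edge_integrable[OF assms(1)] edge_integrable[OF assms(2)] by (simp add: edge_integral_def)

lemma continuous_poly: "continuous_on S (poly (q :: real poly))"
  by (intro continuous_intros)

lemma continuous_edge_point: "continuous_on S (edge_point n e)"
  unfolding edge_point_def by (intro continuous_intros)

lemma continuous_on_edge:
  assumes "continuous_on UNIV f"
  shows "continuous_on UNIV (\<lambda>s. f (edge_point n e s))"
  by (intro continuous_on_compose2[OF assms continuous_edge_point]) auto

lemma has_normal_trace_lincomb:
  assumes "v1 \<in> L2 (cell E)" "v2 \<in> L2 (cell E)"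
    and "has_normal_trace n E e v1 q1" "has_normal_trace n E e v2 q2"
  shows "has_normal_trace n E e (\<lambda>x. a *\<^sub>R v1 x + b *\<^sub>R v2 x) (smult a q1 + smult b q2)"
proof -
  let ?D = "- (\<Union>f \<in> edges E - {e}. convex hull f)"
  obtain g1 where g1: "g1 \<in> L2 (cell E)" "weak_div (cell E) v1 g1"
    "\<And>\<phi>. \<phi> \<in> test_functions ?D \<Longrightarrow>
      integral\<^sup>L (lebesgue_on (cell E)) (\<lambda>x. v1 x \<bullet> grad \<phi> x + g1 x * \<phi> x) =
      edge_sign n E e * edge_integral e (\<lambda>s. poly q1 s * \<phi> (edge_point n e s))"
    using assms(3) unfolding has_normal_trace_def by blast
  obtain g2 where g2: "g2 \<in> L2 (cell E)" "weak_div (cell E) v2 g2"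
    "\<And>\<phi>. \<phi> \<in> test_functions ?D \<Longrightarrow>
      integral\<^sup>L (lebesgue_on (cell E)) (\<lambda>x. v2 x \<bullet> grad \<phi> x + g2 x * \<phi> x) =
      edge_sign n E e * edge_integral e (\<lambda>s. poly q2 s * \<phi> (edge_point n e s))"
    using assms(4) unfolding has_normal_trace_def by blast
  let ?v = "\<lambda>x. a *\<^sub>R v1 x + b *\<^sub>R v2 x" and ?g = "\<lambda>x. a * g1 x + b * g2 x"
  have g: "?g \<in> L2 (cell E)" using L2_lincomb[OF g1(1) g2(1), of a b] by simp
  have "weak_div (cell E) ?v ?g"
    unfolding weak_div_def
  proof
    fix \<phi> assume \<phi>: "\<phi> \<in> test_functions (cell E)"
    have "?v x \<bullet> grad \<phi> x = a * (v1 x \<bullet> grad \<phi> x) + b * (v2 x \<bullet> grad \<phi> x)"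
      "?g x * \<phi> x = a * (g1 x * \<phi> x) + b * (g2 x * \<phi> x)" for x
      by (simp_all add: inner_add_left algebra_simps)
    then show "integral\<^sup>L (lebesgue_on (cell E)) (\<lambda>x. ?v x \<bullet> grad \<phi> x) =
        - integral\<^sup>L (lebesgue_on (cell E)) (\<lambda>x. ?g x * \<phi> x)"
      using green_integrand_integrable[OF assms(1) g1(1) \<phi>] green_integrand_integrable[OF assms(2) g2(1) \<phi>]
        g1(2) g2(2) \<phi> by (simp add: weak_div_def)
  qed
  moreover have "integral\<^sup>L (lebesgue_on (cell E)) (\<lambda>x. ?v x \<bullet> grad \<phi> x + ?g x * \<phi> x) =
      edge_sign n E e * edge_integral e (\<lambda>s. poly (smult a q1 + smult b q2) s * \<phi> (edge_point n e s))"
    if \<phi>: "\<phi> \<in> test_functions ?D" for \<phi>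
  proof -
    let ?i1 = "\<lambda>x. v1 x \<bullet> grad \<phi> x + g1 x * \<phi> x" and ?i2 = "\<lambda>x. v2 x \<bullet> grad \<phi> x + g2 x * \<phi> x"
    have "?v x \<bullet> grad \<phi> x + ?g x * \<phi> x = a * ?i1 x + b * ?i2 x" for x
      by (simp add: inner_add_left algebra_simps)
    moreover have "integrable (lebesgue_on (cell E)) ?i1" "integrable (lebesgue_on (cell E)) ?i2"
      using green_integrand_integrable[OF assms(1) g1(1) \<phi>] green_integrand_integrable[OF assms(2) g2(1) \<phi>]
      by simp_all
    ultimately have "integral\<^sup>L (lebesgue_on (cell E)) (\<lambda>x. ?v x \<bullet> grad \<phi> x + ?g x * \<phi> x) =
        a * integral\<^sup>L (lebesgue_on (cell E)) ?i1 + b * integral\<^sup>L (lebesgue_on (cell E)) ?i2"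
      by simp
    also have "\<dots> = edge_sign n E e * (a * edge_integral e (\<lambda>s. poly q1 s * \<phi> (edge_point n e s)) +
        b * edge_integral e (\<lambda>s. poly q2 s * \<phi> (edge_point n e s)))"
      using g1(3)[OF \<phi>] g2(3)[OF \<phi>] by (simp add: algebra_simps)
    also have "\<dots> = edge_sign n E e *
        edge_integral e (\<lambda>s. a * (poly q1 s * \<phi> (edge_point n e s)) + b * (poly q2 s * \<phi> (edge_point n e s)))"
      by (subst edge_integral_lincomb)
        (auto intro!: continuous_on_mult continuous_poly continuous_on_edge test_function_continuous[OF \<phi>])
    also have "(\<lambda>s. a * (poly q1 s * \<phi> (edge_point n e s)) + b * (poly q2 s * \<phi> (edge_point n e s)))
        = (\<lambda>s. poly (smult a q1 + smult b q2) s * \<phi> (edge_point n e s))"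
      by (simp add: fun_eq_iff algebra_simps)
    finally show ?thesis .
  qed
  ultimately show ?thesis using g unfolding has_normal_trace_def by blast
qed

text \<open>Linearity of \<open>proj\<close> is established on the cell only; this lemma and
  \<open>dof_cong\<close> carry it over to the degrees of freedom.\<close>

lemma has_normal_trace_cong:
  assumes "\<And>x. x \<in> cell E \<Longrightarrow> u x = v x"
  shows "has_normal_trace n E e u q \<longleftrightarrow> has_normal_trace n E e v q"
proof -
  have "integral\<^sup>L (lebesgue_on (cell E)) (\<lambda>x. u x \<bullet> w x + g x) =
      integral\<^sup>L (lebesgue_on (cell E)) (\<lambda>x. v x \<bullet> w x + g x)" for w :: vfield and g
    using assms by (intro Bochner_Integration.integral_cong) simp_all
  moreover from this[of _ "\<lambda>x. 0"] have "integral\<^sup>L (lebesgue_on (cell E)) (\<lambda>x. u x \<bullet> w x) =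
      integral\<^sup>L (lebesgue_on (cell E)) (\<lambda>x. v x \<bullet> w x)" for w :: vfield
    by simp
  ultimately show ?thesis unfolding has_normal_trace_def weak_div_def by simp
qed

context polygon_edge
begin

text \<open>Every rotated frame gives the same divergence, so \<open>\<nabla> \<cdot> u\<close> is written in the frame of
  the edge, in which Green's formula splits into two one-dimensional ones.\<close>

lemma vpolys_normal_trace:
  assumes u: "u \<in> vpolys l"
  shows "\<exists>q. has_normal_trace n E e u q"
proof -
  let ?N = "n e" and ?T = "perp (n e)"
  have comp: "elementary (\<lambda>x. u x $ i)" for i
    using u elementary_polys unfolding vpolys_def by blast
  have el: "elementary (\<lambda>x. u x \<bullet> w)" for w
    unfolding inner_vec_def by (auto intro!: elementary_sum elementary_mult elementary_const comp)
  define a where "a = (\<lambda>x. u x \<bullet> ?T)"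
  define b where "b = (\<lambda>x. u x \<bullet> ?N)"
  define g where "g = (\<lambda>x. grad a x \<bullet> ?T + grad b x \<bullet> ?N)"
  have ab: "elementary a" "elementary b" using el by (simp_all add: a_def b_def)
  have contg: "continuous_on UNIV g"
    unfolding g_def using ab by (intro continuous_intros elementary_grad_continuous)
  obtain q1 q2 where q12: "\<And>s. u (edge_mid e + s *\<^sub>R ?T) $ 1 = poly q1 s" "\<And>s. u (edge_mid e + s *\<^sub>R ?T) $ 2 = poly q2 s"
    using polys_on_line u unfolding vpolys_def by (metis (mono_tags, lifting) mem_Collect_eq)
  define q0 where "q0 = smult (?N $ 1) q1 + smult (?N $ 2) q2"
  have q0: "b (edge_point n e s) = poly q0 s" for s
    by (simp add: b_def q0_def inner_vec_def sum_2 edge_point_def q12 mult.commute)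
  define \<sigma> :: real where "\<sigma> = of_bool left_side - of_bool right_side"
  have main: "integral\<^sup>L (lebesgue_on (cell E)) (\<lambda>x. u x \<bullet> grad \<phi> x + g x * \<phi> x) =
      \<sigma> * edge_integral e (\<lambda>s. poly q0 s * \<phi> (edge_point n e s))"
    if \<phi>: "\<phi> \<in> test_functions (- other_edges)" for \<phi>
  proof -
    obtain K where K: "compact K" "K \<subseteq> - other_edges" "\<And>x. x \<notin> K \<Longrightarrow> \<phi> x = 0"
      using test_function_support[OF \<phi>] by blast
    have d: "((\<lambda>x. f x * \<phi> x) has_derivative (\<lambda>v. (f x *\<^sub>R grad \<phi> x + \<phi> x *\<^sub>R grad f x) \<bullet> v)) (at x)"
      if "elementary f" for f x
      by (rule has_derivative_eq_rhs[OF has_derivative_mult[OF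
            has_derivative_grad[OF elementary_differentiable[OF that]]
            has_derivative_grad[OF test_function_differentiable[OF \<phi>]]]])
        (auto simp: inner_add_left)
    have gr: "grad (\<lambda>x. f x * \<phi> x) = (\<lambda>x. f x *\<^sub>R grad \<phi> x + \<phi> x *\<^sub>R grad f x)" if "elementary f" for f
      using grad_eqI[OF d[OF that]] by (rule ext)
    have df: "(\<lambda>x. f x * \<phi> x) differentiable at x" if "elementary f" for f x
      using d[OF that] unfolding differentiable_def by blast
    have ct: "continuous_on UNIV (grad (\<lambda>x. f x * \<phi> x))" if "elementary f" for f
      unfolding gr[OF that]
      by (intro continuous_intros elementary_continuous that elementary_grad_continuous
          test_function_continuous[OF \<phi>] test_function_grad_continuous[OF \<phi>])
    have KK: "K \<inter> other_edges = {}" using K(2) by blast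
    \<comment> \<open>\<open>?A\<close> is the tangential derivative of the tangential component
      times \<phi>, with integral 0; \<open>?B\<close> is its normal counterpart and supplies the
      edge term.\<close>
    let ?A = "\<lambda>x. grad (\<lambda>x. a x * \<phi> x) x \<bullet> ?T" and ?B = "\<lambda>x. grad (\<lambda>x. b x * \<phi> x) x \<bullet> ?N"
    have "u x \<bullet> grad \<phi> x = a x * (grad \<phi> x \<bullet> ?T) + b x * (grad \<phi> x \<bullet> ?N)" for x
    proof -
      have "u x \<bullet> grad \<phi> x = (a x *\<^sub>R ?T + b x *\<^sub>R ?N) \<bullet> grad \<phi> x"
        using frame_expansion[OF unit_normal, of "u x"] by (simp add: a_def b_def)
      also have "\<dots> = a x * (?T \<bullet> grad \<phi> x) + b x * (?N \<bullet> grad \<phi> x)"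
        by (simp only: inner_add_left inner_scaleR_left)
      finally show ?thesis by (simp only: inner_commute)
    qed
    then have "(\<lambda>x. u x \<bullet> grad \<phi> x + g x * \<phi> x) = (\<lambda>x. ?A x + ?B x)"
      unfolding gr[OF ab(1)] gr[OF ab(2)] g_def by (simp add: inner_add_left fun_eq_iff algebra_simps)
    moreover have "integrable (lebesgue_on (cell E)) (\<lambda>x. grad (\<lambda>x. f x * \<phi> x) x \<bullet> w)" if "elementary f" for f w
      using L2_inner_integrable[OF L2_continuous[OF cell_sets bounded_cell ct[OF that]]
          L2_continuous[OF cell_sets bounded_cell continuous_on_const]] .
    ultimately have "integral\<^sup>L (lebesgue_on (cell E)) (\<lambda>x. u x \<bullet> grad \<phi> x + g x * \<phi> x) =
        integral\<^sup>L (lebesgue_on (cell E)) ?A + integral\<^sup>L (lebesgue_on (cell E)) ?B"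
      using ab by simp
    also have "integral\<^sup>L (lebesgue_on (cell E)) ?A = 0"
      by (rule green_edge(1)[OF K(1) KK df[OF ab(1)] ct[OF ab(1)]]) (simp add: K(3))
    also have "integral\<^sup>L (lebesgue_on (cell E)) ?B =
        \<sigma> * edge_integral e (\<lambda>s. b (edge_point n e s) * \<phi> (edge_point n e s))"
      unfolding \<sigma>_def by (rule green_edge(2)[OF K(1) KK df[OF ab(2)] ct[OF ab(2)]]) (simp add: K(3))
    finally show ?thesis by (simp add: q0)
  qed
  \<comment> \<open>A test function of the open cell vanishes on the edge, so \<open>main\<close>
    without its edge term is the weak divergence identity.\<close>
  have "weak_div (cell E) u g"
    unfolding weak_div_def
  proof
    fix \<phi> assume \<phi>: "\<phi> \<in> test_functions (cell E)"
    have "cell E \<subseteq> - other_edges"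
      using cell_disjoint_edges unfolding other_edges_def by fastforce
    then have \<phi>': "\<phi> \<in> test_functions (- other_edges)" using \<phi> test_functions_mono by blast
    obtain K where K: "K \<subseteq> cell E" "\<And>x. x \<notin> K \<Longrightarrow> \<phi> x = 0"
      using test_function_support[OF \<phi>] by metis
    have "\<phi> (edge_point n e s) = 0" if "s \<in> {- edge_len e / 2..edge_len e / 2}" for s
    proof -
      have "edge_point n e s \<in> convex hull e" using that unfolding edge_hull(2) by (rule imageI)
      then show ?thesis using K cell_disjoint_edges[OF edge] by blast
    qed
    then have "edge_integral e (\<lambda>s. poly q0 s * \<phi> (edge_point n e s)) = edge_integral e (\<lambda>s. 0)"
      unfolding edge_integral_def by (intro Bochner_Integration.integral_cong) simp_all
    then have "integral\<^sup>L (lebesgue_on (cell E)) (\<lambda>x. u x \<bullet> grad \<phi> x + g x * \<phi> x) = 0"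
      using main[OF \<phi>'] by (simp add: edge_integral_def)
    moreover have "u \<in> L2 (cell E)"
    proof (rule L2_continuous[OF cell_sets bounded_cell])
      show "continuous_on UNIV u"
        using continuous_on_vec_lambda[of UNIV "\<lambda>i x. u x $ i"] elementary_continuous[OF comp] by simp
    qed
    note green_integrand_integrable[OF this L2_continuous[OF cell_sets bounded_cell contg] \<phi>]
    ultimately show "integral\<^sup>L (lebesgue_on (cell E)) (\<lambda>x. u x \<bullet> grad \<phi> x) =
        - integral\<^sup>L (lebesgue_on (cell E)) (\<lambda>x. g x * \<phi> x)" by simp
  qed
  moreover have "integral\<^sup>L (lebesgue_on (cell E)) (\<lambda>x. u x \<bullet> grad \<phi> x + g x * \<phi> x) =
      edge_sign n E e * edge_integral e (\<lambda>s. poly (smult (edge_sign n E e * \<sigma>) q0) s * \<phi> (edge_point n e s))"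
    if \<phi>: "\<phi> \<in> test_functions (- other_edges)" for \<phi>
  proof -
    \<comment> \<open>Since \<open>edge_sign\<close> is 1 or -1, putting
      \<open>edge_sign n E e * \<sigma>\<close> into the polynomial cancels the sign in the
      definition of a trace and leaves the factor \<sigma> of \<open>main\<close>.\<close>
    have "edge_integral e (\<lambda>s. poly (smult (edge_sign n E e * \<sigma>) q0) s * \<phi> (edge_point n e s))
        = edge_sign n E e * \<sigma> * edge_integral e (\<lambda>s. poly q0 s * \<phi> (edge_point n e s))"
      by (simp add: edge_integral_def mult.assoc)
    moreover have "edge_sign n E e * edge_sign n E e = 1" by (simp add: edge_sign_def)
    ultimately show ?thesis unfolding main[OF \<phi>] by (simp add: mult.assoc[symmetric])
  qed
  ultimately have "has_normal_trace n E e u (smult (edge_sign n E e * \<sigma>) q0)"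
    using L2_continuous[OF cell_sets bounded_cell contg]
    unfolding has_normal_trace_def other_edges_def by blast
  then show ?thesis by blast
qed

text \<open>The weak divergence in the definition of a trace need not be shown to be unique: test
  functions \<open>\<phi>\<^sub>j\<close> that all agree on the edge but tend to zero off its line make the integrals
  over the element vanish in the limit.\<close>

lemma normal_trace_unique:
  assumes v: "v \<in> L2 (cell E)"
    and "has_normal_trace n E e v q1" "has_normal_trace n E e v q2"
  shows "q1 = q2"
proof (rule ccontr)
  assume "q1 \<noteq> q2"
  define d where "d = q1 - q2"
  have d0: "d \<noteq> 0" using \<open>q1 \<noteq> q2\<close> by (simp add: d_def)
  let ?m = "edge_mid e" and ?N = "n e" and ?T = "perp (n e)" and ?l = "edge_len e / 2"
  obtain g1 where g1: "g1 \<in> L2 (cell E)"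
    "\<And>\<phi>. \<phi> \<in> test_functions (- other_edges) \<Longrightarrow>
      integral\<^sup>L (lebesgue_on (cell E)) (\<lambda>x. v x \<bullet> grad \<phi> x + g1 x * \<phi> x) =
      edge_sign n E e * edge_integral e (\<lambda>s. poly q1 s * \<phi> (edge_point n e s))"
    using assms(2) unfolding has_normal_trace_def other_edges_def by blast
  obtain g2 where g2: "g2 \<in> L2 (cell E)"
    "\<And>\<phi>. \<phi> \<in> test_functions (- other_edges) \<Longrightarrow>
      integral\<^sup>L (lebesgue_on (cell E)) (\<lambda>x. v x \<bullet> grad \<phi> x + g2 x * \<phi> x) =
      edge_sign n E e * edge_integral e (\<lambda>s. poly q2 s * \<phi> (edge_point n e s))"
    using assms(3) unfolding has_normal_trace_def other_edges_def by blast
  have "?m \<notin> other_edges"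
    using edge_point_other_edges[of 0] edge_hull(1) by (simp add: edge_point_def)
  then obtain r0 where r0: "0 < r0" "cball ?m r0 \<subseteq> - other_edges"
    using closed_other_edges open_contains_cball[of "- other_edges"] by auto
  \<comment> \<open>The radius keeps the ball off the other edges, and the parameters |s| < r inside
    the interval of integration of the edge.\<close>
  define r where "r = min r0 ?l"
  have r: "0 < r" "cball ?m r \<subseteq> - other_edges" "r \<le> ?l"
    using r0 edge_hull(1) by (auto simp: r_def)
  \<comment> \<open>A bump times the polynomial d extended constantly across the edge: on the edge,
    (q1 - q2) times \<beta> is d^2 times a bump. The function \<psi> below equals 1 on the line of
    the edge and is less than 1 elsewhere, so the functions \<beta> \<psi>^j agree on the edge and
    shrink to 0 off its line.\<close>
  define \<beta> where "\<beta> = (\<lambda>x. exp_flat 1 (r\<^sup>2 - (x - ?m) \<bullet> (x - ?m)) * poly d ((x - ?m) \<bullet> ?T))"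
  define \<psi> where "\<psi> = (\<lambda>x. 1 - ((x - ?m) \<bullet> ?N)\<^sup>2 / r\<^sup>2)"
  have el\<beta>: "elementary \<beta>"
    unfolding \<beta>_def by (intro elementary_mult elementary_bump elementary_poly elementary_inner)
  have "elementary (\<lambda>x. 1 - ((x - ?m) \<bullet> ?N)^2 * (1 / r\<^sup>2))"
    by (intro elementary_diff elementary_mult elementary_power elementary_inner elementary_const)
  then have el\<psi>: "elementary \<psi>" by (simp add: \<psi>_def)
  have zero: "\<beta> x = 0" if "x \<notin> cball ?m r" for x
  proof -
    have "r < norm (x - ?m)" using that by (simp add: dist_norm norm_minus_commute)
    then have "r\<^sup>2 \<le> (norm (x - ?m))\<^sup>2" using r(1) by (intro power_mono) auto
    then show ?thesis by (simp add: \<beta>_def exp_flat_def power2_norm_eq_inner)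
  qed
  have \<psi>01: "0 \<le> \<psi> x \<and> \<psi> x \<le> 1" if "x \<in> cball ?m r" for x
  proof -
    have "\<bar>(x - ?m) \<bullet> ?N\<bar> \<le> norm (x - ?m)"
      using Cauchy_Schwarz_ineq2[of "x - ?m" ?N] by (simp add: unit_normal)
    also have "\<dots> \<le> r" using that by (simp add: dist_norm norm_minus_commute)
    finally have "\<bar>(x - ?m) \<bullet> ?N\<bar>\<^sup>2 \<le> r\<^sup>2" by (intro power_mono) auto
    then show ?thesis using r(1) by (simp add: \<psi>_def)
  qed
  define \<phi> where "\<phi> = (\<lambda>j x. \<beta> x * \<psi> x ^ j)"
  have el\<phi>: "elementary (\<phi> j)" for j
    unfolding \<phi>_def by (intro elementary_mult el\<beta> elementary_power el\<psi>)
  have test: "\<phi> j \<in> test_functions (- other_edges)" for j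
  proof -
    have "{x. \<phi> j x \<noteq> 0} \<subseteq> cball ?m r" using zero by (force simp: \<phi>_def)
    then have c: "closure {x. \<phi> j x \<noteq> 0} \<subseteq> cball ?m r" by (rule closure_minimal) simp
    then have "compact (closure {x. \<phi> j x \<noteq> 0})"
      by (meson bounded_cball bounded_subset closed_closure compact_eq_bounded_closed)
    then show ?thesis using c r(2) elementary_smooth[OF el\<phi>] unfolding test_functions_def by blast
  qed
  define I where "I = edge_integral e (\<lambda>s. (poly d s)\<^sup>2 * exp_flat 1 (r\<^sup>2 - s\<^sup>2))"
  have N: "?N \<bullet> ?N = 1" using unit_normal by (simp add: norm_eq_1)
  have on_edge: "\<phi> j (edge_point n e s) = poly d s * exp_flat 1 (r\<^sup>2 - s\<^sup>2)" for j s
    by (simp add: \<phi>_def \<beta>_def \<psi>_def edge_point_def N power2_eq_square)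
  \<comment> \<open>Both trace identities contain the same term v \<bullet> grad \<phi>, which
    cancels on subtraction; what remains on the right does not depend on j.\<close>
  have const: "integral\<^sup>L (lebesgue_on (cell E)) (\<lambda>x. (g1 x - g2 x) * \<phi> j x) = edge_sign n E e * I" for j
  proof -
    have "integral\<^sup>L (lebesgue_on (cell E)) (\<lambda>x. (g1 x - g2 x) * \<phi> j x) =
      integral\<^sup>L (lebesgue_on (cell E)) (\<lambda>x. v x \<bullet> grad (\<phi> j) x + g1 x * \<phi> j x) -
      integral\<^sup>L (lebesgue_on (cell E)) (\<lambda>x. v x \<bullet> grad (\<phi> j) x + g2 x * \<phi> j x)"
      using green_integrand_integrable[OF v g1(1) test] green_integrand_integrable[OF v g2(1) test]
      by (simp add: left_diff_distrib)
    also have "\<dots> = edge_sign n E e * (edge_integral e (\<lambda>s. poly q1 s * \<phi> j (edge_point n e s))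
        - edge_integral e (\<lambda>s. poly q2 s * \<phi> j (edge_point n e s)))"
      by (simp add: g1(2)[OF test] g2(2)[OF test] right_diff_distrib)
    also have "edge_integral e (\<lambda>s. poly q1 s * \<phi> j (edge_point n e s))
        - edge_integral e (\<lambda>s. poly q2 s * \<phi> j (edge_point n e s)) =
        edge_integral e (\<lambda>s. 1 * (poly q1 s * \<phi> j (edge_point n e s)) + (-1) * (poly q2 s * \<phi> j (edge_point n e s)))"
      by (subst edge_integral_lincomb)
        (auto intro!: continuous_on_mult continuous_poly continuous_on_edge elementary_continuous[OF el\<phi>])
    also have "\<dots> = I"
      unfolding I_def by (rule arg_cong[where f = "edge_integral e"])
        (simp add: fun_eq_iff on_edge d_def power2_eq_square algebra_simps)
    finally show ?thesis .
  qed
  have "(\<lambda>j. integral\<^sup>L (lebesgue_on (cell E)) (\<lambda>x. (g1 x - g2 x) * \<phi> j x)) \<longlonglongrightarrow>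
      integral\<^sup>L (lebesgue_on (cell E)) (\<lambda>x. 0)"
  proof (rule integral_dominated_convergence[where w = "\<lambda>x. \<bar>(g1 x - g2 x) * \<beta> x\<bar>"])
    have i: "integrable (lebesgue_on (cell E)) (\<lambda>x. (g1 x - g2 x) * f x)" if "elementary f" for f
      using L2_inner_integrable[OF L2_diff[OF g1(1) g2(1)]
          L2_continuous[OF cell_sets bounded_cell elementary_continuous[OF that]]] by simp
    show "(\<lambda>x. (g1 x - g2 x) * \<phi> j x) \<in> borel_measurable (lebesgue_on (cell E))" for j
      using i[OF el\<phi>] by (rule borel_measurable_integrable)
    show "integrable (lebesgue_on (cell E)) (\<lambda>x. \<bar>(g1 x - g2 x) * \<beta> x\<bar>)"
      using i[OF el\<beta>] by (rule integrable_abs)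
    \<comment> \<open>The line of the edge is null. Off it \<psi> < 1 inside the ball, and outside
      the ball \<beta> = 0, so the integrands tend to 0 almost everywhere.\<close>
    have "negligible {x. ?N \<bullet> x = ?N \<bullet> ?m}"
      using unit_normal by (intro negligible_hyperplane) auto
    then have "AE x in lebesgue. x \<notin> {x. ?N \<bullet> x = ?N \<bullet> ?m}"
      using AE_not_in negligible_iff_null_sets by blast
    then have "AE x in lebesgue_on (cell E). x \<notin> {x. ?N \<bullet> x = ?N \<bullet> ?m}"
      by (subst AE_restrict_space_iff) auto
    then show "AE x in lebesgue_on (cell E). (\<lambda>j. (g1 x - g2 x) * \<phi> j x) \<longlonglongrightarrow> 0"
    proof eventually_elim
      case (elim x)
      show ?case
      proof (cases "x \<in> cball ?m r")
        case True
        have "(x - ?m) \<bullet> ?N \<noteq> 0" using elim by (simp add: inner_commute inner_diff_right)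
        then have "\<psi> x < 1" using r(1) by (simp add: \<psi>_def)
        then have "(\<lambda>j. (g1 x - g2 x) * (\<beta> x * \<psi> x ^ j)) \<longlonglongrightarrow> (g1 x - g2 x) * (\<beta> x * 0)"
          using \<psi>01[OF True] by (intro tendsto_intros LIMSEQ_power_zero) auto
        then show ?thesis by (simp add: \<phi>_def)
      qed (simp add: \<phi>_def zero)
    qed
    show "AE x in lebesgue_on (cell E). norm ((g1 x - g2 x) * \<phi> j x) \<le> \<bar>(g1 x - g2 x) * \<beta> x\<bar>" for j
    proof (rule AE_I2)
      fix x
      show "norm ((g1 x - g2 x) * \<phi> j x) \<le> \<bar>(g1 x - g2 x) * \<beta> x\<bar>"
      proof (cases "x \<in> cball ?m r")
        case True
        then have "\<bar>\<psi> x ^ j\<bar> \<le> 1" using \<psi>01[OF True] by (simp add: power_abs power_le_one)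
        then show ?thesis by (simp add: \<phi>_def abs_mult mult_left_le mult.assoc[symmetric])
      qed (simp add: \<phi>_def zero)
    qed
  qed simp
  then have "edge_sign n E e * I = 0"
    unfolding const by (simp add: LIMSEQ_const_iff)
  then have "I = 0" by (simp add: edge_sign_def split: if_splits)
  let ?f = "\<lambda>s. (poly d s)\<^sup>2 * exp_flat 1 (r\<^sup>2 - s\<^sup>2)"
  have "continuous_on UNIV (exp_flat 1)"
    by (meson DERIV_isCont continuous_at_imp_continuous_on exp_flat_has_real_derivative)
  then have "continuous_on UNIV (\<lambda>s. exp_flat 1 (r\<^sup>2 - s\<^sup>2))"
    by (rule continuous_on_compose2) (auto intro!: continuous_intros)
  then have cont: "continuous_on UNIV ?f"
    by (rule continuous_on_mult[OF continuous_on_power[OF continuous_poly]])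
  have "integral {- edge_len e / 2..?l} ?f = 0"
    using \<open>I = 0\<close> lebesgue_integral_eq_integral[OF edge_integrable[OF cont]]
    by (simp add: I_def edge_integral_def)
  moreover have "integral {- edge_len e / 2..?l} ?f = 0 \<longleftrightarrow> (\<forall>s\<in>{- edge_len e / 2..?l}. ?f s = 0)"
    using edge_hull(1) cont
    by (intro integral_eq_0_iff) (auto intro: continuous_on_subset simp: exp_flat_def)
  ultimately have f0: "?f s = 0" if "s \<in> {- edge_len e / 2..?l}" for s using that by blast
  \<comment> \<open>The weight is positive for |s| < r, so d has an interval of roots, contradicting
    d \<noteq> 0.\<close>
  have "poly d s = 0" if s: "s \<in> {0<..<r}" for s
  proof -
    have "s\<^sup>2 < r\<^sup>2" using s by (intro power_strict_mono) auto
    then have "exp_flat 1 (r\<^sup>2 - s\<^sup>2) \<noteq> 0" by (simp add: exp_flat_def)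
    moreover have "?f s = 0" using s r(3) by (intro f0) auto
    ultimately show ?thesis by simp
  qed
  then have "{0<..<r} \<subseteq> {s. poly d s = 0}" by blast
  then have "finite {0<..<r}" using poly_roots_finite[OF d0] finite_subset by blast
  then show False using r(1) by (simp add: infinite_Ioo)
qed

lemma normal_trace_eqI:
  assumes "v \<in> L2 (cell E)" "has_normal_trace n E e v q"
  shows "normal_trace n E e v = q"
  unfolding normal_trace_def
  using assms normal_trace_unique by (intro some_equality) auto

end

section \<open>Projection and degrees of freedom\<close>

text \<open>Gram-Schmidt by induction on the family: both w and the new field \<open>b e\<close> are
  made orthogonal to the old fields, and then the residual u of w loses its component along the
  residual e'. The family may be linearly dependent; a residual e' that vanishes almost everywhere
  is orthogonal to u already.\<close>

lemma orthogonal_coefficients_exist: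
  fixes b :: "'i \<Rightarrow> vfield"
  assumes "finite A" "\<And>i. i \<in> A \<Longrightarrow> b i \<in> L2 D" "w \<in> L2 D"
  shows "\<exists>c. (\<lambda>x. w x - (\<Sum>i\<in>A. c i *\<^sub>R b i x)) \<in> L2 D \<and>
    (\<forall>j\<in>A. integral\<^sup>L (lebesgue_on D) (\<lambda>x. (w x - (\<Sum>i\<in>A. c i *\<^sub>R b i x)) \<bullet> b j x) = 0)"
  using assms
proof (induction A arbitrary: w rule: finite_induct)
  case empty
  then show ?case by simp
next
  case (insert e A)
  let ?I = "\<lambda>u v :: vfield. integral\<^sup>L (lebesgue_on D) (\<lambda>x. u x \<bullet> v x)"
  obtain c where "(\<lambda>x. w x - (\<Sum>i\<in>A. c i *\<^sub>R b i x)) \<in> L2 D \<and>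
      (\<forall>j\<in>A. ?I (\<lambda>x. w x - (\<Sum>i\<in>A. c i *\<^sub>R b i x)) (b j) = 0)"
    using insert.IH[OF _ insert.prems(2)] insert.prems(1) by blast
  moreover obtain d where "(\<lambda>x. b e x - (\<Sum>i\<in>A. d i *\<^sub>R b i x)) \<in> L2 D \<and>
      (\<forall>j\<in>A. ?I (\<lambda>x. b e x - (\<Sum>i\<in>A. d i *\<^sub>R b i x)) (b j) = 0)"
    using insert.IH[of "b e"] insert.prems(1) by blast
  moreover define u where "u = (\<lambda>x. w x - (\<Sum>i\<in>A. c i *\<^sub>R b i x))"
  moreover define e' where "e' = (\<lambda>x. b e x - (\<Sum>i\<in>A. d i *\<^sub>R b i x))"
  ultimately have u: "u \<in> L2 D" "\<And>j. j \<in> A \<Longrightarrow> ?I u (b j) = 0"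
    and e': "e' \<in> L2 D" "\<And>j. j \<in> A \<Longrightarrow> ?I e' (b j) = 0" by auto
  define t where "t = ?I u e' / ?I e' e'"  \<comment> \<open>\<open>0\<close> if \<open>e'\<close> vanishes almost everywhere\<close>
  have ortho_e': "?I u e' = t * ?I e' e'"
  proof (cases "?I e' e' = 0")
    case True
    then have "AE x in lebesgue_on D. e' x \<bullet> e' x = 0"
      using integral_nonneg_eq_0_iff_AE[OF L2_inner_integrable[OF e'(1) e'(1)]] by simp
    then have "AE x in lebesgue_on D. u x \<bullet> e' x = 0" by eventually_elim simp
    then show ?thesis using True by (simp add: integral_eq_zero_AE)
  qed (simp add: t_def)
  define v where "v = (\<lambda>x. 1 *\<^sub>R u x + (- t) *\<^sub>R e' x)"
  have v: "v \<in> L2 D" unfolding v_def by (rule L2_lincomb[OF u(1) e'(1)])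
  have Iv: "?I v f = ?I u f - t * ?I e' f" if "f \<in> L2 D" for f
    using L2_inner_integrable[OF u(1) that] L2_inner_integrable[OF e'(1) that]
    by (simp add: v_def inner_diff_left)
  have vA: "?I v (b j) = 0" if "j \<in> A" for j
    using Iv[of "b j"] insert.prems(1) that u(2) e'(2) by simp
  \<comment> \<open>\<open>b e\<close> is e' plus a combination of the old fields, and v is
    orthogonal to all of these.\<close>
  have "?I v (b e) = 0"
  proof -
    have "v x \<bullet> b e x = v x \<bullet> e' x + (\<Sum>i\<in>A. d i * (v x \<bullet> b i x))" for x
      by (simp add: e'_def inner_diff_right inner_sum_right)
    moreover have "integrable (lebesgue_on D) (\<lambda>x. v x \<bullet> b i x)" if "i \<in> A" for i
      using L2_inner_integrable[OF v] insert.prems(1) that by blast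
    ultimately have "?I v (b e) = ?I v e' + (\<Sum>i\<in>A. d i * ?I v (b i))"
      using L2_inner_integrable[OF v e'(1)] by simp
    then show ?thesis using vA Iv[OF e'(1)] ortho_e' by simp
  qed
  moreover define c' where "c' i = (if i = e then t else c i - t * d i)" for i
  have "v = (\<lambda>x. w x - (\<Sum>i\<in>insert e A. c' i *\<^sub>R b i x))"
  proof
    fix x
    have "(\<Sum>i\<in>A. c' i *\<^sub>R b i x) = (\<Sum>i\<in>A. c i *\<^sub>R b i x - t *\<^sub>R (d i *\<^sub>R b i x))"
      using insert.hyps by (intro sum.cong) (auto simp: c'_def scaleR_diff_left)
    also have "\<dots> = (\<Sum>i\<in>A. c i *\<^sub>R b i x) - t *\<^sub>R (\<Sum>i\<in>A. d i *\<^sub>R b i x)"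
      by (simp only: sum_subtractf scaleR_right.sum)
    finally have "(\<Sum>i\<in>insert e A. c' i *\<^sub>R b i x) = t *\<^sub>R b e x +
        ((\<Sum>i\<in>A. c i *\<^sub>R b i x) - t *\<^sub>R (\<Sum>i\<in>A. d i *\<^sub>R b i x))"
      using insert.hyps by (simp add: c'_def)
    then show "v x = w x - (\<Sum>i\<in>insert e A. c' i *\<^sub>R b i x)"
      by (simp add: v_def u_def e'_def scaleR_diff_right)
  qed
  ultimately show ?case using v vA by (intro exI[of _ c']) auto
qed

lemma finite_degree_bound: "finite {(i, j). int i + int j \<le> l}"
  by (rule finite_subset[of _ "{..nat l} \<times> {..nat l}"]) auto

lemma polys_lincomb:
  assumes "f \<in> polys l" "g \<in> polys l"
  shows "(\<lambda>x. a * f x + b * g x) \<in> polys l"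
proof -
  obtain c d where "\<And>x. f x = (\<Sum>(i, j) | int i + int j \<le> l. c i j * (x $ 1) ^ i * (x $ 2) ^ j)"
    "\<And>x. g x = (\<Sum>(i, j) | int i + int j \<le> l. d i j * (x $ 1) ^ i * (x $ 2) ^ j)"
    using assms unfolding polys_def by auto
  then have "a * f x + b * g x =
      (\<Sum>(i, j) | int i + int j \<le> l. (a * c i j + b * d i j) * (x $ 1) ^ i * (x $ 2) ^ j)" for x
    by (simp add: sum_distrib_left sum.distrib[symmetric] case_prod_beta algebra_simps)
  then show ?thesis
    unfolding polys_def by (intro CollectI exI[of _ "\<lambda>i j. a * c i j + b * d i j"]) simp
qed

lemma vpolys_lincomb:
  assumes "u \<in> vpolys l" "v \<in> vpolys l"
  shows "(\<lambda>x. a *\<^sub>R u x + b *\<^sub>R v x) \<in> vpolys l"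
  using assms polys_lincomb unfolding vpolys_def by simp

lemma vpolys_continuous:
  assumes "u \<in> vpolys l"
  shows "continuous_on UNIV u"
proof -
  have "continuous_on UNIV (\<lambda>x. u x $ i)" for i
    using assms elementary_continuous elementary_polys unfolding vpolys_def by blast
  then show ?thesis using continuous_on_vec_lambda[of UNIV "\<lambda>i x. u x $ i"] by simp
qed

lemma vpolys_L2: "u \<in> vpolys l \<Longrightarrow> u \<in> L2 (cell E)"
  by (intro L2_continuous bounded_cell vpolys_continuous) auto

text \<open>The family is that of the vector monomials: an index pairs the exponents with the
  component m that carries the monomial.\<close>

lemma proj_exists:
  assumes w: "w \<in> L2 (cell E)"
  shows "\<exists>q. q \<in> vpolys l \<and>
    (\<forall>r \<in> vpolys l. integral\<^sup>L (lebesgue_on (cell E)) (\<lambda>x. (w x - q x) \<bullet> r x) = 0)"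
proof -
  let ?S = "{(i, j). int i + int j \<le> l}"
  define mono where "mono = (\<lambda>(i, j) (x :: real^2). (x $ 1) ^ i * (x $ 2) ^ j)"
  define b :: "(nat \<times> nat) \<times> 2 \<Rightarrow> vfield" where "b = (\<lambda>(p, m) x. mono p x *\<^sub>R axis m 1)"
  let ?A = "?S \<times> (UNIV :: 2 set)"
  have comp: "(\<Sum>i\<in>?A. c i *\<^sub>R b i x) $ m = (\<Sum>p\<in>?S. c (p, m) * mono p x)" for c x m
  proof -
    have "(\<Sum>i\<in>?A. c i *\<^sub>R b i x) $ m = (\<Sum>p\<in>?S. \<Sum>m'\<in>UNIV. c (p, m') * (mono p x * (axis m' 1 $ m)))"
      by (simp add: b_def case_prod_beta sum.cartesian_product mult.assoc)
    also have "\<dots> = (\<Sum>p\<in>?S. c (p, m) * mono p x)"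
    proof (intro sum.cong refl)
      fix p
      have "(\<Sum>m'\<in>UNIV. c (p, m') * (mono p x * (axis m' 1 $ m))) =
          (\<Sum>m'\<in>UNIV. if m' = m then c (p, m') * mono p x else 0)"
        by (intro sum.cong) (auto simp: axis_def)
      then show "(\<Sum>m'\<in>UNIV. c (p, m') * (mono p x * (axis m' 1 $ m))) = c (p, m) * mono p x"
        by simp
    qed
    finally show ?thesis .
  qed
  have span: "(\<lambda>x. \<Sum>i\<in>?A. c i *\<^sub>R b i x) \<in> vpolys l" for c
    unfolding vpolys_def
  proof (intro CollectI allI)
    fix m
    show "(\<lambda>x. (\<Sum>i\<in>?A. c i *\<^sub>R b i x) $ m) \<in> polys l"
      unfolding comp polys_def
      by (intro CollectI exI[of _ "\<lambda>i j. c ((i, j), m)"]) (simp add: mono_def case_prod_beta mult.assoc)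
  qed
  have fin: "finite ?A" using finite_degree_bound by simp
  have "b i \<in> vpolys l" if "i \<in> ?A" for i
  proof -
    have "(\<lambda>x. \<Sum>j\<in>?A. (if j = i then 1 else 0) *\<^sub>R b j x) = b i"
      using that fin by (simp add: fun_eq_iff if_distrib[of "\<lambda>c. c *\<^sub>R _"] cong: if_cong)
    then show ?thesis using span[of "\<lambda>j. if j = i then 1 else 0"] by simp
  qed
  then have bL: "b i \<in> L2 (cell E)" if "i \<in> ?A" for i using that vpolys_L2 by blast
  obtain c where c: "(\<lambda>x. w x - (\<Sum>i\<in>?A. c i *\<^sub>R b i x)) \<in> L2 (cell E)"
    "\<And>j. j \<in> ?A \<Longrightarrow>
      integral\<^sup>L (lebesgue_on (cell E)) (\<lambda>x. (w x - (\<Sum>i\<in>?A. c i *\<^sub>R b i x)) \<bullet> b j x) = 0"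
    using orthogonal_coefficients_exist[where A = ?A and b = b, OF fin bL w] by blast
  let ?u = "\<lambda>x. w x - (\<Sum>i\<in>?A. c i *\<^sub>R b i x)"
  have "integral\<^sup>L (lebesgue_on (cell E)) (\<lambda>x. ?u x \<bullet> r x) = 0" if r: "r \<in> vpolys l" for r
  proof -
    have "\<forall>m. \<exists>d. \<forall>x. r x $ m = (\<Sum>(i, j)\<in>?S. d i j * (x $ 1) ^ i * (x $ 2) ^ j)"
      using r unfolding vpolys_def polys_def by simp
    then have "\<exists>d. \<forall>m x. r x $ m = (\<Sum>(i, j)\<in>?S. d m i j * (x $ 1) ^ i * (x $ 2) ^ j)"
      by (rule choice)
    then obtain d where d: "\<forall>m x. r x $ m = (\<Sum>(i, j)\<in>?S. d m i j * (x $ 1) ^ i * (x $ 2) ^ j)"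
      by (rule exE)
    define c' where "c' = (\<lambda>((i, j), m). d m i j)"
    have "(\<Sum>i\<in>?A. c' i *\<^sub>R b i x) $ m = r x $ m" for x m
      unfolding comp d[rule_format] by (simp add: c'_def mono_def case_prod_beta mult.assoc)
    then have r_eq: "r x = (\<Sum>i\<in>?A. c' i *\<^sub>R b i x)" for x
      by (simp add: vec_eq_iff del: sum_component)
    have "?u x \<bullet> r x = (\<Sum>i\<in>?A. c' i * (?u x \<bullet> b i x))" for x
      by (subst r_eq) (simp only: inner_sum_right inner_scaleR_right)
    moreover have "integrable (lebesgue_on (cell E)) (\<lambda>x. ?u x \<bullet> b i x)" if "i \<in> ?A" for i
      using L2_inner_integrable[OF c(1) bL[OF that]] .
    ultimately have "integral\<^sup>L (lebesgue_on (cell E)) (\<lambda>x. ?u x \<bullet> r x) =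
        (\<Sum>i\<in>?A. c' i * integral\<^sup>L (lebesgue_on (cell E)) (\<lambda>x. ?u x \<bullet> b i x))"
      by simp
    also have "\<dots> = 0" using c(2) by (intro sum.neutral) auto
    finally show ?thesis .
  qed
  then show ?thesis using span by blast
qed

lemma proj_orthogonal:
  assumes "w \<in> L2 (cell E)"
  shows "proj k (cell E) w \<in> vpolys (int k)"
    and "\<And>r. r \<in> vpolys (int k) \<Longrightarrow>
      integral\<^sup>L (lebesgue_on (cell E)) (\<lambda>x. (w x - proj k (cell E) w x) \<bullet> r x) = 0"
  using someI_ex[OF proj_exists[OF assms, of "int k"]] unfolding proj_def by blast+

text \<open>The difference r of two candidates is an admissible test field, so it is orthogonal to
  itself and vanishes almost everywhere. The set of its nonzeros in the open cell is open and
  negligible, hence empty.\<close>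

lemma proj_unique:
  assumes w: "w \<in> L2 (cell E)" and q: "q \<in> vpolys (int k)"
    and orth: "\<And>r. r \<in> vpolys (int k) \<Longrightarrow>
      integral\<^sup>L (lebesgue_on (cell E)) (\<lambda>x. (w x - q x) \<bullet> r x) = 0"
    and x: "x \<in> cell E"
  shows "proj k (cell E) w x = q x"
proof -
  let ?p = "proj k (cell E) w"
  define r where "r = (\<lambda>x. 1 *\<^sub>R ?p x + (-1) *\<^sub>R q x)"
  have r: "r \<in> vpolys (int k)"
    unfolding r_def by (rule vpolys_lincomb[OF proj_orthogonal(1)[OF w] q])
  have i: "integrable (lebesgue_on (cell E)) (\<lambda>x. (w x - f x) \<bullet> r x)" if "f \<in> vpolys (int k)" for f
    by (rule L2_inner_integrable[OF L2_diff[OF w vpolys_L2[OF that]] vpolys_L2[OF r]])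
  have "r x \<bullet> r x = (w x - q x) \<bullet> r x - (w x - ?p x) \<bullet> r x" for x
    by (simp add: r_def inner_diff_left)
  then have "integral\<^sup>L (lebesgue_on (cell E)) (\<lambda>x. r x \<bullet> r x) = 0"
    using i[OF q] i[OF proj_orthogonal(1)[OF w]] orth[OF r] proj_orthogonal(2)[OF w r] by simp
  then have "AE x in lebesgue_on (cell E). r x \<bullet> r x = 0"
    using integral_nonneg_eq_0_iff_AE[OF L2_inner_integrable[OF vpolys_L2[OF r] vpolys_L2[OF r]]] by simp
  then have "AE x in lebesgue. x \<in> cell E \<longrightarrow> r x = 0"
    by (subst (asm) AE_restrict_space_iff) auto
  then have "negligible {x. \<not> (x \<in> cell E \<longrightarrow> r x = 0)}"
    by (simp add: eventually_ae_filter_negligible) (metis (no_types, lifting) negligible_subset)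
  moreover have "open {x. \<not> (x \<in> cell E \<longrightarrow> r x = 0)}"
  proof -
    have "open (r -` (- {0}))"
      using vpolys_continuous[OF r] by (intro open_vimage) auto
    moreover have "{x. \<not> (x \<in> cell E \<longrightarrow> r x = 0)} = cell E \<inter> r -` (- {0})" by auto
    ultimately show ?thesis using open_cell by (simp add: open_Int)
  qed
  ultimately have "{x. \<not> (x \<in> cell E \<longrightarrow> r x = 0)} = {}"
    using open_not_negligible by blast
  then have "r x = 0" using x by blast
  then show ?thesis by (simp add: r_def)
qed

lemma proj_lincomb:
  assumes u: "u \<in> L2 (cell E)" and v: "v \<in> L2 (cell E)" and x: "x \<in> cell E"
  shows "proj k (cell E) (\<lambda>x. a *\<^sub>R u x + b *\<^sub>R v x) x =
    a *\<^sub>R proj k (cell E) u x + b *\<^sub>R proj k (cell E) v x"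
proof (rule proj_unique[OF L2_lincomb[OF u v] vpolys_lincomb[OF proj_orthogonal(1)[OF u] proj_orthogonal(1)[OF v]] _ x])
  fix r assume r: "r \<in> vpolys (int k)"
  let ?P = "proj k (cell E)"
  have i: "integrable (lebesgue_on (cell E)) (\<lambda>x. (w x - ?P w x) \<bullet> r x)" if "w \<in> L2 (cell E)" for w
    by (rule L2_inner_integrable[OF L2_diff[OF that vpolys_L2[OF proj_orthogonal(1)[OF that]]] vpolys_L2[OF r]])
  have "(a *\<^sub>R u x + b *\<^sub>R v x - (a *\<^sub>R ?P u x + b *\<^sub>R ?P v x)) \<bullet> r x =
      a * ((u x - ?P u x) \<bullet> r x) + b * ((v x - ?P v x) \<bullet> r x)" for x
    by (simp add: inner_diff_left inner_add_left algebra_simps)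
  then show "integral\<^sup>L (lebesgue_on (cell E))
      (\<lambda>x. (a *\<^sub>R u x + b *\<^sub>R v x - (a *\<^sub>R ?P u x + b *\<^sub>R ?P v x)) \<bullet> r x) = 0"
    using i[OF u] i[OF v] proj_orthogonal(2)[OF u r] proj_orthogonal(2)[OF v r] by simp
qed

section \<open>Linearity of the degrees of freedom\<close>

text \<open>A linear class containing the fields of \<open>Vloc\<close> and all polynomial fields,
  hence also v - \<pi> v. It asks for polynomial traces of any degree, which is what linearity of
  the edge degrees of freedom rests on.\<close>

definition traceable :: "(edge \<Rightarrow> real^2) \<Rightarrow> element \<Rightarrow> vfield set"
  where "traceable n E = {v \<in> L2 (cell E). \<forall>e \<in> edges E. \<exists>q. has_normal_trace n E e v q}"

lemma traceable_L2: "v \<in> traceable n E \<Longrightarrow> v \<in> L2 (cell E)"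
  by (simp add: traceable_def)

lemma traceable_lincomb:
  assumes "u \<in> traceable n E" "v \<in> traceable n E"
  shows "(\<lambda>x. a *\<^sub>R u x + b *\<^sub>R v x) \<in> traceable n E"
  using assms L2_lincomb has_normal_trace_lincomb unfolding traceable_def by blast

lemma elementary_scaled_monomial: "elementary (scaled_monomial E i j)"
proof -
  have "elementary (\<lambda>x. ((x $ 1 - elt_bary E $ 1) * (1 / elt_diam E)) ^ i *
      ((x $ 2 - elt_bary E $ 2) * (1 / elt_diam E)) ^ j)"
    by (intro elementary_mult elementary_power elementary_diff elementary_coord elementary_const)
  then show ?thesis by (simp add: scaled_monomial_def[abs_def])
qed

lemma continuous_perp_bary:
  "continuous_on UNIV (\<lambda>x. scaled_monomial E i j x *\<^sub>R perp ((1 / elt_diam E) *\<^sub>R (x - elt_bary E)))"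
proof -
  have "continuous_on UNIV (\<lambda>x. perp ((1 / elt_diam E) *\<^sub>R (x - elt_bary E)) $ m)" for m
  proof -
    consider "m = 1" | "m = 2" using exhaust_2 by blast
    then show ?thesis
    proof cases
      case 1
      show ?thesis
        unfolding 1 perp_component vector_scaleR_component vector_minus_component by (intro continuous_intros)
    next
      case 2
      show ?thesis
        unfolding 2 perp_component vector_scaleR_component vector_minus_component by (intro continuous_intros)
    qed
  qed
  then have "continuous_on UNIV (\<lambda>x. perp ((1 / elt_diam E) *\<^sub>R (x - elt_bary E)))"
    using continuous_on_vec_lambda[of UNIV "\<lambda>m x. perp ((1 / elt_diam E) *\<^sub>R (x - elt_bary E)) $ m"] by simp
  then show ?thesis
    using elementary_continuous[OF elementary_scaled_monomial] by (intro continuous_intros)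
qed

lemma dof_cong:
  assumes "\<And>x. x \<in> cell E \<Longrightarrow> u x = v x"
  shows "dof n E u \<iota> = dof n E v \<iota>"
proof (cases \<iota>)
  case (Edge_dof e i)
  then show ?thesis
    using has_normal_trace_cong[OF assms] by (simp add: normal_trace_def)
next
  case (Grad_dof i j)
  have "integral\<^sup>L (lebesgue_on (cell E)) (\<lambda>x. u x \<bullet> grad (scaled_monomial E i j) x) =
      integral\<^sup>L (lebesgue_on (cell E)) (\<lambda>x. v x \<bullet> grad (scaled_monomial E i j) x)"
    using assms by (intro Bochner_Integration.integral_cong) simp_all
  then show ?thesis using Grad_dof by simp
next
  case (Perp_dof i j)
  have "integral\<^sup>L (lebesgue_on (cell E))
        (\<lambda>x. u x \<bullet> perp ((1 / elt_diam E) *\<^sub>R (x - elt_bary E)) * scaled_monomial E i j x) =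
      integral\<^sup>L (lebesgue_on (cell E))
        (\<lambda>x. v x \<bullet> perp ((1 / elt_diam E) *\<^sub>R (x - elt_bary E)) * scaled_monomial E i j x)"
    using assms by (intro Bochner_Integration.integral_cong) simp_all
  then show ?thesis using Perp_dof by simp
qed

locale mesh_element =
  fixes n :: "edge \<Rightarrow> real^2" and E :: element
  assumes polygon_edge: "\<And>e. e \<in> edges E \<Longrightarrow> polygon_edge n E e"
begin

lemma vpolys_traceable: "u \<in> vpolys l \<Longrightarrow> u \<in> traceable n E"
  using polygon_edge.vpolys_normal_trace[OF polygon_edge] vpolys_L2 unfolding traceable_def by blast

text \<open>For edge labels, the combination of the two traces is a trace of the combined field, and
  uniqueness makes it the chosen one; the other labels are integrals against continuous
  fields.\<close>

lemma dof_lincomb: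
  assumes u: "u \<in> traceable n E" and v: "v \<in> traceable n E" and \<iota>: "\<iota> \<in> dof_indices k E"
  shows "dof n E (\<lambda>x. a *\<^sub>R u x + b *\<^sub>R v x) \<iota> = a * dof n E u \<iota> + b * dof n E v \<iota>"
proof (cases \<iota>)
  case (Edge_dof e i)
  then have e: "e \<in> edges E" using \<iota> by (auto simp: dof_indices_def)
  interpret polygon_edge n E e using polygon_edge[OF e] .
  obtain q1 q2 where q: "has_normal_trace n E e u q1" "has_normal_trace n E e v q2"
    using u v e unfolding traceable_def by blast
  have "normal_trace n E e (\<lambda>x. a *\<^sub>R u x + b *\<^sub>R v x) = smult a q1 + smult b q2"
    using u v q by (intro normal_trace_eqI L2_lincomb has_normal_trace_lincomb) (auto simp: traceable_def)
  moreover have "normal_trace n E e u = q1" "normal_trace n E e v = q2"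
    using u v q normal_trace_eqI by (auto simp: traceable_def)
  moreover have "edge_integral e (\<lambda>s. poly (smult a q1 + smult b q2) s * (s / edge_len e) ^ i) =
      a * edge_integral e (\<lambda>s. poly q1 s * (s / edge_len e) ^ i) +
      b * edge_integral e (\<lambda>s. poly q2 s * (s / edge_len e) ^ i)"
  proof -
    have "(\<lambda>s. poly (smult a q1 + smult b q2) s * (s / edge_len e) ^ i) =
        (\<lambda>s. a * (poly q1 s * (s / edge_len e) ^ i) + b * (poly q2 s * (s / edge_len e) ^ i))"
      by (simp add: fun_eq_iff algebra_simps)
    then show ?thesis
      using edge_hull(1) by (simp only:) (intro edge_integral_lincomb continuous_intros; simp)
  qed
  ultimately show ?thesis using Edge_dof by (simp add: algebra_simps)
next
  case (Grad_dof i j)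
  have L: "grad (scaled_monomial E i j) \<in> L2 (cell E)"
    by (intro L2_continuous bounded_cell elementary_grad_continuous elementary_scaled_monomial) simp
  have "(a *\<^sub>R u x + b *\<^sub>R v x) \<bullet> grad (scaled_monomial E i j) x =
      a * (u x \<bullet> grad (scaled_monomial E i j) x) + b * (v x \<bullet> grad (scaled_monomial E i j) x)" for x
    by (simp add: inner_add_left)
  then show ?thesis
    using Grad_dof L2_inner_integrable[OF traceable_L2[OF u] L] L2_inner_integrable[OF traceable_L2[OF v] L]
    by (simp add: algebra_simps)
next
  case (Perp_dof i j)
  let ?w = "\<lambda>x. scaled_monomial E i j x *\<^sub>R perp ((1 / elt_diam E) *\<^sub>R (x - elt_bary E))"
  have L: "?w \<in> L2 (cell E)"
    by (intro L2_continuous bounded_cell continuous_perp_bary) simp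
  have D: "dof n E f \<iota> = 1 / elt_area E * integral\<^sup>L (lebesgue_on (cell E)) (\<lambda>x. f x \<bullet> ?w x)" for f
    using Perp_dof by (simp add: mult.commute)
  have "(a *\<^sub>R u x + b *\<^sub>R v x) \<bullet> ?w x = a * (u x \<bullet> ?w x) + b * (v x \<bullet> ?w x)" for x
    by (simp only: inner_add_left inner_scaleR_left)
  then show ?thesis
    unfolding D using L2_inner_integrable[OF traceable_L2[OF u] L] L2_inner_integrable[OF traceable_L2[OF v] L]
    by (simp add: algebra_simps del: inner_scaleR_right)
qed

lemma remainder_traceable:
  assumes "v \<in> traceable n E"
  shows "(\<lambda>x. v x - proj k (cell E) v x) \<in> traceable n E"
  using traceable_lincomb[OF assms vpolys_traceable[OF proj_orthogonal(1)[OF traceable_L2[OF assms]]], of 1 "-1"]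
  by simp

lemma dof_remainder_lincomb:
  assumes u: "u \<in> traceable n E" and v: "v \<in> traceable n E" and \<iota>: "\<iota> \<in> dof_indices k E"
  shows "dof n E (\<lambda>x. (a *\<^sub>R u x + b *\<^sub>R v x) - proj k (cell E) (\<lambda>x. a *\<^sub>R u x + b *\<^sub>R v x) x) \<iota> =
    a * dof n E (\<lambda>x. u x - proj k (cell E) u x) \<iota> + b * dof n E (\<lambda>x. v x - proj k (cell E) v x) \<iota>"
proof -
  let ?P = "proj k (cell E)"
  have "dof n E (\<lambda>x. (a *\<^sub>R u x + b *\<^sub>R v x) - ?P (\<lambda>x. a *\<^sub>R u x + b *\<^sub>R v x) x) \<iota> =
      dof n E (\<lambda>x. a *\<^sub>R (u x - ?P u x) + b *\<^sub>R (v x - ?P v x)) \<iota>"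
    using proj_lincomb[OF traceable_L2[OF u] traceable_L2[OF v]]
    by (intro dof_cong) (simp add: algebra_simps)
  then show ?thesis
    by (simp only: dof_lincomb[OF remainder_traceable[OF u] remainder_traceable[OF v] \<iota>])
qed

end

section \<open>Scalar inequalities\<close>

text \<open>If t \<le> t^r, the difference is at most 1 - t. Otherwise it is at most 1 - t^r \<le> 1
  - t^N \<le> N (1 - t) by Bernoulli's inequality, for which N is taken natural.\<close>

lemma powr_deviation:
  fixes t r :: real
  assumes t: "0 \<le> t" "t \<le> 1" and r: "0 < r" and N: "r \<le> real N" "1 \<le> N"
  shows "\<bar>t - t powr r\<bar> \<le> real N * (1 - t)"
proof (cases "t = 0")
  case False
  then have t0: "0 < t" using t by simp
  have "t powr r \<le> 1" using t r by (simp add: powr_le1)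
  moreover have "1 - t \<le> real N * (1 - t)" using N(2) t by (simp add: mult_le_cancel_right1)
  moreover have "1 + real N * (t - 1) \<le> (1 + (t - 1)) ^ N" using t by (intro Bernoulli_inequality) simp
  moreover have "t ^ N \<le> t powr r"
    using t0 t N powr_mono'[of r "real N" t] by (simp add: powr_realpow)
  ultimately show ?thesis using t by (simp add: algebra_simps abs_le_iff)
qed simp

text \<open>The differences of \<open>|a|^(q-2) a \<cdot> c\<close> and \<open>|b|^(q-2) b \<cdot> c\<close>, expressed through the norms
  \<open>\<alpha>, \<beta>, \<gamma>\<close>, the scalar products \<open>x, y\<close> and \<open>m = |a - b|\<close> only, so that the bounds apply both
  to vectors in the plane and to vectors of degrees of freedom.\<close>

lemma duality_map_difference_crude:
  fixes q \<alpha> \<beta> \<gamma> x y :: real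
  assumes q: "1 < q" and nn: "0 \<le> \<alpha>" "0 \<le> \<beta>" "0 \<le> \<gamma>"
    and x: "\<bar>x\<bar> \<le> \<alpha> * \<gamma>" and y: "\<bar>y\<bar> \<le> \<beta> * \<gamma>"
  shows "\<bar>\<alpha> powr (q - 2) * x - \<beta> powr (q - 2) * y\<bar> \<le> 2 * \<gamma> * max \<alpha> \<beta> powr (q - 1)"
proof -
  have *: "\<bar>a powr (q - 2) * z\<bar> \<le> \<gamma> * max \<alpha> \<beta> powr (q - 1)"
    if "0 \<le> a" "a \<le> max \<alpha> \<beta>" "\<bar>z\<bar> \<le> a * \<gamma>" for a z
  proof -
    have "\<bar>a powr (q - 2) * z\<bar> \<le> a powr (q - 2) * (a * \<gamma>)"
      using that by (simp add: abs_mult mult_left_mono)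
    also have "\<dots> = (a * a powr (q - 2)) * \<gamma>" by simp
    also have "\<dots> = a powr (q - 1) * \<gamma>" using that by (subst powr_mult_base) (auto simp: algebra_simps)
    also have "\<dots> \<le> max \<alpha> \<beta> powr (q - 1) * \<gamma>"
      using that q nn by (intro mult_right_mono powr_mono2) auto
    finally show ?thesis by (simp add: mult.commute)
  qed
  have "\<bar>\<alpha> powr (q - 2) * x - \<beta> powr (q - 2) * y\<bar> \<le> \<bar>\<alpha> powr (q - 2) * x\<bar> + \<bar>\<beta> powr (q - 2) * y\<bar>"
    by linarith
  also have "\<dots> \<le> 2 * \<gamma> * max \<alpha> \<beta> powr (q - 1)"
    using *[of \<alpha> x] *[of \<beta> y] nn x y by simp
  finally show ?thesis .
qed

text \<open>By symmetry \<beta> \<le> \<alpha>. Write the difference as \<alpha>^(q-2) (x - y) +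
  (\<alpha>^(q-2) - \<beta>^(q-2)) y. For q < 2 the last power may blow up as \<beta> tends to 0;
  the factor \<beta> in the bound for y compensates, since with t = \<beta>/\<alpha> one gets
  \<alpha>^(q-1) (t - t^(q-1)), which \<open>powr_deviation\<close> controls.\<close>

lemma duality_map_difference_Lipschitz:
  fixes q \<alpha> \<beta> \<gamma> m x y :: real
  assumes q: "1 < q" and N: "q - 1 \<le> real N" "1 \<le> N"
    and nn: "0 \<le> \<alpha>" "0 \<le> \<beta>" "0 \<le> \<gamma>" and pos: "0 < max \<alpha> \<beta>"
    and x: "\<bar>x\<bar> \<le> \<alpha> * \<gamma>" and y: "\<bar>y\<bar> \<le> \<beta> * \<gamma>" and xy: "\<bar>x - y\<bar> \<le> m * \<gamma>" and m: "\<bar>\<alpha> - \<beta>\<bar> \<le> m"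
  shows "\<bar>\<alpha> powr (q - 2) * x - \<beta> powr (q - 2) * y\<bar> \<le> (1 + real N) * \<gamma> * max \<alpha> \<beta> powr (q - 2) * m"
proof -
  have *: "\<bar>\<alpha> powr (q - 2) * x - \<beta> powr (q - 2) * y\<bar> \<le> (1 + real N) * \<gamma> * \<alpha> powr (q - 2) * m"
    if "\<beta> \<le> \<alpha>" "0 < \<alpha>" "0 \<le> \<beta>" "\<bar>y\<bar> \<le> \<beta> * \<gamma>" "\<bar>x - y\<bar> \<le> m * \<gamma>" "\<bar>\<alpha> - \<beta>\<bar> \<le> m" for \<alpha> \<beta> x y :: real
  proof -
    define t where "t = \<beta> / \<alpha>"
    have t: "0 \<le> t" "t \<le> 1" "\<beta> = t * \<alpha>" using that by (auto simp: t_def)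
    have "(\<alpha> powr (q - 2) - \<beta> powr (q - 2)) * \<beta> = \<alpha> powr (q - 2) * \<alpha> * (t - t powr (q - 1))"
    proof -
      have "\<beta> powr (q - 2) * \<beta> = \<beta> powr (q - 1)"
        using that by (simp add: mult.commute[of _ \<beta>] powr_mult_base)
      also have "\<dots> = t powr (q - 1) * (\<alpha> * \<alpha> powr (q - 2))"
        using that t by (simp add: powr_mult powr_mult_base)
      finally have "\<beta> powr (q - 2) * \<beta> = \<alpha> powr (q - 2) * \<alpha> * t powr (q - 1)"
        by (simp only: mult_ac)
      moreover have "\<alpha> powr (q - 2) * \<beta> = \<alpha> powr (q - 2) * \<alpha> * t" by (subst t(3)) (simp only: mult_ac)
      ultimately show ?thesis by (simp only: left_diff_distrib right_diff_distrib)
    qed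
    then have "\<bar>(\<alpha> powr (q - 2) - \<beta> powr (q - 2)) * \<beta>\<bar> = \<alpha> powr (q - 2) * \<alpha> * \<bar>t - t powr (q - 1)\<bar>"
      using that by (simp add: abs_mult)
    also have "\<dots> \<le> \<alpha> powr (q - 2) * \<alpha> * (real N * (1 - t))"
      using that t q N by (intro mult_left_mono powr_deviation) auto
    also have "\<dots> = real N * \<alpha> powr (q - 2) * (\<alpha> - \<beta>)" using t by (simp add: algebra_simps)
    also have "\<dots> \<le> real N * \<alpha> powr (q - 2) * m" using that by (intro mult_left_mono) auto
    finally have b: "\<bar>(\<alpha> powr (q - 2) - \<beta> powr (q - 2)) * \<beta>\<bar> \<le> real N * \<alpha> powr (q - 2) * m" .
    have "\<bar>(\<alpha> powr (q - 2) - \<beta> powr (q - 2)) * y\<bar> \<le> \<bar>\<alpha> powr (q - 2) - \<beta> powr (q - 2)\<bar> * (\<beta> * \<gamma>)"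
      using that by (simp add: abs_mult mult_left_mono)
    also have "\<dots> = \<bar>(\<alpha> powr (q - 2) - \<beta> powr (q - 2)) * \<beta>\<bar> * \<gamma>"
      using that by (simp add: abs_mult)
    also have "\<dots> \<le> real N * \<alpha> powr (q - 2) * m * \<gamma>" using b nn by (intro mult_right_mono)
    finally have 1: "\<bar>(\<alpha> powr (q - 2) - \<beta> powr (q - 2)) * y\<bar> \<le> real N * \<alpha> powr (q - 2) * m * \<gamma>" .
    have 2: "\<bar>\<alpha> powr (q - 2) * (x - y)\<bar> \<le> \<alpha> powr (q - 2) * (m * \<gamma>)"
      using that by (simp add: abs_mult mult_left_mono)
    have "\<alpha> powr (q - 2) * x - \<beta> powr (q - 2) * y =
        \<alpha> powr (q - 2) * (x - y) + (\<alpha> powr (q - 2) - \<beta> powr (q - 2)) * y"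
      by (simp add: algebra_simps)
    then have "\<bar>\<alpha> powr (q - 2) * x - \<beta> powr (q - 2) * y\<bar> \<le>
        \<alpha> powr (q - 2) * (m * \<gamma>) + real N * \<alpha> powr (q - 2) * m * \<gamma>"
      using 1 2 by linarith
    also have "\<dots> = (1 + real N) * \<gamma> * \<alpha> powr (q - 2) * m" by (simp add: algebra_simps)
    finally show ?thesis .
  qed
  show ?thesis
  proof (cases "\<beta> \<le> \<alpha>")
    case True
    then show ?thesis using *[of \<beta> \<alpha> y x] nn pos y xy m by (simp add: max_def)
  next
    case False
    then show ?thesis
      using *[of \<alpha> \<beta> x y] nn pos x xy m
      by (simp add: max_def abs_minus_commute)
  qed
qed

text \<open>C depends on q and \<eta> only. With r = q - 1, the crude bound is used where m is
  comparable to max \<alpha> \<gamma>, the Lipschitz bound where m is small against it; \<beta> is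
  eliminated through \<beta> \<le> \<alpha> + m.\<close>

lemma duality_map_difference:
  fixes q \<eta> :: real
  assumes q: "1 < q" and \<eta>: "0 < \<eta>"
  shows "\<exists>C\<ge>0. \<forall>\<alpha> \<beta> \<gamma> m x y. 0 \<le> \<alpha> \<longrightarrow> 0 \<le> \<beta> \<longrightarrow> 0 \<le> \<gamma> \<longrightarrow> \<bar>x\<bar> \<le> \<alpha> * \<gamma> \<longrightarrow> \<bar>y\<bar> \<le> \<beta> * \<gamma> \<longrightarrow>
    \<bar>x - y\<bar> \<le> m * \<gamma> \<longrightarrow> \<bar>\<alpha> - \<beta>\<bar> \<le> m \<longrightarrow>
    \<bar>\<alpha> powr (q - 2) * x - \<beta> powr (q - 2) * y\<bar> \<le> \<eta> * (\<alpha> powr q + \<gamma> powr q) + C * m powr q"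
proof -
  define N where "N = nat \<lceil>q\<rceil>"
  have N: "q - 1 \<le> real N" "1 \<le> N" using q unfolding N_def by linarith+
  define r where "r = q - 1"
  have r: "0 < r" using q by (simp add: r_def)
  define K where "K = 1 + real N"
  have K: "2 \<le> K" using N by (simp add: K_def)
  \<comment> \<open>\<delta> \<le> 1 gives max \<alpha> \<beta> \<le> 2 T for small m; the second
    bound serves r \<ge> 1 and the third r < 1.\<close>
  define \<delta> where "\<delta> = min 1 (min (\<eta> / (K * 2 powr r)) ((\<eta> / K) powr (1 / r)))"
  have \<delta>: "0 < \<delta>" "\<delta> \<le> 1" using \<eta> K by (auto simp: \<delta>_def)
  have \<delta>1: "K * 2 powr r * \<delta> \<le> \<eta>"
  proof -
    have "\<delta> \<le> \<eta> / (K * 2 powr r)" by (simp add: \<delta>_def)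
    then show ?thesis using K by (simp add: field_simps)
  qed
  have \<delta>2: "K * \<delta> powr r \<le> \<eta>"
  proof -
    have "\<delta> powr r \<le> ((\<eta> / K) powr (1 / r)) powr r"
      using \<delta> r by (intro powr_mono2) (auto simp: \<delta>_def)
    also have "\<dots> = \<eta> / K" using r \<eta> K by (simp add: powr_powr)
    finally show ?thesis using K by (simp add: field_simps)
  qed
  \<comment> \<open>If \<delta> T \<le> m, then \<gamma> \<le> m/\<delta> and B \<le> 2 m/\<delta>,
    so the crude bound 2 \<gamma> B^r is at most this constant times m^q.\<close>
  define C where "C = 2 * (1 / \<delta>) * (2 / \<delta>) powr r"
  have "0 \<le> C" using \<delta> by (simp add: C_def)
  moreover have "\<bar>\<alpha> powr (q - 2) * x - \<beta> powr (q - 2) * y\<bar> \<le> \<eta> * (\<alpha> powr q + \<gamma> powr q) + C * m powr q"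
    (is "?D \<le> _")
    if nn: "0 \<le> \<alpha>" "0 \<le> \<beta>" "0 \<le> \<gamma>" and x: "\<bar>x\<bar> \<le> \<alpha> * \<gamma>" and y: "\<bar>y\<bar> \<le> \<beta> * \<gamma>"
      and xy: "\<bar>x - y\<bar> \<le> m * \<gamma>" and m: "\<bar>\<alpha> - \<beta>\<bar> \<le> m" for \<alpha> \<beta> \<gamma> m x y
  proof -
    define T where "T = max \<alpha> \<gamma>"
    define B where "B = max \<alpha> \<beta>"
    have m0: "0 \<le> m" using m by linarith
    have T: "0 \<le> T" "\<alpha> \<le> T" "\<gamma> \<le> T" using nn by (auto simp: T_def)
    have B: "0 \<le> B" "B \<le> \<alpha> + m" using nn m by (auto simp: B_def)
    have Tq: "T powr q \<le> \<alpha> powr q + \<gamma> powr q" by (auto simp: T_def max_def)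
    have crude: "?D \<le> 2 * \<gamma> * B powr r"
      using duality_map_difference_crude[OF q nn x y] by (simp add: B_def r_def)
    show ?thesis
    proof (cases "\<delta> * T \<le> m")
      case True
      then have "T \<le> m / \<delta>" using \<delta> by (simp add: field_simps)
      then have g: "\<gamma> \<le> m / \<delta>" and a: "\<alpha> \<le> m / \<delta>" using T by auto
      have "m \<le> m / \<delta>" using \<delta> m0 by (simp add: le_divide_eq mult_left_le)
      then have b: "B \<le> (2 / \<delta>) * m" using a B(2) by simp
      have "?D \<le> 2 * \<gamma> * B powr r" by (rule crude)
      also have "\<dots> \<le> 2 * (m / \<delta>) * ((2 / \<delta>) * m) powr r"
        using g b B nn r m0 \<delta> by (intro mult_mono powr_mono2) auto
      also have "\<dots> = 2 * (1 / \<delta>) * (2 / \<delta>) powr r * (m * m powr r)"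
        using m0 \<delta> by (subst powr_mult) (auto simp: field_simps)
      also have "m * m powr r = m powr q"
        using m0 by (simp add: powr_mult_base r_def)
      finally have "?D \<le> C * m powr q" by (simp add: C_def)
      moreover have "0 \<le> \<eta> * (\<alpha> powr q + \<gamma> powr q)" using \<eta> by simp
      ultimately show ?thesis by linarith
    next
      case False
      then have mT: "m \<le> \<delta> * T" by simp
      have T0: "0 < T" using False m0 T(1) \<delta> by (metis mult_zero_right order_less_le)
      have TT: "T * T powr r = T powr q" using T by (simp add: powr_mult_base r_def)
      have "?D \<le> \<eta> * T powr q"
      proof (cases "B = 0")
        case True
        then show ?thesis using crude \<eta> T r by simp
      next
        case False
        then have B0: "0 < B" using B by simp
        have lip: "?D \<le> K * \<gamma> * B powr (r - 1) * m"
          using duality_map_difference_Lipschitz[OF q N nn _ x y xy m] B0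
          by (simp add: B_def r_def K_def)
        show ?thesis
        proof (cases "1 \<le> r")
          case True
          have "B \<le> 2 * T" using B(2) T(2) mT \<delta> T(1) mult_left_le_one_le[of T \<delta>] by linarith
          then have "?D \<le> K * T * (2 * T) powr (r - 1) * (\<delta> * T)"
            using lip True B T nn m0 mT K \<delta>
            by (elim order_trans) (intro mult_mono powr_mono2 mult_nonneg_nonneg; simp)
          also have "\<dots> = (K * 2 powr (r - 1) * \<delta>) * (T * (T * T powr (r - 1)))"
            using T by (simp add: powr_mult algebra_simps)
          also have "T * T powr (r - 1) = T powr r" using T by (simp add: powr_mult_base)
          also have "(K * 2 powr (r - 1) * \<delta>) * (T * T powr r) \<le> \<eta> * (T * T powr r)"
          proof (intro mult_right_mono)
            have "K * 2 powr (r - 1) * \<delta> \<le> K * 2 powr r * \<delta>"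
              using K \<delta> by (intro mult_mono powr_mono) auto
            then show "K * 2 powr (r - 1) * \<delta> \<le> \<eta>" using \<delta>1 by linarith
          qed (use T in auto)
          finally show ?thesis by (simp only: TT)
        next
          case False
          \<comment> \<open>The exponent r - 1 is negative: for m \<le> B it gives B^(r-1) m \<le>
            m^r, and for m > B the crude bound suffices because K \<ge> 2. The case m = 0 is
            separate since \<open>0 powr (r - 1)\<close> is 0.\<close>
          have "?D \<le> K * \<gamma> * m powr r"
          proof (cases "m \<le> B")
            case mB: True
            show ?thesis
            proof (cases "m = 0")
              case True
              then show ?thesis using lip by simp
            next
              case m1: False
              have "B powr (r - 1) \<le> m powr (r - 1)"
                using False mB m0 m1 by (intro powr_mono2') auto
              then have "K * \<gamma> * B powr (r - 1) * m \<le> K * \<gamma> * m powr (r - 1) * m"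
                using K nn m0 by (intro mult_right_mono mult_left_mono) auto
              also have "\<dots> = K * \<gamma> * (m * m powr (r - 1))" by simp
              also have "m * m powr (r - 1) = m powr r" using m0 by (simp add: powr_mult_base)
              finally show ?thesis using lip by linarith
            qed
          next
            case mB: False
            have "2 * \<gamma> * B powr r \<le> K * \<gamma> * m powr r"
              using K nn B mB r by (intro mult_mono powr_mono2) auto
            then show ?thesis using crude by linarith
          qed
          also have "\<dots> \<le> K * T * (\<delta> * T) powr r"
            using K nn T mT m0 r by (intro mult_mono powr_mono2) auto
          also have "\<dots> = K * \<delta> powr r * (T * T powr r)"
            using \<delta> T by (simp add: powr_mult)
          also have "\<dots> \<le> \<eta> * (T * T powr r)" using \<delta>2 T by (intro mult_right_mono) auto
          finally show ?thesis by (simp only: TT)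
        qed
      qed
      also have "\<dots> \<le> \<eta> * (\<alpha> powr q + \<gamma> powr q)" using Tq \<eta> by simp
      also have "\<dots> \<le> \<eta> * (\<alpha> powr q + \<gamma> powr q) + C * m powr q" using \<open>0 \<le> C\<close> by simp
      finally show ?thesis .
    qed
  qed
  ultimately show ?thesis by blast
qed

text \<open>A rough form of Young's inequality: both \<alpha> and \<gamma> are at most their maximum
  T, and T^q is one of the two summands.\<close>

lemma duality_map_bound:
  fixes q :: real
  assumes q: "1 < q" and nn: "0 \<le> \<alpha>" "0 \<le> \<gamma>" and x: "\<bar>x\<bar> \<le> \<alpha> * \<gamma>"
  shows "\<bar>\<alpha> powr (q - 2) * x\<bar> \<le> \<alpha> powr q + \<gamma> powr q"
proof -
  define T where "T = max \<alpha> \<gamma>"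
  have T: "0 \<le> T" "\<alpha> \<le> T" "\<gamma> \<le> T" using nn by (auto simp: T_def)
  have "\<bar>\<alpha> powr (q - 2) * x\<bar> \<le> \<alpha> powr (q - 2) * (\<alpha> * \<gamma>)"
    using x by (simp add: abs_mult mult_left_mono)
  also have "\<dots> = (\<alpha> * \<alpha> powr (q - 2)) * \<gamma>" by simp
  also have "\<dots> = \<alpha> powr (q - 1) * \<gamma>" using nn by (subst powr_mult_base) (auto simp: algebra_simps)
  also have "\<dots> \<le> T powr (q - 1) * T" using T nn q by (intro mult_mono powr_mono2) auto
  also have "\<dots> = T powr q" using T by (simp add: mult.commute[of _ T] powr_mult_base)
  also have "\<dots> \<le> \<alpha> powr q + \<gamma> powr q" by (auto simp: T_def max_def)
  finally show ?thesis .
qed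

lemma powr_times_square: "0 \<le> a \<Longrightarrow> a powr (q - 2) * (a * a) = a powr q" for a q :: real
proof -
  assume a: "0 \<le> a"
  have "a powr (q - 2) * (a * a) = a * (a * a powr (q - 2))" by simp
  also have "\<dots> = a powr q" using a by (simp add: powr_mult_base)
  finally show ?thesis .
qed

section \<open>Continuity of the operator\<close>

lemma L2_set_self: "L2_set f A * L2_set f A = (\<Sum>i\<in>A. f i * f i)"
  by (simp add: L2_set_def sum_nonneg power2_eq_square)

lemma L2_set_inner_bound: "\<bar>\<Sum>i\<in>A. f i * g i\<bar> \<le> L2_set f A * L2_set g A"
proof -
  have "\<bar>\<Sum>i\<in>A. f i * g i\<bar> \<le> (\<Sum>i\<in>A. \<bar>f i\<bar> * \<bar>g i\<bar>)"
    using sum_abs[of "\<lambda>i. f i * g i" A] by (simp add: abs_mult)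
  also have "\<dots> \<le> L2_set f A * L2_set g A" by (rule L2_set_mult_ineq)
  finally show ?thesis .
qed

lemma L2_set_diff_bound: "\<bar>L2_set f A - L2_set g A\<bar> \<le> L2_set (\<lambda>i. f i - g i) A"
proof -
  have "L2_set f A \<le> L2_set (\<lambda>i. f i - g i) A + L2_set g A"
    using L2_set_triangle_ineq[of "\<lambda>i. f i - g i" g A] by simp
  moreover have "L2_set g A \<le> L2_set (\<lambda>i. g i - f i) A + L2_set f A"
    using L2_set_triangle_ineq[of "\<lambda>i. g i - f i" f A] by simp
  moreover have "L2_set (\<lambda>i. g i - f i) A = L2_set (\<lambda>i. f i - g i) A"
    by (simp add: L2_set_def power2_commute)
  ultimately show ?thesis by linarith
qed

lemma L2_set_scale: "L2_set (\<lambda>i. t * f i) A = \<bar>t\<bar> * L2_set f A"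
  by (simp add: L2_set_def power_mult_distrib sum_distrib_left[symmetric] real_sqrt_mult)

definition elt_form ::
    "real \<Rightarrow> nat \<Rightarrow> (edge \<Rightarrow> real^2) \<Rightarrow> element \<Rightarrow> vfield \<Rightarrow> vfield \<Rightarrow> real"
  where "elt_form p k n E w v =
    form_a p E (proj k (cell E) w) (proj k (cell E) v) +
    form_s p k n E (\<lambda>x. w x - proj k (cell E) w x) (\<lambda>x. v x - proj k (cell E) v x)"

lemma form_h_elt_form: "form_h p k n M w v = (\<Sum>E\<in>M. elt_form p k n E w v)"
  by (simp add: form_h_def elt_form_def)

text \<open>For q < 2 the factor |u|^(q-2) is unbounded near zeros of u; the whole product is
  nevertheless bounded on the cell by \<open>duality_map_bound\<close>.\<close>

lemma duality_integrable:
  assumes q: "1 < q" and u: "u \<in> vpolys l" and v: "v \<in> vpolys l"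
  shows "integrable (lebesgue_on (cell E)) (\<lambda>x. norm (u x) powr (q - 2) * (u x \<bullet> v x))"
proof -
  obtain A where A: "\<And>x. x \<in> cell E \<Longrightarrow> norm (u x) \<le> A"
    using continuous_bounded_on_bounded[OF bounded_cell vpolys_continuous[OF u]] by blast
  obtain B where B: "\<And>x. x \<in> cell E \<Longrightarrow> norm (v x) \<le> B"
    using continuous_bounded_on_bounded[OF bounded_cell vpolys_continuous[OF v]] by blast
  have mu: "u \<in> borel_measurable (lebesgue_on (cell E))" and mv: "v \<in> borel_measurable (lebesgue_on (cell E))"
    using vpolys_L2[OF u] vpolys_L2[OF v] by (auto simp: L2_def)
  show ?thesis
  proof (rule integrable_bounded_measurable[OF cell_sets bounded_cell])
    show "(\<lambda>x. norm (u x) powr (q - 2) * (u x \<bullet> v x)) \<in> borel_measurable (lebesgue_on (cell E))"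
      by (intro borel_measurable_times powr_real_measurable borel_measurable_inner mu mv
          borel_measurable_const measurable_compose[OF mu borel_measurable_norm])
    fix x assume x: "x \<in> cell E"
    have "norm (norm (u x) powr (q - 2) * (u x \<bullet> v x)) \<le> norm (u x) powr q + norm (v x) powr q"
      using duality_map_bound[OF q, of "norm (u x)" "norm (v x)" "u x \<bullet> v x"] Cauchy_Schwarz_ineq2[of "u x" "v x"]
      by simp
    also have "\<dots> \<le> A powr q + B powr q"
      using A[OF x] B[OF x] q by (intro add_mono powr_mono2) auto
    finally show "norm (norm (u x) powr (q - 2) * (u x \<bullet> v x)) \<le> A powr q + B powr q" .
  qed
qed

lemma form_a_self: "form_a p E w w = integral\<^sup>L (lebesgue_on (cell E)) (\<lambda>x. norm (w x) powr conj_exp p)"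
  unfolding form_a_def by (simp add: dot_square_norm power2_eq_square powr_times_square)

lemma form_s_self:
  "form_s p k n E w w = (elt_diam E)\<^sup>2 * L2_set (dof n E w) (dof_indices k E) powr conj_exp p"
  unfolding form_s_def L2_set_self[symmetric] by (simp add: mult.assoc powr_times_square)

context mesh_element
begin

context
  fixes p :: real and k :: nat
  assumes conj_exp: "1 < conj_exp p"
begin

abbreviation "\<pi> v \<equiv> proj k (cell E) v"
abbreviation "rdof v \<equiv> dof n E (\<lambda>x. v x - proj k (cell E) v x)"
abbreviation "J \<equiv> dof_indices k E"

lemma proj_vpolys: "v \<in> traceable n E \<Longrightarrow> \<pi> v \<in> vpolys (int k)"
  by (intro proj_orthogonal(1) traceable_L2)

lemma proj_powr_integrable:
  assumes "v \<in> traceable n E"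
  shows "integrable (lebesgue_on (cell E)) (\<lambda>x. norm (\<pi> v x) powr conj_exp p)"
  using duality_integrable[OF conj_exp proj_vpolys[OF assms] proj_vpolys[OF assms]]
  by (simp add: dot_square_norm power2_eq_square powr_times_square)

lemma elt_form_self:
  "elt_form p k n E v v = integral\<^sup>L (lebesgue_on (cell E)) (\<lambda>x. norm (\<pi> v x) powr conj_exp p) +
    (elt_diam E)\<^sup>2 * L2_set (rdof v) J powr conj_exp p"
  by (simp add: elt_form_def form_a_self form_s_self)

lemma elt_form_nonneg: "0 \<le> elt_form p k n E v v"
  unfolding elt_form_self by (intro add_nonneg_nonneg mult_nonneg_nonneg Bochner_Integration.integral_nonneg) auto

lemma elt_form_lincomb:
  assumes w: "w \<in> traceable n E" and u: "u \<in> traceable n E" and v: "v \<in> traceable n E"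
  shows "elt_form p k n E w (\<lambda>x. a *\<^sub>R u x + b *\<^sub>R v x) = a * elt_form p k n E w u + b * elt_form p k n E w v"
proof -
  let ?v = "\<lambda>x. a *\<^sub>R u x + b *\<^sub>R v x"
  let ?g = "\<lambda>v x. norm (\<pi> w x) powr (conj_exp p - 2) * (\<pi> w x \<bullet> \<pi> v x)"
  have "form_a p E (\<pi> w) (\<pi> ?v) = integral\<^sup>L (lebesgue_on (cell E)) (\<lambda>x. a * ?g u x + b * ?g v x)"
    unfolding form_a_def
  proof (rule Bochner_Integration.integral_cong[OF refl])
    fix x assume "x \<in> space (lebesgue_on (cell E))"
    then have "\<pi> ?v x = a *\<^sub>R \<pi> u x + b *\<^sub>R \<pi> v x"
      by (intro proj_lincomb[OF traceable_L2[OF u] traceable_L2[OF v]]) simp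
    then show "?g ?v x = a * ?g u x + b * ?g v x"
      by (simp only: inner_add_right inner_scaleR_right) (simp add: algebra_simps)
  qed
  also have "\<dots> = a * form_a p E (\<pi> w) (\<pi> u) + b * form_a p E (\<pi> w) (\<pi> v)"
    unfolding form_a_def
    using duality_integrable[OF conj_exp proj_vpolys[OF w] proj_vpolys[OF u]]
      duality_integrable[OF conj_exp proj_vpolys[OF w] proj_vpolys[OF v]] by simp
  finally have A: "form_a p E (\<pi> w) (\<pi> ?v) = a * form_a p E (\<pi> w) (\<pi> u) + b * form_a p E (\<pi> w) (\<pi> v)" .
  have "(\<Sum>\<iota>\<in>J. rdof w \<iota> * rdof ?v \<iota>) = (\<Sum>\<iota>\<in>J. a * (rdof w \<iota> * rdof u \<iota>) + b * (rdof w \<iota> * rdof v \<iota>))"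
    by (intro sum.cong refl) (simp add: dof_remainder_lincomb[OF u v] algebra_simps)
  also have "\<dots> = a * (\<Sum>\<iota>\<in>J. rdof w \<iota> * rdof u \<iota>) + b * (\<Sum>\<iota>\<in>J. rdof w \<iota> * rdof v \<iota>)"
    by (simp add: sum.distrib sum_distrib_left)
  finally show ?thesis
    unfolding elt_form_def A form_s_def by (simp add: algebra_simps)
qed

lemma elt_form_scale:
  assumes v: "v \<in> traceable n E"
  shows "elt_form p k n E (\<lambda>x. t *\<^sub>R v x) (\<lambda>x. t *\<^sub>R v x) = \<bar>t\<bar> powr conj_exp p * elt_form p k n E v v"
proof -
  let ?v = "\<lambda>x. t *\<^sub>R v x"
  have \<pi>: "\<pi> ?v x = t *\<^sub>R \<pi> v x" if "x \<in> cell E" for x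
    using proj_lincomb[OF traceable_L2[OF v] traceable_L2[OF v] that, of k t 0] by simp
  have "integral\<^sup>L (lebesgue_on (cell E)) (\<lambda>x. norm (\<pi> ?v x) powr conj_exp p) =
      integral\<^sup>L (lebesgue_on (cell E)) (\<lambda>x. \<bar>t\<bar> powr conj_exp p * norm (\<pi> v x) powr conj_exp p)"
    by (rule Bochner_Integration.integral_cong[OF refl]) (simp add: \<pi> powr_mult)
  moreover have "L2_set (rdof ?v) J = \<bar>t\<bar> * L2_set (rdof v) J"
  proof -
    have "L2_set (rdof ?v) J = L2_set (\<lambda>\<iota>. t * rdof v \<iota>) J"
      using dof_remainder_lincomb[OF v v, of _ k t 0] by (intro L2_set_cong refl) simp
    then show ?thesis by (simp add: L2_set_scale)
  qed
  ultimately show ?thesis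
    unfolding elt_form_self by (simp add: powr_mult L2_set_nonneg algebra_simps)
qed

lemma elt_form_bound:
  assumes w: "w \<in> traceable n E" and v: "v \<in> traceable n E"
  shows "\<bar>elt_form p k n E w v\<bar> \<le> elt_form p k n E w w + elt_form p k n E v v"
proof -
  let ?q = "conj_exp p"
  let ?g = "\<lambda>x. norm (\<pi> w x) powr (?q - 2) * (\<pi> w x \<bullet> \<pi> v x)"
  have i: "integrable (lebesgue_on (cell E)) ?g"
    by (rule duality_integrable[OF conj_exp proj_vpolys[OF w] proj_vpolys[OF v]])
  have "\<bar>form_a p E (\<pi> w) (\<pi> v)\<bar> \<le> integral\<^sup>L (lebesgue_on (cell E)) (\<lambda>x. \<bar>?g x\<bar>)"
    unfolding form_a_def by (rule integral_abs_bound)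
  also have "\<dots> \<le> integral\<^sup>L (lebesgue_on (cell E)) (\<lambda>x. norm (\<pi> w x) powr ?q + norm (\<pi> v x) powr ?q)"
    using i proj_powr_integrable[OF w] proj_powr_integrable[OF v]
    by (intro integral_mono duality_map_bound[OF conj_exp] Cauchy_Schwarz_ineq2) auto
  also have "\<dots> = form_a p E (\<pi> w) (\<pi> w) + form_a p E (\<pi> v) (\<pi> v)"
    using proj_powr_integrable[OF w] proj_powr_integrable[OF v] by (simp add: form_a_self)
  finally have a: "\<bar>form_a p E (\<pi> w) (\<pi> v)\<bar> \<le> form_a p E (\<pi> w) (\<pi> w) + form_a p E (\<pi> v) (\<pi> v)" .
  have "\<bar>L2_set (rdof w) J powr (?q - 2) * (\<Sum>\<iota>\<in>J. rdof w \<iota> * rdof v \<iota>)\<bar> \<le> L2_set (rdof w) J powr ?q + L2_set (rdof v) J powr ?q"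
    by (intro duality_map_bound[OF conj_exp] L2_set_inner_bound L2_set_nonneg)
  then have "(elt_diam E)\<^sup>2 * \<bar>L2_set (rdof w) J powr (?q - 2) * (\<Sum>\<iota>\<in>J. rdof w \<iota> * rdof v \<iota>)\<bar> \<le>
      (elt_diam E)\<^sup>2 * (L2_set (rdof w) J powr ?q + L2_set (rdof v) J powr ?q)"
    by (intro mult_left_mono) auto
  then have "\<bar>form_s p k n E (\<lambda>x. w x - \<pi> w x) (\<lambda>x. v x - \<pi> v x)\<bar> \<le>
      form_s p k n E (\<lambda>x. w x - \<pi> w x) (\<lambda>x. w x - \<pi> w x) + form_s p k n E (\<lambda>x. v x - \<pi> v x) (\<lambda>x. v x - \<pi> v x)"
    unfolding form_s_self by (simp add: form_s_def abs_mult mult.assoc distrib_left)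
  then show ?thesis using a unfolding elt_form_def by linarith
qed

text \<open>The scalar inequality is used twice: pointwise under the integral, with m = |\<pi> w -
  \<pi> z|, and once for the vectors of degrees of freedom. It enters as a hypothesis so that the
  same \<eta> and C serve every element.\<close>

lemma elt_form_difference:
  assumes C: "\<And>\<alpha> \<beta> \<gamma> m x y. 0 \<le> \<alpha> \<Longrightarrow> 0 \<le> \<beta> \<Longrightarrow> 0 \<le> \<gamma> \<Longrightarrow> \<bar>x\<bar> \<le> \<alpha> * \<gamma> \<Longrightarrow> \<bar>y\<bar> \<le> \<beta> * \<gamma> \<Longrightarrow>
      \<bar>x - y\<bar> \<le> m * \<gamma> \<Longrightarrow> \<bar>\<alpha> - \<beta>\<bar> \<le> m \<Longrightarrow>
      \<bar>\<alpha> powr (conj_exp p - 2) * x - \<beta> powr (conj_exp p - 2) * y\<bar> \<le>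
        \<eta> * (\<alpha> powr conj_exp p + \<gamma> powr conj_exp p) + C * m powr conj_exp p"
    and w: "w \<in> traceable n E" and z: "z \<in> traceable n E" and v: "v \<in> traceable n E"
  shows "\<bar>elt_form p k n E w v - elt_form p k n E z v\<bar> \<le>
    \<eta> * (elt_form p k n E w w + elt_form p k n E v v) +
    C * elt_form p k n E (\<lambda>x. w x - z x) (\<lambda>x. w x - z x)"
proof -
  let ?q = "conj_exp p"
  let ?d = "\<lambda>x. w x - z x"
  let ?g = "\<lambda>w x. norm (\<pi> w x) powr (?q - 2) * (\<pi> w x \<bullet> \<pi> v x)"
  have d: "?d \<in> traceable n E" using traceable_lincomb[OF w z, of 1 "-1"] by simp
  have \<pi>d: "\<pi> ?d x = \<pi> w x - \<pi> z x" if "x \<in> cell E" for x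
    using proj_lincomb[OF traceable_L2[OF w] traceable_L2[OF z] that, of k 1 "-1"] by simp
  have rdofd: "rdof ?d \<iota> = rdof w \<iota> - rdof z \<iota>" if "\<iota> \<in> J" for \<iota>
    using dof_remainder_lincomb[OF w z that, of 1 "-1"] by simp
  have i: "integrable (lebesgue_on (cell E)) (?g w)" "integrable (lebesgue_on (cell E)) (?g z)"
    by (rule duality_integrable[OF conj_exp proj_vpolys proj_vpolys], fact+)+
  note pi = proj_powr_integrable[OF w] proj_powr_integrable[OF v] proj_powr_integrable[OF d]
  have "\<bar>form_a p E (\<pi> w) (\<pi> v) - form_a p E (\<pi> z) (\<pi> v)\<bar> =
      \<bar>integral\<^sup>L (lebesgue_on (cell E)) (\<lambda>x. ?g w x - ?g z x)\<bar>"
    unfolding form_a_def using i by simp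
  also have "\<dots> \<le> integral\<^sup>L (lebesgue_on (cell E)) (\<lambda>x. \<bar>?g w x - ?g z x\<bar>)"
    by (rule integral_abs_bound)
  also have "\<dots> \<le> integral\<^sup>L (lebesgue_on (cell E))
      (\<lambda>x. \<eta> * (norm (\<pi> w x) powr ?q + norm (\<pi> v x) powr ?q) + C * norm (\<pi> ?d x) powr ?q)"
  proof (rule integral_mono)
    show "integrable (lebesgue_on (cell E)) (\<lambda>x. \<bar>?g w x - ?g z x\<bar>)" using i by simp
    show "integrable (lebesgue_on (cell E))
        (\<lambda>x. \<eta> * (norm (\<pi> w x) powr ?q + norm (\<pi> v x) powr ?q) + C * norm (\<pi> ?d x) powr ?q)"
      using pi by simp
    fix x assume "x \<in> space (lebesgue_on (cell E))"
    then have x: "x \<in> cell E" by simp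
    have "\<bar>\<pi> w x \<bullet> \<pi> v x - \<pi> z x \<bullet> \<pi> v x\<bar> \<le> norm (\<pi> w x - \<pi> z x) * norm (\<pi> v x)"
      by (simp only: inner_diff_left[symmetric] Cauchy_Schwarz_ineq2)
    then show "\<bar>?g w x - ?g z x\<bar> \<le>
        \<eta> * (norm (\<pi> w x) powr ?q + norm (\<pi> v x) powr ?q) + C * norm (\<pi> ?d x) powr ?q"
      unfolding \<pi>d[OF x] by (intro C norm_ge_zero Cauchy_Schwarz_ineq2 norm_triangle_ineq3)
  qed
  also have "\<dots> = \<eta> * (form_a p E (\<pi> w) (\<pi> w) + form_a p E (\<pi> v) (\<pi> v)) + C * form_a p E (\<pi> ?d) (\<pi> ?d)"
    using pi by (simp add: form_a_self)
  finally have a: "\<bar>form_a p E (\<pi> w) (\<pi> v) - form_a p E (\<pi> z) (\<pi> v)\<bar> \<le>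
      \<eta> * (form_a p E (\<pi> w) (\<pi> w) + form_a p E (\<pi> v) (\<pi> v)) + C * form_a p E (\<pi> ?d) (\<pi> ?d)" .
  let ?s = "\<lambda>w v. form_s p k n E (\<lambda>x. w x - \<pi> w x) (\<lambda>x. v x - \<pi> v x)"
  let ?h = "\<lambda>w. L2_set (rdof w) J powr (?q - 2) * (\<Sum>\<iota>\<in>J. rdof w \<iota> * rdof v \<iota>)"
  have Ld: "L2_set (rdof ?d) J = L2_set (\<lambda>\<iota>. rdof w \<iota> - rdof z \<iota>) J"
    by (intro L2_set_cong refl rdofd)
  have "\<bar>(\<Sum>\<iota>\<in>J. rdof w \<iota> * rdof v \<iota>) - (\<Sum>\<iota>\<in>J. rdof z \<iota> * rdof v \<iota>)\<bar> \<le> L2_set (rdof ?d) J * L2_set (rdof v) J"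
    unfolding Ld using L2_set_inner_bound[of "\<lambda>\<iota>. rdof w \<iota> - rdof z \<iota>" "rdof v" J]
    by (simp add: left_diff_distrib sum_subtractf)
  moreover have "\<bar>L2_set (rdof w) J - L2_set (rdof z) J\<bar> \<le> L2_set (rdof ?d) J"
    unfolding Ld by (rule L2_set_diff_bound)
  ultimately have "\<bar>?h w - ?h z\<bar> \<le>
      \<eta> * (L2_set (rdof w) J powr ?q + L2_set (rdof v) J powr ?q) + C * L2_set (rdof ?d) J powr ?q"
    by (intro C L2_set_nonneg L2_set_inner_bound)
  then have "(elt_diam E)\<^sup>2 * \<bar>?h w - ?h z\<bar> \<le> (elt_diam E)\<^sup>2 *
      (\<eta> * (L2_set (rdof w) J powr ?q + L2_set (rdof v) J powr ?q) + C * L2_set (rdof ?d) J powr ?q)"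
    by (intro mult_left_mono) auto
  moreover have "\<bar>?s w v - ?s z v\<bar> = (elt_diam E)\<^sup>2 * \<bar>?h w - ?h z\<bar>"
  proof -
    have "?s w v - ?s z v = (elt_diam E)\<^sup>2 * (?h w - ?h z)"
      by (simp only: form_s_def right_diff_distrib mult.assoc)
    then show ?thesis by (simp add: abs_mult)
  qed
  ultimately have "\<bar>?s w v - ?s z v\<bar> \<le> \<eta> * (?s w w + ?s v v) + C * ?s ?d ?d"
    unfolding form_s_self by (simp add: algebra_simps)
  then show ?thesis using a unfolding elt_form_def by (simp add: algebra_simps)
qed

end

end

lemma mesh_element:
  assumes "decomposition \<Omega> M" "unit_normals M n" "E \<in> M"
  shows "mesh_element n E"
proof
  fix e a b assume e: "e \<in> edges E"
  show "simple_polygon E" using assms by (simp add: decomposition_def)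
  show "e \<in> edges E" by fact
  show "norm (n e) = 1" using assms e by (simp add: unit_normals_def)
  show "n e \<bullet> (a - b) = 0" if "a \<in> e" "b \<in> e" using assms e that by (simp add: unit_normals_def)
qed

lemma Vh_traceable: "v \<in> Vh k n \<Omega> M \<Longrightarrow> E \<in> M \<Longrightarrow> v \<in> traceable n E"
  unfolding Vh_def Vloc_def Hdiv_def traceable_def by blast

text \<open>Ensures that the supremum in \<open>dual_norm\<close> runs over a nonempty set.\<close>

lemma zero_in_Zh: "(\<lambda>x. 0) \<in> Zh k n \<Omega> M"
proof -
  have div: "weak_div D (\<lambda>x. 0) (\<lambda>x. 0)" and rot: "weak_rot D (\<lambda>x. 0) (\<lambda>x. 0)" for D
    by (simp_all add: weak_div_def weak_rot_def)
  have Hdiv: "(\<lambda>x. 0) \<in> Hdiv D" and Hrot: "(\<lambda>x. 0) \<in> Hrot D" for D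
    unfolding Hdiv_def Hrot_def
    by (auto intro!: L2_zero bexI[of _ "\<lambda>x. 0"] div rot)
  have polys: "(\<lambda>x. 0) \<in> polys l" for l
    unfolding polys_def by (intro CollectI exI[of _ "\<lambda>_ _. 0"]) simp
  have "has_normal_trace n E e (\<lambda>x. 0) 0" for E e
    unfolding has_normal_trace_def
    by (rule bexI[of _ "\<lambda>x. 0"]) (simp_all add: div L2_zero edge_integral_def)
  then have "\<exists>q. degree q \<le> k \<and> has_normal_trace n E e (\<lambda>x. 0) q" for E e
    by (metis degree_0 le0)
  then show ?thesis
    using Hdiv Hrot div rot polys unfolding Zh_def Vh_def Vloc_def by blast
qed

theorem lemma28:
  fixes p \<rho> :: real and k :: nat and \<Omega> :: "(real^2) set" and M :: "element set"
    and n :: "edge \<Rightarrow> real^2" and \<tau> :: vfield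
  assumes "1 < p"
    and "polygonal_domain \<Omega>"
    and "decomposition \<Omega> M"
    and "mesh_regular \<rho> M"
    and "unit_normals M n"
    and "\<tau> \<in> Vh k n \<Omega> M"
  shows "(\<forall>w \<in> Zh k n \<Omega> M. op_A p k n M \<tau> w \<in> dual_space (Zh k n \<Omega> M) (normZ p k n M)) \<and>
    (\<forall>w \<in> Zh k n \<Omega> M. \<forall>\<epsilon> > 0. \<exists>\<delta> > 0. \<forall>z \<in> Zh k n \<Omega> M.
       normZ p k n M (\<lambda>x. w x - z x) < \<delta> \<longrightarrow>
       dual_norm (Zh k n \<Omega> M) (normZ p k n M)
         (\<lambda>v. op_A p k n M \<tau> w v - op_A p k n M \<tau> z v) < \<epsilon>)"
proof -
  let ?Z = "Zh k n \<Omega> M" and ?N = "normZ p k n M" and ?h = "form_h p k n M"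
  define q where "q = conj_exp p"
  have q: "1 < conj_exp p" using \<open>1 < p\<close> by (simp add: conj_exp_def)
  then have q0: "0 < q" "1 < q" by (simp_all add: q_def)
  \<comment> \<open>Adding \<tau>, which may have nonzero divergence, leads out of Z_h;
    \<open>W\<close> is a linear space containing Z_h and its translate.\<close>
  define W where "W = {v. \<forall>E\<in>M. v \<in> traceable n E}"
  have elem: "mesh_element n E" if "E \<in> M" for E
    using mesh_element[OF assms(3,5) that] .
  have Wt: "v \<in> traceable n E" if "v \<in> W" "E \<in> M" for v E using that by (simp add: W_def)
  have ZW: "v \<in> W" if "v \<in> ?Z" for v
    using that Vh_traceable unfolding W_def Zh_def by blast
  have W_lin: "(\<lambda>x. a *\<^sub>R u x + b *\<^sub>R v x) \<in> W" if "u \<in> W" "v \<in> W" for u v a b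
    using that traceable_lincomb by (simp add: W_def)
  have W_scale: "(\<lambda>x. t *\<^sub>R v x) \<in> W" if "v \<in> W" for t v
    using W_lin[OF that that, of t 0] by simp
  have W\<tau>: "(\<lambda>x. w x + \<tau> x) \<in> W" if "w \<in> ?Z" for w
  proof -
    have "\<tau> \<in> W" using Vh_traceable[OF assms(6)] by (simp add: W_def)
    then show ?thesis using W_lin[OF ZW[OF that], of \<tau> 1 1] by simp
  qed
  have nonneg: "0 \<le> ?h v v" for v
    unfolding form_h_elt_form by (intro sum_nonneg mesh_element.elt_form_nonneg[OF elem q])
  have lin: "?h w (\<lambda>x. a *\<^sub>R u x + b *\<^sub>R v x) = a * ?h w u + b * ?h w v"
    if "w \<in> W" "u \<in> W" "v \<in> W" for w u v a b
    unfolding form_h_elt_form using that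
    by (simp add: mesh_element.elt_form_lincomb[OF elem q] Wt sum.distrib sum_distrib_left)
  have scale: "?h (\<lambda>x. t *\<^sub>R v x) (\<lambda>x. t *\<^sub>R v x) = \<bar>t\<bar> powr q * ?h v v" if "v \<in> W" for v t
    unfolding form_h_elt_form q_def using that
    by (simp add: mesh_element.elt_form_scale[OF elem q] Wt sum_distrib_left)
  have bound: "\<bar>?h w v\<bar> \<le> ?h w w + ?h v v" if "w \<in> W" "v \<in> W" for w v
    unfolding form_h_elt_form sum.distrib[symmetric] using that
    by (intro order_trans[OF sum_abs] sum_mono mesh_element.elt_form_bound[OF elem q] Wt)
  have N_def: "?N v = ?h v v powr (1 / q)" for v by (simp add: normZ_def q_def)
  have bounded: "\<bar>?h w v\<bar> \<le> (?h w w + 1) * ?N v" if w: "w \<in> W" and v: "v \<in> W" for w v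
  proof -
    \<comment> \<open>Replacing v by t v in \<open>bound\<close> makes the left side grow like t and
      the last term like t^q; the free parameter t turns the sum into a bound by the norm.\<close>
    have scaled: "t * \<bar>?h w v\<bar> \<le> ?h w w + t powr q * ?h v v" if "0 < t" for t
    proof -
      have "?h w (\<lambda>x. t *\<^sub>R v x) = t * ?h w v" using lin[OF w v v, of t 0] by simp
      then show ?thesis
        using bound[OF w W_scale[OF v, of t]] that by (simp add: scale[OF v] abs_mult)
    qed
    show ?thesis
    proof (cases "?h v v = 0")
      case True
      have "\<bar>?h w v\<bar> = 0"
      proof (rule ccontr)
        assume "\<bar>?h w v\<bar> \<noteq> 0"
        \<comment> \<open>When v has zero energy, t can be as large as desired; this value of t
          already gives the contradiction h(w,w) + 1 \<le> h(w,w).\<close>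
        then have "(?h w w + 1) / \<bar>?h w v\<bar> * \<bar>?h w v\<bar> \<le> ?h w w"
          using scaled[of "(?h w w + 1) / \<bar>?h w v\<bar>"] nonneg[of w] True by (simp add: zero_less_divide_iff)
        then show False using \<open>\<bar>?h w v\<bar> \<noteq> 0\<close> by simp
      qed
      then show ?thesis using True by (simp add: N_def)
    next
      case False
      then have S: "0 < ?h v v" using nonneg[of v] by simp
      then have N0: "0 < ?N v" by (simp add: N_def)
      \<comment> \<open>The choice t = 1 / N(v) scales v to energy 1.\<close>
      have "(1 / ?N v) powr q * ?h v v = 1"
        using S q0 by (simp add: N_def powr_divide powr_powr)
      then have "1 / ?N v * \<bar>?h w v\<bar> \<le> ?h w w + 1"
        using scaled[of "1 / ?N v"] N0 by simp
      then show ?thesis using N0 by (simp add: field_simps)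
    qed
  qed
  have "op_A p k n M \<tau> w \<in> dual_space ?Z ?N" if "w \<in> ?Z" for w
    unfolding dual_space_def op_A_def
    using lin[OF W\<tau>[OF that] ZW ZW] bounded[OF W\<tau>[OF that] ZW] by blast
  moreover have "\<exists>\<delta>>0. \<forall>z\<in>?Z. ?N (\<lambda>x. w x - z x) < \<delta> \<longrightarrow>
      dual_norm ?Z ?N (\<lambda>v. op_A p k n M \<tau> w v - op_A p k n M \<tau> z v) < \<epsilon>"
    if w: "w \<in> ?Z" and \<epsilon>: "0 < \<epsilon>" for w and \<epsilon> :: real
  proof -
    let ?w = "\<lambda>x. w x + \<tau> x"
    \<comment> \<open>Makes the \<eta>-term at most \<epsilon>/4 for every v of energy at most
      1.\<close>
    define \<eta> where "\<eta> = \<epsilon> / (4 * (?h ?w ?w + 1))"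
    have \<eta>: "0 < \<eta>" "\<eta> * (?h ?w ?w + 1) = \<epsilon> / 4"
      using \<epsilon> nonneg[of ?w] by (auto simp: \<eta>_def field_simps add_pos_nonneg)
    obtain C where C0: "0 \<le> C" and C: "\<forall>\<alpha> \<beta> \<gamma> m x y. 0 \<le> \<alpha> \<longrightarrow> 0 \<le> \<beta> \<longrightarrow> 0 \<le> \<gamma> \<longrightarrow>
      \<bar>x\<bar> \<le> \<alpha> * \<gamma> \<longrightarrow> \<bar>y\<bar> \<le> \<beta> * \<gamma> \<longrightarrow> \<bar>x - y\<bar> \<le> m * \<gamma> \<longrightarrow> \<bar>\<alpha> - \<beta>\<bar> \<le> m \<longrightarrow>
      \<bar>\<alpha> powr (conj_exp p - 2) * x - \<beta> powr (conj_exp p - 2) * y\<bar> \<le>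
        \<eta> * (\<alpha> powr conj_exp p + \<gamma> powr conj_exp p) + C * m powr conj_exp p"
      using duality_map_difference[OF q \<eta>(1)] by (elim exE conjE)
    \<comment> \<open>The exponent 1/q converts the norm back to the energy, so closeness bounds h(w
      - z, w - z) by \<epsilon>/(4 (C + 1)); adding 1 keeps the quotient meaningful if C =
      0.\<close>
    define \<delta> where "\<delta> = (\<epsilon> / (4 * (C + 1))) powr (1 / q)"
    have "0 < \<delta>" using \<epsilon> C0 by (simp add: \<delta>_def)
    moreover have "dual_norm ?Z ?N (\<lambda>v. op_A p k n M \<tau> w v - op_A p k n M \<tau> z v) < \<epsilon>"
      if z: "z \<in> ?Z" and close: "?N (\<lambda>x. w x - z x) < \<delta>" for z
    proof -
      let ?z = "\<lambda>x. z x + \<tau> x" and ?d = "\<lambda>x. w x - z x"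
      have "?h ?d ?d < \<epsilon> / (4 * (C + 1))"
      proof (rule ccontr)
        assume "\<not> ?h ?d ?d < \<epsilon> / (4 * (C + 1))"
        then have "\<delta> \<le> ?N ?d"
          unfolding \<delta>_def N_def using \<epsilon> C0 q0 by (intro powr_mono2) auto
        then show False using close by simp
      qed
      then have "C * ?h ?d ?d \<le> C * (\<epsilon> / (4 * (C + 1)))" using C0 by (intro mult_left_mono) auto
      also have "\<dots> \<le> \<epsilon> / 4" using C0 \<epsilon> by (simp add: field_simps)
      finally have Cd: "C * ?h ?d ?d \<le> \<epsilon> / 4" .
      \<comment> \<open>The estimates leave \<epsilon>/2, which keeps a margin: passing to the
        supremum preserves only the non-strict inequality.\<close>
      have "\<bar>op_A p k n M \<tau> w v - op_A p k n M \<tau> z v\<bar> \<le> \<epsilon> / 2" if v: "v \<in> {v \<in> ?Z. ?N v \<le> 1}" for v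
      proof -
        have vW: "v \<in> W" using v ZW by simp
        have "?h v v \<le> 1"
        proof (rule ccontr)
          assume "\<not> ?h v v \<le> 1"
          then have "1 powr (1 / q) < ?h v v powr (1 / q)" using q0 by (intro powr_less_mono2) auto
          then show False using v by (simp add: N_def)
        qed
        have "\<bar>op_A p k n M \<tau> w v - op_A p k n M \<tau> z v\<bar> =
            \<bar>\<Sum>E\<in>M. elt_form p k n E ?w v - elt_form p k n E ?z v\<bar>"
          by (simp add: op_A_def form_h_elt_form sum_subtractf)
        also have "\<dots> \<le> (\<Sum>E\<in>M. \<eta> * (elt_form p k n E ?w ?w + elt_form p k n E v v) +
            C * elt_form p k n E (\<lambda>x. ?w x - ?z x) (\<lambda>x. ?w x - ?z x))"
          by (intro order_trans[OF sum_abs] sum_mono mesh_element.elt_form_difference[OF elem q]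
              C[rule_format] Wt W\<tau> w z vW)
        \<comment> \<open>The field \<tau> cancels in the difference, so the last term is C times
          the energy of w - z.\<close>
        also have "\<dots> = \<eta> * (?h ?w ?w + ?h v v) + C * ?h ?d ?d"
          by (simp add: form_h_elt_form sum.distrib sum_distrib_left distrib_left)
        also have "\<dots> \<le> \<eta> * (?h ?w ?w + 1) + \<epsilon> / 4"
          using \<open>?h v v \<le> 1\<close> \<eta>(1) Cd by (intro add_mono mult_left_mono) auto
        finally show ?thesis using \<eta>(2) by simp
      qed
      moreover have "(\<lambda>x. 0) \<in> {v \<in> ?Z. ?N v \<le> 1}"
      proof -
        have "?h (\<lambda>x. 0) (\<lambda>x. 0) = 0"
          using scale[OF ZW[OF zero_in_Zh], of 0] by simp
        then show ?thesis using zero_in_Zh by (simp add: N_def)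
      qed
      ultimately have "dual_norm ?Z ?N (\<lambda>v. op_A p k n M \<tau> w v - op_A p k n M \<tau> z v) \<le> \<epsilon> / 2"
        unfolding dual_norm_def by (intro cSUP_least) blast+
      then show ?thesis using \<epsilon> by simp
    qed
    ultimately show ?thesis by blast
  qed
  ultimately show ?thesis by blast
qed

end
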